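(* Let $M\subset K^n$ be a $K$-analytic manifold of finite type, let $S$ be a compact open subset of $M$, and let $k>0$ be the type of the $K$-analytic manifold $S$. Suppose that the characteristic of $K$ is either $0$ or $>k$. Let $\mu_S$ be the induced measure on $S$ and, for $y\in K^n$, put $$\widehat{\mu}_S(y):=\int_{x\in S}\psi(y\cdot x)\,d\mu_S(x).$$ Then $$\lim_{|y|\to\infty}\widehat{\mu}_S(y)=0,$$ and, more precisely, there exists a constant $c$ such that $$|\widehat{\mu}_S(y)|\leq c\,|y|^{-\frac1k}\quad\text{for all nonzero } y\in K^n.$$
   Context: $K$ is a non-archimedean local field with valuation ring $\mathcal{O}_K$, maximal ideal $\mathcal{M}_K$, and residue field with $q_K$ elements. The norm on $K$ is normalized so that a uniformizer has norm $q_K^{-1}$, and $|x|=\max_i|x_i|$ for $x\in K^n$. $\psi:K\to\mathbf{C}^\times$ is an additive character of $K$ which is trivial on $\mathcal{M}_K$ and nontrivial on $\mathcal{O}_K$. For $x,y\in K^n$, $y\cdot x=\sum_i y_ix_i$. $K$-analytic functions: for $X\subset K^d$ open, $f:X\to K^m$ is $K$-analytic if there is an open cover of $X$ such that on each open $U$ of the cover $f$ is given by $m$ power series converging on $U$. $K$-analytic manifolds: a subset $M\subset K^n$ is a $K$-analytic manifold of dimension $d$ if there is an open cover of $M$ such that for each open $U$ in the cover there is a coordinate projection $p_U:K^n\to K^d$ onto $d$ of the $n$ standard coordinates inducing a bijection $U\to U'$ onto an open $U'\subset K^d$, and there are $K$-analytic functions $f_1,\dots,f_n:U'\to K$ such that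 $f=(f_1,\dots,f_n)$ is the inverse of $p_U$ on $U$. The cover and the projections can be chosen such that the $p_U$ are isometries on $U$; the induced measure $\mu_M$ on $M$ is the pull-back via these isometries of the Haar measure on $K^d$ normalized so that $\mathcal{O}_K^d$ has measure $1$. A $K$-analytic manifold is a $K$-analytic manifold of some dimension $d$. An open subset of a $K$-analytic manifold is again a $K$-analytic manifold. Type: let $M\subset K^n$ be a $K$-analytic manifold of dimension $d$, $x_0\in M$, and let $f=(f_1,\dots,f_n):U'\to U\subset M$ be analytic coordinates on $M$ with $x_0\in U$, that is, $U$ is an open subset of $M$ containing $x_0$, $p_U:K^n\to K^d$ is a coordinate projection onto $d$ of the $n$ standard coordinates inducing a bijection from $U$ onto an open $U'\subset K^d$, and $f_1,\dots,f_n:U'\to K$ are $K$-analytic functions such that $f$ is the inverse of $p_U$ on $U$. $M$ is of finite type at $x_0$ if there exists $k>0$ such that for each nonzero $v\in K^n$ there exists $\alpha\in\mathbf{N}^d$ with $k\geq|\alpha|:=\sum_{i=1}^d\alpha_i>0$ and $$v\cdot(\partial^\alpha f/\partial x^\alpha)\neq0$$ at the point of $U'$ corresponding to $x_0$; the least such $k$ is the type of $M$ at $x_0$. $M$ is of finite type if it is of finite type at all its points. If there is $k$ such that $M$ is of type $\leq k$ at each of its points, the least such integer $k$ is called the type of $M$. If $M$ is of finite type and $S$ is compact open in $M$, then $S$ is of type $k$ for some $k>0$. *)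

theory Defs
  imports "HOL-Analysis.Analysis"
begin

section \<open>Non-archimedean local fields\<close>

text \<open>
  The normed field classes of HOL are algebras over the reals, hence archimedean, so the
  field is a type class of its own, with norm \<open>knorm\<close>. Its metric is the one of the library
  class, so that the library topology and Borel sets apply to \<open>'k\<close> and \<open>'k ^ 'n\<close>.
\<close>

class nonarch_valued_field = field + metric_space +
  fixes knorm :: "'a \<Rightarrow> real"
  assumes dist_knorm: "dist x y = knorm (x - y)"
    and knorm_eq_zero: "knorm x = 0 \<longleftrightarrow> x = 0"
    and knorm_mult: "knorm (x * y) = knorm x * knorm y"
    and knorm_add: "knorm (x + y) \<le> max (knorm x) (knorm y)"

definition (in nonarch_valued_field) valuation_ring :: "'a set" where
  "valuation_ring = {x. knorm x \<le> 1}"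

definition (in nonarch_valued_field) maximal_ideal :: "'a set" where
  "maximal_ideal = {x. knorm x < 1}"

definition (in nonarch_valued_field) residue_field :: "'a set set" where
  "residue_field = valuation_ring //
     {(x, y). x \<in> valuation_ring \<and> y \<in> valuation_ring \<and> x - y \<in> maximal_ideal}"

text \<open>
  A local field is complete, its maximal ideal is generated by one nonzero element (that is, the
  valuation is discrete and nontrivial), and its residue field is finite. Giving the
  generator the inverse of the residue field cardinality as its norm fixes the normalization.
\<close>

class nonarch_local_field = nonarch_valued_field + complete_space +
  assumes finite_residue_field: "finite residue_field"
    and normalized_uniformizer:
      "\<exists>\<pi>. \<pi> \<noteq> 0 \<and> maximal_ideal = (\<lambda>x. \<pi> * x) ` valuation_ring \<and>
         knorm \<pi> = 1 / real (card residue_field)"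

definition additive_character :: "('k::nonarch_local_field \<Rightarrow> complex) \<Rightarrow> bool" where
  "additive_character \<psi> \<longleftrightarrow> (\<forall>x. \<psi> x \<noteq> 0) \<and> (\<forall>x y. \<psi> (x + y) = \<psi> x * \<psi> y)"

text \<open>
  The topology of the library on \<open>'k ^ 'n\<close> is the product topology, but the library metric there
  is the Euclidean combination of the coordinate distances, so the maximum norm is defined
  separately. It induces the same topology.
\<close>

definition max_norm :: "'k::nonarch_local_field ^ 'n \<Rightarrow> real" where
  "max_norm x = Max (range (\<lambda>i. knorm (x $ i)))"

definition dot :: "'k::nonarch_local_field ^ 'n \<Rightarrow> 'k ^ 'n \<Rightarrow> 'k" where
  "dot y x = (\<Sum>i\<in>UNIV. y $ i * x $ i)"

section \<open>Analytic functions and partial derivatives\<close>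

text \<open>
  Power series may be expanded about any centre \<open>a\<close>. Their convergence is unconditional, which
  over a non-archimedean field means that the terms tend to zero.
\<close>

definition K_analytic_on ::
  "('k::nonarch_local_field ^ 'd \<Rightarrow> 'k ^ 'm) \<Rightarrow> ('k ^ 'd) set \<Rightarrow> bool" where
  "K_analytic_on f X \<longleftrightarrow>
     (\<forall>x\<in>X. \<exists>U. open U \<and> x \<in> U \<and> U \<subseteq> X \<and>
        (\<exists>(a :: 'k ^ 'd) (c :: 'm \<Rightarrow> ('d \<Rightarrow> nat) \<Rightarrow> 'k). \<forall>y\<in>U. \<forall>j.
           ((\<lambda>\<alpha>. c j \<alpha> * (\<Prod>i\<in>UNIV. (y $ i - a $ i) ^ \<alpha> i)) has_sum f y $ j) UNIV))"

definition partial_deriv ::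
  "'d \<Rightarrow> ('k::nonarch_local_field ^ 'd \<Rightarrow> 'k) \<Rightarrow> 'k ^ 'd \<Rightarrow> 'k" where
  "partial_deriv i g x = Lim (at 0) (\<lambda>h. (g (x + axis i h) - g x) / h)"

text \<open>
  For a multi-index \<open>\<alpha>\<close> the operator applies \<open>partial_deriv i\<close> exactly \<open>\<alpha> i\<close> times for each \<open>i\<close>.
  Since the index type carries no order, some order is chosen; for analytic functions the
  result does not depend on it, because partial derivatives commute.
\<close>

definition multi_deriv ::
  "('d \<Rightarrow> nat) \<Rightarrow> ('k::nonarch_local_field ^ 'd \<Rightarrow> 'k) \<Rightarrow> 'k ^ 'd \<Rightarrow> 'k" where
  "multi_deriv \<alpha> g = foldr partial_deriv (SOME is. \<forall>i. count_list is i = \<alpha> i) g"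

section \<open>Analytic manifolds and their type\<close>

text \<open>
  The dimension is the cardinality of the index type \<open>'d\<close>, and an injection \<open>\<sigma>\<close> from \<open>'d\<close> into
  \<open>'n\<close> selects the coordinates onto which one projects.
\<close>

definition coord_proj :: "('d \<Rightarrow> 'n) \<Rightarrow> 'k::nonarch_local_field ^ 'n \<Rightarrow> 'k ^ 'd" where
  "coord_proj \<sigma> x = (\<chi> i. x $ \<sigma> i)"

definition analytic_chart ::
  "('k::nonarch_local_field ^ 'n) set \<Rightarrow> ('k ^ 'n) set \<Rightarrow> ('d \<Rightarrow> 'n) \<Rightarrow> ('k ^ 'd \<Rightarrow> 'k ^ 'n) \<Rightarrow> bool"
  where
  "analytic_chart M U \<sigma> f \<longleftrightarrow>
     openin (top_of_set M) U \<and> inj \<sigma> \<and>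
     inj_on (coord_proj \<sigma>) U \<and> open (coord_proj \<sigma> ` U) \<and>
     K_analytic_on f (coord_proj \<sigma> ` U) \<and> (\<forall>x\<in>U. f (coord_proj \<sigma> x) = x)"

definition analytic_manifold ::
  "'d::finite itself \<Rightarrow> ('k::nonarch_local_field ^ 'n) set \<Rightarrow> bool" where
  "analytic_manifold (_ :: 'd::finite itself) M \<longleftrightarrow>
     (\<forall>x\<in>M. \<exists>U (\<sigma> :: 'd \<Rightarrow> 'n) f. x \<in> U \<and> analytic_chart M U \<sigma> f)"

text \<open>
  The condition below does not depend on the coordinates \<open>f\<close> around \<open>x0\<close> (chain rule); it is
  required for all of them.
\<close>

definition type_le_at ::
  "'d::finite itself \<Rightarrow> ('k::nonarch_local_field ^ 'n) set \<Rightarrow> 'k ^ 'n \<Rightarrow> nat \<Rightarrow> bool" where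
  "type_le_at (_ :: 'd::finite itself) M x0 k \<longleftrightarrow>
     0 < k \<and>
     (\<forall>U (\<sigma> :: 'd \<Rightarrow> 'n) f. analytic_chart M U \<sigma> f \<and> x0 \<in> U \<longrightarrow>
        (\<forall>v. v \<noteq> 0 \<longrightarrow>
           (\<exists>\<alpha>. 0 < (\<Sum>i\<in>UNIV. \<alpha> i) \<and> (\<Sum>i\<in>UNIV. \<alpha> i) \<le> k \<and>
              dot v (\<chi> j. multi_deriv \<alpha> (\<lambda>x. f x $ j) (coord_proj \<sigma> x0)) \<noteq> 0)))"

definition finite_type ::
  "'d::finite itself \<Rightarrow> ('k::nonarch_local_field ^ 'n) set \<Rightarrow> bool" where
  "finite_type D M \<longleftrightarrow> (\<forall>x\<in>M. \<exists>k. type_le_at D M x k)"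

definition has_type ::
  "'d::finite itself \<Rightarrow> ('k::nonarch_local_field ^ 'n) set \<Rightarrow> nat \<Rightarrow> bool" where
  "has_type D M k \<longleftrightarrow>
     0 < k \<and> (\<forall>x\<in>M. type_le_at D M x k) \<and>
     (\<forall>l. 0 < l \<and> (\<forall>x\<in>M. type_le_at D M x l) \<longrightarrow> k \<le> l)"

section \<open>Haar measure, induced measure and Fourier transform\<close>

definition normalized_haar :: "('k::nonarch_local_field ^ 'd) measure \<Rightarrow> bool" where
  "normalized_haar \<nu> \<longleftrightarrow>
     sets \<nu> = sets borel \<and>
     (\<forall>a. \<forall>A\<in>sets borel. emeasure \<nu> ((\<lambda>x. a + x) ` A) = emeasure \<nu> A) \<and>
     emeasure \<nu> {x. \<forall>i. x $ i \<in> valuation_ring} = 1"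

text \<open>
  \<open>\<mu>\<close> is a Borel measure on \<open>M\<close>, and \<open>M\<close> is covered by charts whose projections are isometries
  along which \<open>\<mu>\<close> is the pull-back of the Haar measure \<open>\<nu>\<close>. This determines \<open>\<mu>\<close>, since \<open>M\<close> is
  second countable and isometries between open subsets of \<open>'k ^ 'd\<close> preserve \<open>\<nu>\<close>.
\<close>

definition induced_measure ::
  "('k::nonarch_local_field ^ 'd) measure \<Rightarrow> ('k ^ 'n) set \<Rightarrow> ('k ^ 'n) measure \<Rightarrow> bool" where
  "induced_measure \<nu> M \<mu> \<longleftrightarrow>
     space \<mu> = M \<and> sets \<mu> = sets (restrict_space borel M) \<and>
     (\<forall>x\<in>M. \<exists>U (\<sigma> :: 'd \<Rightarrow> 'n) f. x \<in> U \<and> analytic_chart M U \<sigma> f \<and>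
        (\<forall>y\<in>U. \<forall>z\<in>U. max_norm (coord_proj \<sigma> y - coord_proj \<sigma> z) = max_norm (y - z)) \<and>
        (\<forall>A\<in>sets \<mu>. A \<subseteq> U \<longrightarrow> emeasure \<mu> A = emeasure \<nu> (coord_proj \<sigma> ` A)))"

definition fourier_transform ::
  "('k::nonarch_local_field \<Rightarrow> complex) \<Rightarrow> ('k ^ 'n) measure \<Rightarrow> 'k ^ 'n \<Rightarrow> complex" where
  "fourier_transform \<psi> \<mu> y = (\<integral>x. \<psi> (dot y x) \<partial>\<mu>)"

end

theory Submission
  imports Defs "HOL-Computational_Algebra.Polynomial"
begin

text \<open>
  The decay comes from a van der Corput estimate along lines. Write a large \<open>y\<close> as \<open>t v\<close> with
  \<open>v\<close> on the unit sphere. Near a point of \<open>S\<close> the phase \<open>y \<cdot> x\<close> becomes \<open>t g\<close> in an isometric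
  chart \<open>f\<close>, where \<open>g = v \<cdot> f\<close> is given by a power series. Finite type says that some Taylor
  coefficient of \<open>g\<close> of an order \<open>m\<close> with \<open>1 \<le> m \<le> k\<close> is nonzero. So the form of degree \<open>m\<close> in
  the expansion of \<open>g\<close> does not vanish in some direction \<open>w\<close>, and on short segments in the
  direction \<open>w\<close> the phase is a one-variable series whose coefficient of order \<open>m\<close> dominates all
  higher ones. The mean of \<open>\<psi> (t g)\<close> over such a segment is \<open>O(|t|^(-1/m))\<close>, uniformly for nearby
  lines and nearby \<open>v\<close>.

  The one-variable estimate (\<open>van_der_corput\<close>) goes by induction on the order \<open>n\<close> of the
  dominating coefficient. For \<open>n = 1\<close> the phase is linear up to terms that are negligible, and
  the mean is zero as soon as that coefficient has norm at least \<open>1\<close>. For larger \<open>n\<close>, the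
  Taylor coefficient of order \<open>n - 1\<close> is a scaled isometry of the point at which it is taken, the
  scaling factor containing \<open>n\<close>; this is where the characteristic enters. Hence it is small on
  at most one residue class. On the other classes the case \<open>n - 1\<close> applies after zooming in, and on
  the exceptional class zooming in reproduces the original situation at a smaller scale.

  Two devices keep the analysis finite. Since \<open>\<psi>\<close> is trivial on the maximal ideal, for each \<open>t\<close> a
  power series may be replaced by a polynomial, so only polynomials are restricted to lines
  (\<open>power_series_truncate\<close>). And since the Haar measure is translation invariant, the integral
  over a polydisc equals the integral of the finite averages along segments inside the polydisc
  (\<open>norm_integral_le_line_avg\<close>), which takes the place of a product decomposition of the measure.

  The local bounds are summed over \<open>S\<close> by compactness: polydiscs are disjoint or nested, so the
  maximal ones in a finite covering form a partition. Compactness of the unit sphere then makes the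
  constant independent of \<open>v\<close>.
\<close>

section \<open>Arithmetic of a non-archimedean local field\<close>

context nonarch_valued_field
begin

lemma knorm_zero [simp]: "knorm 0 = 0"
  using knorm_eq_zero by simp

lemma knorm_ge_0 [simp]: "0 \<le> knorm x"
proof -
  have "knorm x = dist x 0" by (simp add: dist_knorm)
  thus ?thesis by simp
qed

lemma knorm_pos_iff [simp]: "0 < knorm x \<longleftrightarrow> x \<noteq> 0"
  using knorm_ge_0[of x] knorm_eq_zero[of x] by linarith

lemma knorm_one [simp]: "knorm 1 = 1"
proof -
  have "knorm 1 * knorm 1 = knorm 1" using knorm_mult[of 1 1] by simp
  thus ?thesis by (simp add: knorm_eq_zero)
qed

lemma knorm_minus [simp]: "knorm (- x) = knorm x"
proof -
  have "knorm (- x) = dist 0 x" by (simp add: dist_knorm)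
  also have "\<dots> = dist x 0" by (rule dist_commute)
  finally show ?thesis by (simp add: dist_knorm)
qed

lemma knorm_minus_commute: "knorm (x - y) = knorm (y - x)"
  using knorm_minus[of "x - y"] by simp

lemma knorm_power: "knorm (x ^ n) = knorm x ^ n"
  by (induction n) (auto simp: knorm_mult)

lemma knorm_add_le: "knorm x \<le> B \<Longrightarrow> knorm y \<le> B \<Longrightarrow> knorm (x + y) \<le> B"
  using knorm_add[of x y] by linarith

lemma knorm_add_less: "knorm x < B \<Longrightarrow> knorm y < B \<Longrightarrow> knorm (x + y) < B"
  using knorm_add[of x y] by linarith

lemma knorm_diff_le: "knorm x \<le> B \<Longrightarrow> knorm y \<le> B \<Longrightarrow> knorm (x - y) \<le> B"
  using knorm_add_le[of x B "- y"] by simp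

lemma knorm_diff_less: "knorm x < B \<Longrightarrow> knorm y < B \<Longrightarrow> knorm (x - y) < B"
  using knorm_add_less[of x B "- y"] by simp

lemma knorm_add_eq: "knorm y < knorm x \<Longrightarrow> knorm (x + y) = knorm x"
  using knorm_add[of x y] knorm_add[of "x + y" "- y"] by simp

lemma knorm_sum_le:
  assumes "\<And>i. i \<in> I \<Longrightarrow> knorm (f i) \<le> B" "0 \<le> B"
  shows "knorm (\<Sum>i\<in>I. f i) \<le> B"
  using assms by (induction I rule: infinite_finite_induct) (auto intro!: knorm_add_le)

lemma knorm_sum_less:
  assumes "\<And>i. i \<in> I \<Longrightarrow> knorm (f i) < B" "0 < B"
  shows "knorm (\<Sum>i\<in>I. f i) < B"
  using assms by (induction I rule: infinite_finite_induct) (auto intro!: knorm_add_less)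

lemma knorm_prod: "knorm (\<Prod>i\<in>I. f i) = (\<Prod>i\<in>I. knorm (f i))"
  by (induction I rule: infinite_finite_induct) (auto simp: knorm_mult)

lemma knorm_of_nat_le [simp]: "knorm (of_nat n) \<le> 1"
  by (induction n) (auto intro!: knorm_add_le)

lemma knorm_mult_le: "knorm x \<le> A \<Longrightarrow> knorm y \<le> B \<Longrightarrow> knorm (x * y) \<le> A * B"
  unfolding knorm_mult by (rule mult_mono) (auto intro: order_trans[OF knorm_ge_0])

lemma knorm_mult_le_right: "knorm y \<le> 1 \<Longrightarrow> knorm x \<le> B \<Longrightarrow> knorm (x * y) \<le> B"
  using knorm_mult_le[of x B y 1] by simp

lemma knorm_mult_le_left: "knorm x \<le> 1 \<Longrightarrow> knorm y \<le> B \<Longrightarrow> knorm (x * y) \<le> B"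
  using knorm_mult_le[of x 1 y B] by simp

lemma knorm_power_le_1: "knorm x \<le> 1 \<Longrightarrow> knorm (x ^ n) \<le> 1"
  by (simp add: knorm_power power_le_one)

lemma knorm_prod_le_1: "(\<And>i. i \<in> I \<Longrightarrow> knorm (f i) \<le> 1) \<Longrightarrow> knorm (\<Prod>i\<in>I. f i) \<le> 1"
  by (simp add: knorm_prod prod_le_1)

end

lemma knorm_inverse: "knorm (inverse x :: 'k::nonarch_valued_field) = inverse (knorm x)"
proof (cases "x = 0")
  case False
  hence "knorm x * knorm (inverse x) = 1" by (simp flip: knorm_mult)
  thus ?thesis using inverse_unique by metis
qed auto

lemma knorm_divide: "knorm (x / y :: 'k::nonarch_valued_field) = knorm x / knorm y"
  by (simp add: divide_inverse knorm_mult knorm_inverse)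

definition unif :: "'k::nonarch_local_field" where
  "unif = (SOME \<pi>. \<pi> \<noteq> 0 \<and> maximal_ideal = (\<lambda>x. \<pi> * x) ` valuation_ring \<and>
         knorm \<pi> = 1 / real (card (residue_field :: 'k set set)))"

definition residue_card :: "'k::nonarch_local_field itself \<Rightarrow> nat" where
  "residue_card _ = card (residue_field :: 'k set set)"

lemma unif_props:
  "(unif :: 'k::nonarch_local_field) \<noteq> 0"
  "maximal_ideal = (\<lambda>x. (unif :: 'k) * x) ` valuation_ring"
  "knorm (unif :: 'k) = 1 / real (residue_card TYPE('k))"
  using someI_ex[OF normalized_uniformizer[where 'a = 'k], folded unif_def] by (auto simp: residue_card_def)

lemma knorm_unif_less_1 [simp]: "knorm (unif :: 'k::nonarch_local_field) < 1"
proof -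
  have "(unif :: 'k) * 1 \<in> (\<lambda>x. (unif :: 'k) * x) ` valuation_ring"
    by (intro imageI) (simp add: valuation_ring_def)
  thus ?thesis unfolding unif_props(2)[symmetric] by (simp add: maximal_ideal_def)
qed

lemma knorm_unif_le_1 [simp]: "knorm (unif :: 'k::nonarch_local_field) \<le> 1"
  by (rule less_imp_le) simp

lemma unif_neq_0 [simp]: "(unif :: 'k::nonarch_local_field) \<noteq> 0"
  by (rule unif_props(1))

lemma residue_card_gt_1: "residue_card TYPE('k::nonarch_local_field) > 1"
proof -
  have "knorm (unif :: 'k) > 0" by simp
  hence "real (residue_card TYPE('k)) > 0" unfolding unif_props(3) by (simp add: zero_less_divide_iff)
  moreover have "1 / real (residue_card TYPE('k)) < 1"
    using knorm_unif_less_1[where 'k = 'k] unfolding unif_props(3) .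
  ultimately show ?thesis by (simp add: field_simps)
qed

lemma less_1_imp_le_unif:
  assumes "knorm (x :: 'k::nonarch_local_field) < 1"
  shows "\<exists>y. knorm y \<le> 1 \<and> x = unif * y"
proof -
  have "x \<in> maximal_ideal" using assms by (simp add: maximal_ideal_def)
  thus ?thesis unfolding unif_props(2)[where 'k = 'k] by (auto simp: valuation_ring_def)
qed

definition residue_rel :: "('k::nonarch_local_field \<times> 'k) set" where
  "residue_rel = {(x, y). x \<in> valuation_ring \<and> y \<in> valuation_ring \<and> x - y \<in> maximal_ideal}"

lemma equiv_residue_rel: "equiv valuation_ring (residue_rel :: ('k::nonarch_local_field \<times> 'k) set)"
proof (rule equivI)
  show "residue_rel \<subseteq> (valuation_ring :: 'k set) \<times> valuation_ring"
    by (auto simp: residue_rel_def)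
  show "refl_on (valuation_ring :: 'k set) residue_rel"
    by (auto simp: refl_on_def residue_rel_def maximal_ideal_def)
  show "sym (residue_rel :: ('k \<times> 'k) set)"
    by (auto simp: sym_def residue_rel_def maximal_ideal_def knorm_minus_commute)
  show "trans (residue_rel :: ('k \<times> 'k) set)"
  proof (rule transI)
    fix x y z :: 'k assume "(x, y) \<in> residue_rel" "(y, z) \<in> residue_rel"
    thus "(x, z) \<in> residue_rel"
      using knorm_add_less[of "x - y" 1 "y - z"] by (auto simp: residue_rel_def maximal_ideal_def)
  qed
qed

lemma residue_field_eq: "(residue_field :: 'k::nonarch_local_field set set) = valuation_ring // residue_rel"
  by (simp add: residue_field_def residue_rel_def)

text \<open>
  One representative of each residue class. They are the digits of expansions in powers of the
  uniformizer \<open>unif\<close>.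
\<close>

definition digits :: "'k::nonarch_local_field set" where
  "digits = (\<lambda>C. SOME x. x \<in> C) ` residue_field"

lemma some_in_class:
  assumes "C \<in> (residue_field :: 'k::nonarch_local_field set set)"
  shows "(SOME x. x \<in> C) \<in> C"
  using in_quotient_imp_non_empty[OF equiv_residue_rel assms[unfolded residue_field_eq]]
  by (simp add: some_in_eq)

lemma digits_norm: "(b :: 'k::nonarch_local_field) \<in> digits \<Longrightarrow> knorm b \<le> 1"
  using some_in_class in_quotient_imp_subset[OF equiv_residue_rel]
  by (fastforce simp: digits_def residue_field_eq valuation_ring_def)

lemma digits_unique:
  assumes "(b :: 'k::nonarch_local_field) \<in> digits" "b' \<in> digits" "knorm (b - b') < 1"
  shows "b = b'"
proof -
  obtain C C' where C: "C \<in> residue_field" "C' \<in> residue_field"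
    "b = (SOME x. x \<in> C)" "b' = (SOME x. x \<in> C')"
    using assms by (auto simp: digits_def)
  have in_C: "b \<in> C" "b' \<in> C'" using some_in_class C by auto
  have "(b, b') \<in> residue_rel"
    using assms digits_norm by (auto simp: residue_rel_def valuation_ring_def maximal_ideal_def)
  hence "C = C'"
    using quotient_eqI[OF equiv_residue_rel C(1,2)[unfolded residue_field_eq] in_C] by auto
  thus ?thesis using C by simp
qed

lemma digits_exist:
  assumes "knorm (x :: 'k::nonarch_local_field) \<le> 1"
  shows "\<exists>b\<in>digits. knorm (x - b) < 1"
proof -
  define C where "C = residue_rel `` {x}"
  have C: "C \<in> residue_field"
    unfolding C_def residue_field_eq by (rule quotientI) (simp add: assms valuation_ring_def)
  have "(SOME x. x \<in> C) \<in> C" using some_in_class C by auto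
  moreover have "(SOME x. x \<in> C) \<in> digits" using C by (auto simp: digits_def)
  ultimately show ?thesis by (force simp: C_def residue_rel_def maximal_ideal_def)
qed

lemma finite_digits [simp]: "finite (digits :: 'k::nonarch_local_field set)"
  using finite_residue_field[where 'a = 'k] by (simp add: digits_def)

lemma card_digits: "card (digits :: 'k::nonarch_local_field set) = residue_card TYPE('k)"
  unfolding digits_def residue_card_def
proof (rule card_image, rule inj_onI)
  fix C C' :: "'k set" assume C: "C \<in> residue_field" "C' \<in> residue_field"
    "(SOME x. x \<in> C) = (SOME x. x \<in> C')"
  thus "C = C'"
    using quotient_eqI[OF equiv_residue_rel C(1,2)[unfolded residue_field_eq]
        some_in_class[OF C(1)] some_in_class[OF C(2)]]
      in_quotient_imp_subset[OF equiv_residue_rel C(1)[unfolded residue_field_eq]]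
      some_in_class[OF C(1)] 
    by (auto simp: residue_rel_def maximal_ideal_def valuation_ring_def)
qed

lemma digit_decomp:
  assumes "knorm (x :: 'k::nonarch_local_field) \<le> 1"
  obtains b c where "b \<in> digits" "knorm c \<le> 1" "x = b + unif * c"
proof -
  obtain b where b: "b \<in> digits" "knorm (x - b) < 1" using digits_exist assms by blast
  obtain c where "knorm c \<le> 1" "x - b = unif * c" using less_1_imp_le_unif b(2) by blast
  thus ?thesis using that[OF b(1)] by (metis add.commute diff_add_cancel)
qed

section \<open>Averages over the valuation ring\<close>

text \<open>
  The mean of \<open>F\<close> over the points with a digit expansion of length \<open>N\<close>. If \<open>F\<close> is constant on
  the cosets of the ideal generated by \<open>unif ^ N\<close>, this is the integral of \<open>F\<close> for the Haar
  probability measure of the valuation ring, obtained here by finite sums. The recursion is on the leading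
  digit, because the estimates subdivide the valuation ring into residue classes and zoom in.
\<close>

fun avg :: "nat \<Rightarrow> ('k::nonarch_local_field \<Rightarrow> complex) \<Rightarrow> complex" where
  "avg 0 F = F 0"
| "avg (Suc N) F = (\<Sum>b\<in>digits. avg N (\<lambda>u. F (b + unif * u))) / of_nat (card (digits :: 'k set))"

lemma card_digits_pos: "card (digits :: 'k::nonarch_local_field set) > 0"
  using residue_card_gt_1[where 'k = 'k] by (simp add: card_digits)

lemma knorm_digit_shift:
  "b \<in> digits \<Longrightarrow> knorm u \<le> 1 \<Longrightarrow> knorm (b + unif * (u :: 'k::nonarch_local_field)) \<le> 1"
  using digits_norm[of b] by (intro knorm_add_le) (auto intro!: knorm_mult_le_left)

lemma avg_cong:
  assumes "\<And>u. knorm u \<le> 1 \<Longrightarrow> F u = G u"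
  shows "avg N (F :: 'k::nonarch_local_field \<Rightarrow> complex) = avg N G"
  using assms
proof (induction N arbitrary: F G)
  case (Suc N)
  have "avg N (\<lambda>u. F (b + unif * u)) = avg N (\<lambda>u. G (b + unif * u))" if "b \<in> digits" for b
    by (rule Suc.IH) (use Suc.prems that in \<open>auto intro: knorm_digit_shift\<close>)
  thus ?case by simp
qed auto

lemma avg_cmult: "avg N (\<lambda>u :: 'k::nonarch_local_field. c * F u) = c * avg N F"
  by (induction N arbitrary: F) (auto simp: sum_distrib_left)

lemma avg_const [simp]: "avg N (\<lambda>u :: 'k::nonarch_local_field. c) = c"
  using card_digits_pos[where 'k = 'k] by (induction N) auto

lemma norm_mean_le:
  assumes "\<And>b. b \<in> (digits :: 'k::nonarch_local_field set) \<Longrightarrow> norm (f b :: complex) \<le> E b"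
  shows "norm ((\<Sum>b\<in>(digits :: 'k set). f b) / of_nat (card (digits :: 'k set)))
    \<le> (\<Sum>b\<in>(digits :: 'k set). E b) / real (card (digits :: 'k set))"
  using sum_norm_le[of "digits :: 'k set" f E] assms
  by (simp add: norm_divide divide_right_mono)

lemma norm_mean_le_const:
  assumes "\<And>b. b \<in> (digits :: 'k::nonarch_local_field set) \<Longrightarrow> norm (f b :: complex) \<le> B"
  shows "norm ((\<Sum>b\<in>(digits :: 'k set). f b) / of_nat (card (digits :: 'k set))) \<le> B"
  using norm_mean_le[of f "\<lambda>_. B"] assms card_digits_pos[where 'k = 'k] by (auto split: if_splits)

lemma norm_avg_le:
  assumes "\<And>u. knorm u \<le> 1 \<Longrightarrow> norm (F u) \<le> B"
  shows "norm (avg N (F :: 'k::nonarch_local_field \<Rightarrow> complex)) \<le> B"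
  using assms
proof (induction N arbitrary: F)
  case (Suc N)
  have "norm (avg N (\<lambda>u. F (b + unif * u))) \<le> B" if "b \<in> digits" for b
    by (rule Suc.IH) (use Suc.prems that in \<open>auto intro: knorm_digit_shift\<close>)
  from norm_mean_le_const[of "\<lambda>b. avg N (\<lambda>u. F (b + unif * u))", OF this] show ?case by simp
qed auto

text \<open>
  An average of depth \<open>s + N\<close> is a mean of averages of depth \<open>N\<close> over the discs of radius
  \<open>|unif|^s\<close>.
\<close>

lemma norm_avg_zoom:
  assumes "\<And>b. knorm b \<le> 1 \<Longrightarrow> norm (avg N (\<lambda>u. F (b + unif ^ s * u))) \<le> B"
  shows "norm (avg (s + N) (F :: 'k::nonarch_local_field \<Rightarrow> complex)) \<le> B"
  using assms
proof (induction s arbitrary: F)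
  case 0
  thus ?case using "0.prems"[of 0] by simp
next
  case (Suc s)
  have "norm (avg (s + N) (\<lambda>u. F (b + unif * u))) \<le> B" if "b \<in> digits" for b
  proof (rule Suc.IH)
    fix c :: 'k assume "knorm c \<le> 1"
    thus "norm (avg N (\<lambda>u. F (b + unif * (c + unif ^ s * u)))) \<le> B"
      using Suc.prems[of "b + unif * c"] knorm_digit_shift[OF that, of c]
      by (simp add: algebra_simps)
  qed
  from norm_mean_le_const[of "\<lambda>b. avg (s + N) (\<lambda>u. F (b + unif * u))", OF this] show ?case by simp
qed

text \<open>
  A translation permutes the residue classes. From a class to its image it acts on the remaining
  digits as the translation by a carry, to which the induction hypothesis applies.
\<close>

lemma avg_translate:
  fixes F :: "'k::nonarch_local_field \<Rightarrow> complex"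
  assumes "\<And>u c. knorm u \<le> 1 \<Longrightarrow> knorm c \<le> 1 \<Longrightarrow> F (u + unif ^ N * c) = F u"
    and "knorm a \<le> 1"
  shows "avg N (\<lambda>u. F (u + a)) = avg N F"
  using assms
proof (induction N arbitrary: F a)
  case 0
  show ?case using "0.prems"(1)[of 0 a] "0.prems"(2) by simp
next
  case (Suc N)
  define \<tau> where "\<tau> b = (SOME b'. b' \<in> digits \<and> knorm (b + a - b') < 1)" for b
  have \<tau>: "\<tau> b \<in> digits" "knorm (b + a - \<tau> b) < 1" if "b \<in> digits" for b
  proof -
    have "knorm (b + a) \<le> 1" using that Suc.prems digits_norm by (auto intro!: knorm_add_le)
    hence "\<exists>b'. b' \<in> digits \<and> knorm (b + a - b') < 1" using digits_exist by blast
    from someI_ex[OF this] show "\<tau> b \<in> digits" "knorm (b + a - \<tau> b) < 1"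
      by (auto simp: \<tau>_def)
  qed
  have inj: "inj_on \<tau> digits"
  proof (rule inj_onI)
    fix b b' assume *: "b \<in> digits" "b' \<in> digits" "\<tau> b = \<tau> b'"
    have "knorm ((b + a - \<tau> b) - (b' + a - \<tau> b')) < 1"
      by (intro knorm_diff_less \<tau> *)
    hence "knorm (b - b') < 1" using * by (simp add: algebra_simps)
    thus "b = b'" using digits_unique * by blast
  qed
  hence img: "\<tau> ` digits = digits"
    using \<tau>(1) by (intro endo_inj_surj) auto
  have "avg N (\<lambda>u. F (b + unif * u + a)) = avg N (\<lambda>u. F (\<tau> b + unif * u))" if b: "b \<in> digits" for b
  proof -
    obtain c where c: "knorm c \<le> 1" "b + a - \<tau> b = unif * c"
      using less_1_imp_le_unif \<tau>(2)[OF b] by blast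
    define G where "G u = F (\<tau> b + unif * u)" for u
    have "avg N (\<lambda>u. G (u + c)) = avg N G"
    proof (rule Suc.IH)
      fix u e :: 'k assume ue: "knorm u \<le> 1" "knorm e \<le> 1"
      show "G (u + unif ^ N * e) = G u"
        using Suc.prems(1)[of "\<tau> b + unif * u" e] knorm_digit_shift[OF \<tau>(1)[OF b] ue(1)] ue(2)
        by (simp add: G_def algebra_simps)
    qed (use c in auto)
    moreover have "G (u + c) = F (b + unif * u + a)" for u
    proof -
      have "\<tau> b + unif * (u + c) = b + unif * u + a"
        using c(2) by (simp add: distrib_left) (metis (no_types, lifting) add.assoc add.commute diff_add_cancel)
      thus ?thesis by (simp add: G_def)
    qed
    ultimately show ?thesis by (simp add: G_def[abs_def])
  qed
  hence "(\<Sum>b\<in>digits. avg N (\<lambda>u. F (b + unif * u + a))) = (\<Sum>b\<in>digits. avg N (\<lambda>u. F (\<tau> b + unif * u)))"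
    by (intro sum.cong) auto
  also have "\<dots> = (\<Sum>b\<in>digits. avg N (\<lambda>u. F (b + unif * u)))"
    using sum.reindex[OF inj, of "\<lambda>b. avg N (\<lambda>u. F (b + unif * u))"] by (simp add: img)
  finally show ?case by simp
qed

section \<open>The additive character\<close>

locale nontrivial_character =
  fixes \<psi> :: "'k::nonarch_local_field \<Rightarrow> complex"
  assumes additive: "additive_character \<psi>"
    and trivial: "\<forall>x\<in>maximal_ideal. \<psi> x = 1"
    and nontrivial: "\<exists>x\<in>valuation_ring. \<psi> x \<noteq> 1"
begin

lemma char_add: "\<psi> (x + y) = \<psi> x * \<psi> y"
  using additive by (auto simp: additive_character_def)

lemma char_small: "knorm x < 1 \<Longrightarrow> \<psi> x = 1"
  using trivial by (auto simp: maximal_ideal_def)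

lemma char_cong: "knorm (x - y) < 1 \<Longrightarrow> \<psi> x = \<psi> y"
  using char_add[of "x - y" y] char_small[of "x - y"] by simp

lemma char_of_nat_mult: "\<psi> (of_nat n * x) = \<psi> x ^ n"
  by (induction n) (auto simp: char_small char_add distrib_right)

end

text \<open>
  Among \<open>q + 1\<close> multiples of \<open>1\<close> two lie in the same residue class; their difference is the
  required integer.
\<close>

lemma small_of_nat_exists: "\<exists>n>0. knorm (of_nat n :: 'k::nonarch_local_field) < 1"
proof -
  define \<delta> where "\<delta> n = (SOME b :: 'k. b \<in> digits \<and> knorm (of_nat n - b) < 1)" for n
  have \<delta>: "\<delta> n \<in> digits" "knorm (of_nat n - \<delta> n) < 1" for n
  proof -
    have "\<exists>b :: 'k. b \<in> digits \<and> knorm (of_nat n - b) < 1"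
      using digits_exist[of "of_nat n :: 'k"] by auto
    from someI_ex[OF this] show "\<delta> n \<in> digits" "knorm (of_nat n - \<delta> n) < 1"
      by (auto simp: \<delta>_def)
  qed
  have "\<not> inj_on \<delta> {..card (digits :: 'k set)}"
    using \<delta>(1) by (intro pigeonhole) (auto intro!: le_less_trans[OF card_mono[of digits]])
  then obtain m' n' where "m' \<noteq> n'" "\<delta> m' = \<delta> n'" by (auto simp: inj_on_def)
  then obtain m n where mn: "m < n" "\<delta> m = \<delta> n" by (metis nat_neq_iff)
  have "knorm ((of_nat n - \<delta> n) - (of_nat m - \<delta> m)) < 1"
    by (intro knorm_diff_less \<delta>)
  also have "(of_nat n - \<delta> n) - (of_nat m - \<delta> m) = (of_nat (n - m) :: 'k)"
    using mn by (simp add: of_nat_diff)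
  finally show ?thesis using mn by (intro exI[of _ "n - m"]) auto
qed

context nontrivial_character
begin

text \<open>
  Multiplication by a power of an integer of norm less than \<open>1\<close> moves \<open>x\<close> into the maximal ideal,
  hence \<open>\<psi> x\<close> is a root of unity.
\<close>

lemma norm_char [simp]: "norm (\<psi> x) = 1"
proof -
  obtain n where n: "n > 0" "knorm (of_nat n :: 'k) < 1" using small_of_nat_exists by blast
  obtain j where j: "knorm (of_nat n :: 'k) ^ j < inverse (1 + knorm x)"
    using real_arch_pow_inv[of "inverse (1 + knorm x)" "knorm (of_nat n :: 'k)"] n
    by (auto simp: add_pos_nonneg)
  have "knorm (of_nat (n ^ j) * x) \<le> inverse (1 + knorm x) * knorm x"
    using j by (auto simp: knorm_mult knorm_power intro!: mult_right_mono)
  also have "\<dots> < 1" by (simp add: field_simps add_pos_nonneg)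
  finally have "\<psi> x ^ (n ^ j) = 1"
    using char_small char_of_nat_mult[of "n ^ j" x] by simp
  hence "norm (\<psi> x) ^ (n ^ j) = 1" by (metis norm_one norm_power)
  moreover have "n ^ j > 0" using n by simp
  ultimately show ?thesis using power_eq_imp_eq_base[of "norm (\<psi> x)" "n ^ j" 1] by simp
qed

end

section \<open>Taylor coefficients of polynomials\<close>

text \<open>
  The coefficient of \<open>u ^ i\<close> in \<open>p (b + u)\<close>. Binomial coefficients replace the derivative divided
  by \<open>i!\<close>, since \<open>i!\<close> may vanish in the field.
\<close>

definition taylor :: "'k::nonarch_local_field poly \<Rightarrow> nat \<Rightarrow> 'k \<Rightarrow> 'k" where
  "taylor p i b = (\<Sum>j\<le>degree p. of_nat (j choose i) * coeff p j * b ^ (j - i))"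

lemma taylor_altdef:
  assumes "degree p \<le> n"
  shows "taylor p i b = (\<Sum>j\<le>n. of_nat (j choose i) * coeff p j * b ^ (j - i))"
  unfolding taylor_def using assms
  by (intro sum.mono_neutral_left) (auto simp: coeff_eq_0)

lemma poly_eq_taylor: "poly p b = taylor p 0 b"
  by (simp add: taylor_def poly_altdef)

lemma coeff_pcompose_linear: "coeff (p \<circ>\<^sub>p [:b, c:]) i = c ^ i * taylor p i b"
proof -
  have "p \<circ>\<^sub>p [:b, c:] = (\<Sum>j\<le>degree p. [:coeff p j:] * [:b, c:] ^ j)"
    unfolding pcompose_altdef poly_altdef
    by (simp add: degree_map_poly coeff_map_poly)
  hence "coeff (p \<circ>\<^sub>p [:b, c:]) i = (\<Sum>j\<le>degree p. coeff p j * coeff ([:b, c:] ^ j) i)"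
    by (simp add: coeff_sum)
  also have "\<dots> = (\<Sum>j\<le>degree p. c ^ i * (of_nat (j choose i) * coeff p j * b ^ (j - i)))"
  proof (rule sum.cong)
    fix j
    show "coeff p j * coeff ([:b, c:] ^ j) i = c ^ i * (of_nat (j choose i) * coeff p j * b ^ (j - i))"
    proof (cases "i \<le> j")
      case False
      have "degree ([:b, c:] ^ j) \<le> 1 * j"
        using degree_power_le[of "[:b, c:]" j] by (intro order_trans[OF degree_power_le]) auto
      hence "coeff ([:b, c:] ^ j) i = 0" using False by (intro coeff_eq_0) auto
      thus ?thesis using False by (simp add: binomial_eq_0)
    qed (simp add: coeff_linear_poly_power)
  qed auto
  finally show ?thesis by (simp add: taylor_def sum_distrib_left)
qed

lemma knorm_taylor_less:
  assumes "\<And>j. j \<ge> i \<Longrightarrow> knorm (coeff p j) < M" "knorm b \<le> 1"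
  shows "knorm (taylor p i b) < M"
  unfolding taylor_def
proof (rule knorm_sum_less)
  show M: "0 < M" using assms(1)[of i] knorm_ge_0[of "coeff p i"] by linarith
  fix j assume "j \<in> {..degree p}"
  show "knorm (of_nat (j choose i) * coeff p j * b ^ (j - i)) < M"
  proof (cases "i \<le> j")
    case True
    have "knorm (of_nat (j choose i) * coeff p j * b ^ (j - i)) \<le> knorm (coeff p j)"
      by (intro knorm_mult_le_right knorm_power_le_1 assms knorm_mult_le_left) auto
    also have "\<dots> < M" using assms True by blast
    finally show ?thesis .
  qed (use M in \<open>auto simp: binomial_eq_0\<close>)
qed

lemma knorm_taylor_le:
  assumes "\<And>j. j \<ge> i \<Longrightarrow> knorm (coeff p j) \<le> M" "knorm b \<le> 1"
  shows "knorm (taylor p i b) \<le> M"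
proof (rule field_le_epsilon)
  fix e :: real assume "e > 0"
  hence "knorm (coeff p j) < M + e" if "j \<ge> i" for j
    using assms(1)[OF that] by simp
  thus "knorm (taylor p i b) \<le> M + e"
    using assms(2) by (rule less_imp_le[OF knorm_taylor_less])
qed

lemma knorm_taylor_diff_coeff:
  assumes "\<And>j. j > i \<Longrightarrow> knorm (coeff p j) \<le> M" "knorm b \<le> 1" "M \<ge> 0"
  shows "knorm (taylor p i b - coeff p i) \<le> M"
proof -
  define n where "n = max (degree p) i"
  have "taylor p i b = (\<Sum>j\<le>n. of_nat (j choose i) * coeff p j * b ^ (j - i))"
    by (rule taylor_altdef) (simp add: n_def)
  also have "\<dots> - coeff p i = (\<Sum>j\<in>{..n} - {i}. of_nat (j choose i) * coeff p j * b ^ (j - i))"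
    by (subst sum.remove[of _ i]) (auto simp: n_def)
  also have "knorm \<dots> \<le> M"
  proof (rule knorm_sum_le)
    fix j assume j: "j \<in> {..n} - {i}"
    show "knorm (of_nat (j choose i) * coeff p j * b ^ (j - i)) \<le> M"
    proof (cases "i < j")
      case True
      show ?thesis
        by (intro knorm_mult_le_right knorm_power_le_1 assms knorm_mult_le_left True) auto
    qed (use j assms in \<open>auto simp: binomial_eq_0\<close>)
  qed fact
  finally show ?thesis .
qed

lemma knorm_power_diff_le:
  assumes "knorm (x :: 'k::nonarch_valued_field) \<le> 1" "knorm y \<le> 1"
  shows "knorm (x ^ n - y ^ n) \<le> knorm (x - y)"
proof (induction n)
  case (Suc n)
  have "x ^ Suc n - y ^ Suc n = x * (x ^ n - y ^ n) + (x - y) * y ^ n"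
    by (simp add: algebra_simps)
  also have "knorm \<dots> \<le> knorm (x - y)"
    by (intro knorm_add_le knorm_mult_le_left[OF assms(1)] knorm_mult_le_right knorm_power_le_1 Suc assms) auto
  finally show ?case .
qed auto

lemma knorm_taylor_diff:
  assumes "\<And>j. j > Suc i \<Longrightarrow> knorm (coeff p j) \<le> M" "knorm b \<le> 1" "knorm b' \<le> 1" "M \<ge> 0"
  shows "knorm (taylor p i b - taylor p i b' - of_nat (Suc i) * coeff p (Suc i) * (b - b'))
    \<le> M * knorm (b - b')"
proof -
  define n where "n = max (degree p) (Suc i)"
  define T where "T j = of_nat (j choose i) * coeff p j * (b ^ (j - i) - b' ^ (j - i))" for j
  have tay: "taylor p i b = (\<Sum>j\<le>n. of_nat (j choose i) * coeff p j * b ^ (j - i))" for b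
    by (rule taylor_altdef) (simp add: n_def)
  have "taylor p i b - taylor p i b' = (\<Sum>j\<le>n. T j)"
    unfolding tay T_def by (simp add: sum_subtractf right_diff_distrib)
  also have "\<dots> = T (Suc i) + (\<Sum>j\<in>{..n} - {Suc i}. T j)"
    by (rule sum.remove) (auto simp: n_def)
  also have "T (Suc i) = of_nat (Suc i) * coeff p (Suc i) * (b - b')"
    by (simp add: T_def)
  finally have "taylor p i b - taylor p i b' - of_nat (Suc i) * coeff p (Suc i) * (b - b') =
    (\<Sum>j\<in>{..n} - {Suc i}. T j)" by simp
  also have "knorm \<dots> \<le> M * knorm (b - b')"
  proof (rule knorm_sum_le)
    fix j assume j: "j \<in> {..n} - {Suc i}"
    consider "j < i" | "j = i" | "j > Suc i" using j by force
    thus "knorm (T j) \<le> M * knorm (b - b')"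
    proof cases
      case 3
      show ?thesis unfolding T_def
        by (intro knorm_mult_le knorm_mult_le_left assms 3 knorm_power_diff_le) auto
    qed (auto simp: T_def binomial_eq_0 assms)
  qed (use assms in auto)
  finally show ?thesis .
qed

section \<open>The van der Corput estimate in one variable\<close>

text \<open>
  The bound is chosen such that the Taylor coefficient of order \<open>k - 1\<close>, as a function of the point, is
  governed by its linear part, whose slope is \<open>k\<close> times the coefficient of degree \<open>k\<close>.
\<close>

definition dominated :: "'k::nonarch_local_field poly \<Rightarrow> nat \<Rightarrow> bool" where
  "dominated p k \<longleftrightarrow>
     (\<forall>i>k. knorm (coeff p i) \<le> knorm (of_nat k :: 'k) * knorm (unif :: 'k) * knorm (coeff p k))"

lemma dominatedD:
  assumes "dominated (p :: 'k::nonarch_local_field poly) k" "i > k"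
  shows "knorm (coeff p i) \<le> knorm (of_nat k :: 'k) * knorm (unif :: 'k) * knorm (coeff p k)"
  using assms by (auto simp: dominated_def)

lemma dominated_le:
  assumes "dominated (p :: 'k::nonarch_local_field poly) k" "i \<ge> k"
  shows "knorm (coeff p i) \<le> knorm (coeff p k)"
proof (cases "i = k")
  case False
  have "knorm (coeff p i) \<le> knorm (of_nat k :: 'k) * knorm (unif :: 'k) * knorm (coeff p k)"
    using assms False by (intro dominatedD) auto
  also have "\<dots> = knorm (of_nat k * unif * coeff p k)" by (simp add: knorm_mult)
  also have "\<dots> \<le> knorm (coeff p k)"
    by (intro knorm_mult_le_left order.refl) (auto intro!: knorm_mult_le_left)
  finally show ?thesis .
qed auto

lemma knorm_taylor_dominated:
  assumes "dominated (p :: 'k::nonarch_local_field poly) k" "knorm b \<le> 1" "coeff p k \<noteq> 0"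
  shows "knorm (taylor p k b) = knorm (coeff p k)"
proof -
  have "knorm (taylor p k b - coeff p k) \<le> knorm (of_nat k :: 'k) * knorm (unif :: 'k) * knorm (coeff p k)"
    using assms by (intro knorm_taylor_diff_coeff dominatedD) auto
  also have "\<dots> \<le> 1 * knorm (unif :: 'k) * knorm (coeff p k)"
    by (intro mult_right_mono) auto
  also have "\<dots> < 1 * knorm (coeff p k)"
    using assms by (auto intro!: mult_strict_right_mono)
  finally show ?thesis using knorm_add_eq[of "taylor p k b - coeff p k" "coeff p k"] by simp
qed

text \<open>
  This is the substitute for a lower bound on a derivative: the Taylor coefficient of order \<open>k\<close> is an
  isometry up to a scaling factor, so it can be small on one residue class at most.
\<close>

lemma knorm_taylor_pred_diff:
  assumes "dominated (p :: 'k::nonarch_local_field poly) (Suc k)" "knorm b \<le> 1" "knorm b' \<le> 1"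
  shows "knorm (taylor p k b - taylor p k b') =
    knorm (of_nat (Suc k) :: 'k) * knorm (coeff p (Suc k)) * knorm (b - b')"
proof -
  define a where "a = of_nat (Suc k) * coeff p (Suc k) * (b - b')"
  have "knorm (taylor p k b - taylor p k b' - a) \<le>
     knorm (of_nat (Suc k) :: 'k) * knorm (unif :: 'k) * knorm (coeff p (Suc k)) * knorm (b - b')"
    unfolding a_def by (intro knorm_taylor_diff dominatedD assms) auto
  also have "\<dots> = knorm (unif :: 'k) * knorm a" by (simp add: a_def knorm_mult del: of_nat_Suc)
  finally have le: "knorm (taylor p k b - taylor p k b' - a) \<le> knorm (unif :: 'k) * knorm a" .
  have "knorm (taylor p k b - taylor p k b') = knorm a"
  proof (cases "a = 0")
    case True
    thus ?thesis using le knorm_ge_0[of "taylor p k b - taylor p k b'"] by simp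
  next
    case False
    hence "knorm (unif :: 'k) * knorm a < 1 * knorm a" by (intro mult_strict_right_mono) auto
    thus ?thesis using le knorm_add_eq[of "taylor p k b - taylor p k b' - a" a] by simp
  qed
  thus ?thesis by (simp add: a_def knorm_mult del: of_nat_Suc)
qed

lemma one_le_powr_nonpos: "0 < x \<Longrightarrow> x \<le> 1 \<Longrightarrow> a \<le> 0 \<Longrightarrow> 1 \<le> x powr (a :: real)"
  using powr_mono2'[of a x 1] by simp

context nontrivial_character
begin

lemma norm_avg_char_le_1: "norm (avg N (\<lambda>u. \<psi> (G u))) \<le> 1"
  by (rule norm_avg_le) auto

text \<open>
  For \<open>\<psi> e \<noteq> 1\<close>, the shift by \<open>e\<close> over the linear coefficient changes the phase by \<open>e\<close> up to an
  element of the maximal ideal. So it multiplies the average by \<open>\<psi> e\<close>, and translation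
  invariance forces the average to vanish.
\<close>

lemma avg_linear_eq_0:
  assumes dom: "dominated p 1" and large: "knorm (coeff p 1) \<ge> 1"
    and N: "\<And>i. i \<ge> 1 \<Longrightarrow> knorm (coeff p i) < inverse (knorm (unif :: 'k) ^ N)"
  shows "avg N (\<lambda>u. \<psi> (poly p u)) = 0"
proof -
  obtain e where e: "knorm e \<le> 1" "\<psi> e \<noteq> 1"
    using nontrivial by (auto simp: valuation_ring_def)
  have nz: "coeff p 1 \<noteq> 0" using large by (intro notI) simp
  define a where "a = e / coeff p 1"
  have a: "knorm a \<le> 1" using large e nz by (simp add: a_def knorm_divide divide_le_eq_1)
  have shift: "\<psi> (poly p (u + a)) = \<psi> e * \<psi> (poly p u)" if u: "knorm u \<le> 1" for u
  proof -
    have ua: "knorm (u + a) \<le> 1" using u a by (intro knorm_add_le)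
    have "knorm (taylor p 0 (u + a) - taylor p 0 u - of_nat (Suc 0) * coeff p (Suc 0) * (u + a - u)) \<le>
       knorm (unif :: 'k) * knorm (coeff p 1) * knorm (u + a - u)"
      using dominatedD[OF dom] by (intro knorm_taylor_diff u ua) auto
    also have "\<dots> = knorm (unif :: 'k) * knorm e"
      using nz by (simp add: a_def knorm_divide knorm_eq_zero)
    also have "\<dots> < 1"
      by (rule le_less_trans[OF mult_left_le[OF e(1)] knorm_unif_less_1]) simp
    finally have "knorm (poly p (u + a) - (e + poly p u)) < 1"
      using nz by (simp add: poly_eq_taylor a_def algebra_simps)
    thus ?thesis using char_cong char_add by metis
  qed
  have "avg N (\<lambda>u. \<psi> (poly p (u + a))) = avg N (\<lambda>u. \<psi> (poly p u))"
  proof (rule avg_translate)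
    fix u c :: 'k assume uc: "knorm u \<le> 1" "knorm c \<le> 1"
    have uc': "knorm (u + unif ^ N * c) \<le> 1"
      using uc by (intro knorm_add_le knorm_mult_le_left knorm_power_le_1) auto
    have "poly p (u + unif ^ N * c) - poly p u =
        (\<Sum>j\<le>degree p. coeff p j * ((u + unif ^ N * c) ^ j - u ^ j))"
      by (simp add: poly_altdef sum_subtractf right_diff_distrib)
    also have "knorm \<dots> < 1"
    proof (rule knorm_sum_less)
      fix j assume "j \<in> {..degree p}"
      show "knorm (coeff p j * ((u + unif ^ N * c) ^ j - u ^ j)) < 1"
      proof (cases "j = 0")
        case False
        have "knorm ((u + unif ^ N * c) ^ j - u ^ j) \<le> knorm (u + unif ^ N * c - u)"
          by (intro knorm_power_diff_le uc uc')
        also have "\<dots> \<le> knorm (unif :: 'k) ^ N"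
          using uc by (auto simp: knorm_mult knorm_power intro: mult_left_le)
        finally have "knorm (coeff p j * ((u + unif ^ N * c) ^ j - u ^ j)) \<le>
          knorm (coeff p j) * knorm (unif :: 'k) ^ N" by (intro knorm_mult_le) auto
        also have "\<dots> < 1" using N[of j] False by (simp add: field_simps)
        finally show ?thesis .
      qed auto
    qed auto
    finally show "\<psi> (poly p (u + unif ^ N * c)) = \<psi> (poly p u)" by (rule char_cong)
  qed fact
  moreover have "avg N (\<lambda>u. \<psi> (poly p (u + a))) = avg N (\<lambda>u. \<psi> e * \<psi> (poly p u))"
    by (intro avg_cong shift)
  ultimately have "(\<psi> e - 1) * avg N (\<lambda>u. \<psi> (poly p u)) = 0"
    by (simp add: avg_cmult algebra_simps)
  thus ?thesis using e by simp
qed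

text \<open>
  The bound on the coefficients ties the depth \<open>N\<close> to \<open>p\<close>: it makes \<open>\<psi> (p u)\<close> constant on the cosets
  over which \<open>avg N\<close> samples, so that the average is the full oscillatory integral over the
  valuation ring. The constant \<open>C\<close> has to serve all \<open>p\<close> and \<open>N\<close>.
\<close>

definition vdc_const :: "nat \<Rightarrow> real \<Rightarrow> bool" where
  "vdc_const k C \<longleftrightarrow> C \<ge> 1 \<and>
     (\<forall>p N. dominated p k \<longrightarrow> coeff p k \<noteq> 0 \<longrightarrow>
        (\<forall>i\<ge>1. knorm (coeff p i) < inverse (knorm (unif :: 'k) ^ N)) \<longrightarrow>
        norm (avg N (\<lambda>u. \<psi> (poly p u))) \<le> C * knorm (coeff p k) powr (- 1 / real k))"

lemma vdc_const_1: "vdc_const 1 1"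
  unfolding vdc_const_def
proof (intro conjI allI impI)
  fix p :: "'k poly" and N
  assume *: "dominated p 1" "coeff p 1 \<noteq> 0"
    "\<forall>i\<ge>1. knorm (coeff p i) < inverse (knorm (unif :: 'k) ^ N)"
  show "norm (avg N (\<lambda>u. \<psi> (poly p u))) \<le> 1 * knorm (coeff p 1) powr (- 1 / real 1)"
  proof (cases "knorm (coeff p 1) \<ge> 1")
    case True
    thus ?thesis using avg_linear_eq_0[of p N] * by simp
  next
    case False
    hence "1 \<le> knorm (coeff p 1) powr (- 1 / real 1)"
      using * by (intro one_le_powr_nonpos) auto
    thus ?thesis using norm_avg_char_le_1[of N "poly p"] by linarith
  qed
qed auto

text \<open>
  Where the Taylor coefficient of order \<open>k\<close> is not small, zooming in by \<open>unif ^ Suc s\<close> multiplies the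
  coefficients of degree above \<open>k\<close> by a further factor \<open>|unif|^(Suc s)\<close> relative to the one of
  degree \<open>k\<close>. For large \<open>s\<close> the coefficient of degree \<open>k\<close> becomes dominant.
\<close>

lemma vdc_nonexceptional:
  assumes C: "vdc_const k C" "k \<ge> 1"
    and kn: "of_nat k \<noteq> (0 :: 'k)" "of_nat (Suc k) \<noteq> (0 :: 'k)"
    and s: "knorm (unif :: 'k) ^ s \<le> knorm (of_nat (Suc k) :: 'k) * knorm (of_nat k :: 'k)"
    and dom: "dominated p (Suc k)" and X: "knorm (coeff p (Suc k)) \<ge> inverse (knorm (unif :: 'k) ^ s)"
    and N: "\<And>i. i \<ge> 1 \<Longrightarrow> knorm (coeff p i) < inverse (knorm (unif :: 'k) ^ Suc N)"
    and b: "knorm b \<le> 1"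
    and nonexc: "knorm (taylor p k b) \<ge> knorm (of_nat (Suc k) :: 'k) * knorm (coeff p (Suc k))"
  shows "norm (avg N (\<lambda>u. \<psi> (poly p (b + unif * u)))) \<le>
    C * (knorm (unif :: 'k) ^ (Suc s * k) * knorm (of_nat (Suc k) :: 'k)) powr (- 1 / real k)
      * knorm (coeff p (Suc k)) powr (- 1 / real k)"
proof -
  define \<rho> where "\<rho> = knorm (unif :: 'k)"
  define \<kappa> where "\<kappa> = knorm (of_nat (Suc k) :: 'k)"
  define X where "X = knorm (coeff p (Suc k))"
  have \<rho>: "0 < \<rho>" "\<rho> < 1" by (auto simp: \<rho>_def)
  have \<kappa>: "0 < \<kappa>" using kn by (auto simp: \<kappa>_def simp del: of_nat_Suc)
  have X1: "X \<ge> inverse (\<rho> ^ s)" using assms by (simp add: X_def \<rho>_def)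
  have Xpos: "X > 0" using X1 \<rho> by (smt (verit) positive_imp_inverse_positive zero_less_power)
  have "N \<ge> s"
  proof (rule ccontr)
    assume "\<not> N \<ge> s"
    hence "\<rho> ^ s \<le> \<rho> ^ Suc N" using \<rho> by (intro power_decreasing) auto
    hence "inverse (\<rho> ^ Suc N) \<le> inverse (\<rho> ^ s)" using \<rho> by (intro le_imp_inverse_le) auto
    thus False using X1 N[of "Suc k"] by (simp add: \<rho>_def X_def)
  qed
  then obtain N' where N': "N = s + N'" using le_Suc_ex by blast
  have "norm (avg N' (\<lambda>u. \<psi> (poly p (b + unif * (c + unif ^ s * u))))) \<le>
    C * (\<rho> ^ (Suc s * k) * \<kappa>) powr (- 1 / real k) * X powr (- 1 / real k)" if c: "knorm c \<le> 1" for c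
  proof -
    define b' where "b' = b + unif * c"
    define p' where "p' = p \<circ>\<^sub>p [:b', unif ^ Suc s:]"
    have b': "knorm b' \<le> 1" using b c by (auto simp: b'_def intro!: knorm_add_le knorm_mult_le_left)
    have coeff_p': "knorm (coeff p' i) = \<rho> ^ (Suc s * i) * knorm (taylor p i b')" for i
      by (simp only: p'_def coeff_pcompose_linear knorm_mult knorm_power \<rho>_def power_mult)
    have tk: "knorm (taylor p k b') = knorm (taylor p k b)"
    proof -
      have "knorm (taylor p k b' - taylor p k b) = \<kappa> * X * knorm (b' - b)"
        unfolding \<kappa>_def X_def by (intro knorm_taylor_pred_diff dom b b')
      also have "knorm (b' - b) \<le> \<rho>" using c by (simp add: b'_def knorm_mult \<rho>_def mult_left_le)
      hence "\<kappa> * X * knorm (b' - b) \<le> \<kappa> * X * \<rho>"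
        using \<kappa> Xpos by (intro mult_left_mono) auto
      also have "\<dots> < \<kappa> * X * 1" using \<kappa> Xpos \<rho> by (intro mult_strict_left_mono) auto
      also have "\<dots> \<le> knorm (taylor p k b)" using nonexc by (simp add: \<kappa>_def X_def)
      finally show ?thesis using knorm_add_eq[of "taylor p k b' - taylor p k b" "taylor p k b"] by simp
    qed
    have ck: "knorm (coeff p' k) \<ge> \<rho> ^ (Suc s * k) * \<kappa> * X"
      unfolding coeff_p' tk using nonexc \<rho> by (simp add: \<kappa>_def X_def mult.assoc mult_left_mono del: of_nat_Suc)
    have "dominated p' k"
      unfolding dominated_def
    proof (intro allI impI)
      fix i assume i: "i > k"
      have "knorm (coeff p' i) = \<rho> ^ (Suc s * i) * knorm (taylor p i b')" by (rule coeff_p')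
      also have "\<dots> \<le> \<rho> ^ (Suc s * Suc k) * X"
      proof (rule mult_mono)
        have "Suc s * Suc k \<le> Suc s * i" using i by (intro mult_le_mono) auto
        thus "\<rho> ^ (Suc s * i) \<le> \<rho> ^ (Suc s * Suc k)" using \<rho> by (intro power_decreasing) auto
        show "knorm (taylor p i b') \<le> X" unfolding X_def
          using i by (intro knorm_taylor_le dominated_le dom b') auto
      qed (use \<rho> in auto)
      also have "\<dots> = \<rho> ^ s * (\<rho> * (\<rho> ^ (Suc s * k) * X))"
        by (simp add: power_add algebra_simps)
      also have "\<dots> \<le> (\<kappa> * knorm (of_nat k :: 'k)) * (\<rho> * (\<rho> ^ (Suc s * k) * X))"
        using s \<rho> Xpos by (intro mult_right_mono) (auto simp: \<kappa>_def \<rho>_def simp del: of_nat_Suc)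
      also have "\<dots> = knorm (of_nat k :: 'k) * \<rho> * (\<rho> ^ (Suc s * k) * \<kappa> * X)"
        by (simp only: mult_ac)
      also have "\<dots> \<le> knorm (of_nat k :: 'k) * \<rho> * knorm (coeff p' k)"
        using ck \<rho> by (intro mult_left_mono) auto
      finally show "knorm (coeff p' i) \<le> knorm (of_nat k :: 'k) * knorm (unif :: 'k) * knorm (coeff p' k)"
        by (simp add: \<rho>_def)
    qed
    moreover have lowpos: "\<rho> ^ (Suc s * k) * \<kappa> * X > 0" using \<rho> \<kappa> Xpos by simp
    hence "coeff p' k \<noteq> 0" using ck by (metis knorm_zero not_le)
    moreover have "knorm (coeff p' i) < inverse (\<rho> ^ N')" if i: "i \<ge> 1" for i
    proof -
      have "knorm (taylor p i b') < inverse (\<rho> ^ Suc N)"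
        using i N by (intro knorm_taylor_less b') (auto simp: \<rho>_def)
      hence "\<rho> ^ (Suc s * i) * knorm (taylor p i b') < \<rho> ^ (Suc s * i) * inverse (\<rho> ^ Suc N)"
        using \<rho> by (intro mult_strict_left_mono) auto
      also have "\<dots> \<le> \<rho> ^ Suc s * inverse (\<rho> ^ Suc N)"
        using \<rho> mult_le_mono2[OF i, of "Suc s"] by (intro mult_right_mono power_decreasing) auto
      also have "\<dots> = inverse (\<rho> ^ N')" using \<rho> by (simp add: N' power_add field_simps)
      finally show ?thesis by (simp add: coeff_p')
    qed
    ultimately have "norm (avg N' (\<lambda>u. \<psi> (poly p' u))) \<le> C * knorm (coeff p' k) powr (- 1 / real k)"
      using C(1) unfolding vdc_const_def \<rho>_def by blast
    also have "\<dots> \<le> C * (\<rho> ^ (Suc s * k) * \<kappa> * X) powr (- 1 / real k)"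
      using C(1) lowpos ck by (intro mult_left_mono powr_mono2') (auto simp: vdc_const_def)
    also have "\<dots> = C * (\<rho> ^ (Suc s * k) * \<kappa>) powr (- 1 / real k) * X powr (- 1 / real k)"
      using \<rho> \<kappa> Xpos by (simp add: powr_mult)
    finally show ?thesis
      by (simp add: p'_def b'_def poly_pcompose algebra_simps)
  qed
  from norm_avg_zoom[of N' "\<lambda>u. \<psi> (poly p (b + unif * u))" s, OF this]
  show ?thesis by (simp add: N' \<rho>_def \<kappa>_def X_def)
qed

text \<open>
  Let \<open>n = Suc k\<close> and let \<open>X\<close> be the norm of the coefficient of degree \<open>n\<close>. The nonexceptional
  classes contribute at most \<open>A X^(-1/k)\<close>. The exceptional class carries the weight \<open>\<rho> = 1/q\<close>, and
  there \<open>X\<close> is replaced by \<open>\<rho>^n X\<close>. So a bound \<open>E\<close> has to satisfy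
  \<open>A X^(-1/k) + \<rho> E (\<rho>^n X) \<le> E X\<close>. The ansatz \<open>E X = D X^(-1/n) - D' X^(-1/k)\<close> turns this into an
  equality: the first summand is invariant under the recursion, and the second one sums the
  geometric series of the errors.
\<close>

lemma vdc_const_Suc:
  assumes C: "vdc_const k C" "k \<ge> 1"
    and kn: "of_nat k \<noteq> (0 :: 'k)" "of_nat (Suc k) \<noteq> (0 :: 'k)"
  shows "\<exists>C'. vdc_const (Suc k) C'"
proof -
  define n where "n = Suc k"
  define \<rho> where "\<rho> = knorm (unif :: 'k)"
  define \<kappa> where "\<kappa> = knorm (of_nat n :: 'k)"
  have \<rho>: "0 < \<rho>" "\<rho> < 1" by (auto simp: \<rho>_def)
  have \<kappa>: "0 < \<kappa>" using kn by (auto simp: \<kappa>_def n_def simp del: of_nat_Suc)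
  obtain s where s: "\<rho> ^ s < \<kappa> * knorm (of_nat k :: 'k)"
    using real_arch_pow_inv[of "\<kappa> * knorm (of_nat k :: 'k)" \<rho>] \<rho> \<kappa> kn by auto
  define A where "A = C * (\<rho> ^ (Suc s * k) * \<kappa>) powr (- 1 / real k)"
  have A: "A \<ge> 0" using C by (auto simp: A_def vdc_const_def)
  have \<rho>k: "\<rho> powr (- 1 / real k) > 1" 
    using powr_less_mono2_neg[of "- 1 / real k" \<rho> 1] \<rho> C(2) by simp
  \<comment> \<open>the solution of \<open>E_rec\<close> below for the coefficient of \<open>X^(-1/k)\<close>\<close>
  define D' where "D' = A / (\<rho> powr (- 1 / real k) - 1)"
  have D': "D' \<ge> 0" "D' * \<rho> powr (- 1 / real k) = A + D'"
    using A \<rho>k by (auto simp: D'_def field_simps)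
  \<comment> \<open>below this threshold the trivial bound \<open>1\<close> suffices; above it zooming keeps \<open>X\<close> at least \<open>1\<close>\<close>
  define X1 where "X1 = inverse (\<rho> ^ (s + n))"
  have X1: "X1 \<ge> 1" "X1 \<ge> inverse (\<rho> ^ s)" "X1 \<ge> inverse (\<rho> ^ n)"
    using \<rho> by (auto simp: X1_def power_le_one intro!: one_le_inverse le_imp_inverse_le power_decreasing)
  define D where "D = (1 + D') * X1 powr (1 / real n)"
  have X1n: "X1 powr (1 / real n) \<ge> 1" using X1 by (intro ge_one_powr_ge_zero) auto
  have DD': "D \<ge> 1 + D'" using X1n D' by (auto simp: D_def)
  define E where "E X = D * X powr (- 1 / real n) - D' * X powr (- 1 / real k)" for X
  have E_nonneg: "E X \<ge> 0" if "X \<ge> 1" for X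
  proof -
    have "D' * X powr (- 1 / real k) \<le> D * X powr (- 1 / real n)"
      using that D' DD' C(2) by (intro mult_mono powr_mono) (auto simp: n_def field_simps)
    thus ?thesis by (simp add: E_def)
  qed
  have E_base: "E X \<ge> 1" if "1 \<le> X" "X \<le> X1" for X
  proof -
    have "1 + D' = D * X1 powr (- 1 / real n)"
      using X1 by (simp add: D_def powr_minus field_simps)
    also have "\<dots> \<le> D * X powr (- 1 / real n)"
      using that DD' D' by (intro mult_left_mono powr_mono2') auto
    finally have "1 + D' \<le> D * X powr (- 1 / real n)" .
    moreover have "X powr (- 1 / real k) \<le> 1"
      using that powr_mono2'[of "- 1 / real k" 1 X] by simp
    hence "D' * X powr (- 1 / real k) \<le> D' * 1" using D' by (intro mult_left_mono)
    ultimately show ?thesis by (simp add: E_def)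
  qed
  have E_rec: "\<rho> * E (\<rho> ^ n * X) + A * X powr (- 1 / real k) = E X" if "X > 0" for X
  proof -
    have "(\<rho> ^ n * X) powr (- 1 / real n) = inverse \<rho> * X powr (- 1 / real n)"
      using \<rho> that by (simp add: powr_mult powr_powr powr_minus flip: powr_realpow) (simp add: n_def)
    hence 1: "\<rho> * (D * (\<rho> ^ n * X) powr (- 1 / real n)) = D * X powr (- 1 / real n)"
      using \<rho> by simp
    have "(\<rho> ^ n) powr (- 1 / real k) = \<rho> powr (- 1 + (- 1 / real k))"
    proof -
      have "\<rho> ^ n = \<rho> powr real n" using \<rho> by (simp add: powr_realpow)
      moreover have "real n * (- 1 / real k) = - 1 + (- 1 / real k)"
        using C(2) by (simp add: n_def field_simps)
      ultimately show ?thesis by (simp only: powr_powr)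
    qed
    also have "\<dots> = inverse \<rho> * \<rho> powr (- 1 / real k)"
      using \<rho> by (simp only: powr_add) (simp add: powr_minus)
    finally have "(\<rho> ^ n * X) powr (- 1 / real k) = inverse \<rho> * \<rho> powr (- 1 / real k) * X powr (- 1 / real k)"
      using \<rho> that by (simp add: powr_mult)
    hence "\<rho> * (D' * (\<rho> ^ n * X) powr (- 1 / real k)) = (D' * \<rho> powr (- 1 / real k)) * X powr (- 1 / real k)"
      using \<rho> by simp
    also have "\<dots> = (A + D') * X powr (- 1 / real k)" by (simp only: D')
    finally show ?thesis using 1 by (simp add: E_def algebra_simps)
  qed
  have main: "norm (avg N (\<lambda>u. \<psi> (poly p u))) \<le> E (knorm (coeff p n))"
    if "dominated p n" "knorm (coeff p n) \<ge> 1" "\<And>i. i \<ge> 1 \<Longrightarrow> knorm (coeff p i) < inverse (\<rho> ^ N)" for p N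
    using that
  proof (induction N arbitrary: p)
    case 0
    from "0.prems"(3)[of n] "0.prems"(2) have False by (simp add: n_def)
    thus ?case ..
  next
    case (Suc N)
    define X where "X = knorm (coeff p n)"
    show ?case
    proof (cases "X \<le> X1")
      case True
      thus ?thesis using E_base[of X] Suc.prems(2) norm_avg_char_le_1[of "Suc N" "poly p"]
        by (simp add: X_def del: avg.simps)
    next
      case False
      hence XX: "X \<ge> X1" "X \<ge> 1" "X > 0" using X1 by auto
      have X': "\<rho> ^ n * X \<ge> 1"
      proof -
        have "\<rho> ^ n * inverse (\<rho> ^ n) \<le> \<rho> ^ n * X"
          using XX X1 \<rho> by (intro mult_left_mono) auto
        thus ?thesis using \<rho> by simp
      qed
      define e where "e b \<longleftrightarrow> knorm (taylor p k b) < \<kappa> * X" for b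
      have bound: "norm (avg N (\<lambda>u. \<psi> (poly p (b + unif * u)))) \<le>
          A * X powr (- 1 / real k) + (if e b then E (\<rho> ^ n * X) else 0)" if b: "b \<in> digits" for b
      proof (cases "e b")
        case False
        have "norm (avg N (\<lambda>u. \<psi> (poly p (b + unif * u)))) \<le> A * X powr (- 1 / real k)"
          unfolding A_def X_def n_def \<rho>_def \<kappa>_def
          by (rule vdc_nonexceptional[OF C kn])
            (use s False XX X1 Suc.prems digits_norm[OF b] in
              \<open>auto simp: e_def n_def X_def \<rho>_def \<kappa>_def simp del: of_nat_Suc power_Suc\<close>)
        thus ?thesis using False by simp
      next
        case True
        define p' where "p' = p \<circ>\<^sub>p [:b, unif:]"
        have b1: "knorm b \<le> 1" using b by (rule digits_norm)
        have coeff_p': "knorm (coeff p' i) = \<rho> ^ i * knorm (taylor p i b)" for i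
          by (simp add: p'_def coeff_pcompose_linear knorm_mult knorm_power \<rho>_def)
        have cn: "knorm (coeff p' n) = \<rho> ^ n * X"
          unfolding coeff_p' X_def using Suc.prems b1 by (subst knorm_taylor_dominated) auto
        have "norm (avg N (\<lambda>u. \<psi> (poly p' u))) \<le> E (knorm (coeff p' n))"
        proof (rule Suc.IH)
          show "dominated p' n"
            unfolding dominated_def
          proof (intro allI impI)
            fix i assume i: "i > n"
            have "knorm (coeff p' i) \<le> \<rho> ^ n * (\<kappa> * \<rho> * X)"
              unfolding coeff_p'
            proof (rule mult_mono)
              show "knorm (taylor p i b) \<le> \<kappa> * \<rho> * X"
                unfolding \<kappa>_def \<rho>_def X_def
                using i Suc.prems(1) by (intro knorm_taylor_le dominatedD b1) auto
            qed (use \<rho> i in \<open>auto intro!: power_decreasing\<close>)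
            thus "knorm (coeff p' i) \<le> knorm (of_nat n :: 'k) * knorm (unif :: 'k) * knorm (coeff p' n)"
              by (simp add: cn \<kappa>_def \<rho>_def mult_ac)
          qed
          show "1 \<le> knorm (coeff p' n)" using X' by (simp add: cn)
          show "knorm (coeff p' i) < inverse (\<rho> ^ N)" if i: "i \<ge> 1" for i
          proof -
            have "knorm (taylor p i b) < inverse (\<rho> ^ Suc N)"
              using i Suc.prems(3) by (intro knorm_taylor_less b1) auto
            hence "\<rho> ^ i * knorm (taylor p i b) < \<rho> ^ i * inverse (\<rho> ^ Suc N)"
              using \<rho> by (intro mult_strict_left_mono) auto
            also have "\<dots> \<le> \<rho> ^ 1 * inverse (\<rho> ^ Suc N)"
              using \<rho> i by (intro mult_right_mono power_decreasing) auto
            also have "\<dots> = inverse (\<rho> ^ N)" using \<rho> by simp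
            finally show ?thesis by (simp add: coeff_p')
          qed
        qed
        hence "norm (avg N (\<lambda>u. \<psi> (poly p (b + unif * u)))) \<le> E (\<rho> ^ n * X)"
          unfolding cn by (simp add: p'_def poly_pcompose mult.commute)
        thus ?thesis using True A by (simp add: add_increasing)
      qed
      have exc: "card {b \<in> digits. e b} \<le> 1"
      proof -
        have "b = b'" if "b \<in> digits" "b' \<in> digits" "e b" "e b'" for b b'
        proof (rule digits_unique[OF that(1,2)])
          have "knorm (taylor p k b - taylor p k b') < \<kappa> * X"
            using that by (intro knorm_diff_less) (auto simp: e_def)
          also have "knorm (taylor p k b - taylor p k b') = \<kappa> * X * knorm (b - b')"
            unfolding \<kappa>_def X_def n_def using Suc.prems that
            by (intro knorm_taylor_pred_diff digits_norm) (auto simp: n_def)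
          finally show "knorm (b - b') < 1" using \<kappa> XX by simp
        qed
        thus ?thesis by (intro card_le_Suc0_iff_eq[THEN iffD2, folded One_nat_def]) auto
      qed
      have q: "real (card (digits :: 'k set)) = inverse \<rho>"
        by (simp add: card_digits \<rho>_def unif_props(3))
      have "norm (avg (Suc N) (\<lambda>u. \<psi> (poly p u))) \<le>
         (\<Sum>b\<in>(digits :: 'k set). A * X powr (- 1 / real k) + (if e b then E (\<rho> ^ n * X) else 0)) / real (card (digits :: 'k set))"
        unfolding avg.simps by (rule norm_mean_le) (rule bound)
      also have "(\<Sum>b\<in>(digits :: 'k set). A * X powr (- 1 / real k) + (if e b then E (\<rho> ^ n * X) else 0)) =
          real (card (digits :: 'k set)) * (A * X powr (- 1 / real k)) + real (card {b \<in> digits. e b}) * E (\<rho> ^ n * X)"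
        by (simp add: sum.distrib sum.If_cases Int_def)
      also have "\<dots> / real (card (digits :: 'k set)) =
          A * X powr (- 1 / real k) + \<rho> * (real (card {b \<in> digits. e b}) * E (\<rho> ^ n * X))"
        unfolding q using \<rho> by (simp add: field_simps)
      also have "\<dots> \<le> A * X powr (- 1 / real k) + \<rho> * (1 * E (\<rho> ^ n * X))"
        using exc \<rho> E_nonneg[OF X'] by (intro add_left_mono mult_left_mono mult_right_mono) auto
      also have "\<dots> = E X" using E_rec[of X] XX by simp
      finally show ?thesis by (simp add: X_def)
    qed
  qed
  have "vdc_const n D"
    unfolding vdc_const_def
  proof (intro conjI allI impI)
    show "D \<ge> 1" using DD' D' by simp
    fix p :: "'k poly" and N
    assume *: "dominated p n" "coeff p n \<noteq> 0"
      "\<forall>i\<ge>1. knorm (coeff p i) < inverse (knorm (unif :: 'k) ^ N)"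
    show "norm (avg N (\<lambda>u. \<psi> (poly p u))) \<le> D * knorm (coeff p n) powr (- 1 / real n)"
    proof (cases "knorm (coeff p n) \<ge> 1")
      case True
      hence "norm (avg N (\<lambda>u. \<psi> (poly p u))) \<le> E (knorm (coeff p n))"
        using * by (intro main) (auto simp: \<rho>_def)
      also have "\<dots> \<le> D * knorm (coeff p n) powr (- 1 / real n)"
        using D' by (simp add: E_def)
      finally show ?thesis .
    next
      case False
      hence "1 \<le> knorm (coeff p n) powr (- 1 / real n)"
        using * by (intro one_le_powr_nonpos) auto
      also have "\<dots> \<le> D * knorm (coeff p n) powr (- 1 / real n)"
        using DD' D' by (intro mult_right_mono[of 1 D, simplified]) auto
      finally show ?thesis using norm_avg_char_le_1[of N "poly p"] by linarith
    qed
  qed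
  thus ?thesis by (auto simp: n_def)
qed

lemma van_der_corput:
  assumes "k \<ge> 1" "\<And>j. 1 \<le> j \<Longrightarrow> j \<le> k \<Longrightarrow> of_nat j \<noteq> (0 :: 'k)"
  shows "\<exists>C. vdc_const k C"
  using assms
proof (induction k rule: nat_induct_at_least)
  case base
  thus ?case using vdc_const_1 by blast
next
  case (Suc k)
  then obtain C where "vdc_const k C" by force
  thus ?case using Suc by (intro vdc_const_Suc) (auto simp del: of_nat_Suc)
qed

end

section \<open>Topology of the field\<close>

instance nonarch_valued_field < topological_ab_group_add
proof
  fix a b :: 'a
  show "LIM x (nhds a \<times>\<^sub>F nhds b). fst x + snd x :> nhds (a + b)"
    unfolding tendsto_iff
  proof (intro allI impI)
    fix e :: real assume e: "e > 0"
    have "dist (x + y) (a + b) < e" if "dist x a < e" "dist y b < e" for x y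
      using knorm_add_less[of "x - a" e "y - b"] that by (simp add: dist_knorm algebra_simps)
    thus "\<forall>\<^sub>F x in nhds a \<times>\<^sub>F nhds b. dist (fst x + snd x) (a + b) < e"
      unfolding eventually_prod_filter using e
      by (intro exI[of _ "\<lambda>x. dist x a < e"] exI[of _ "\<lambda>y. dist y b < e"])
        (auto simp: eventually_nhds_metric)
  qed
  show "(uminus \<longlongrightarrow> - a) (nhds a)"
    unfolding tendsto_iff eventually_nhds_metric
  proof (intro allI impI)
    fix e :: real assume "e > 0"
    thus "\<exists>d>0. \<forall>x. dist x a < d \<longrightarrow> dist (- x) (- a) < e"
      by (intro exI[of _ e]) (auto simp: dist_knorm knorm_minus_commute)
  qed
qed

instance nonarch_valued_field < topological_semigroup_mult
proof
  fix a b :: 'a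
  show "LIM x (nhds a \<times>\<^sub>F nhds b). fst x * snd x :> nhds (a * b)"
    unfolding tendsto_iff
  proof (intro allI impI)
    fix e :: real assume e: "e > 0"
    define M where "M = knorm a + knorm b + 1"
    have M: "M > 0" by (simp add: M_def add_nonneg_pos)
    define d where "d = min 1 (e / M)"
    have d: "d > 0" "d \<le> 1" "d \<le> e / M" using e M by (auto simp: d_def)
    have "dist (x * y) (a * b) < e" if *: "dist x a < d" "dist y b < d" for x y
    proof -
      have x: "knorm x \<le> M"
      proof -
        have "knorm a \<le> M" "knorm (x - a) \<le> M"
          unfolding M_def using * d knorm_ge_0[of b] knorm_ge_0[of a] by (simp_all add: dist_knorm del: knorm_ge_0)
        from knorm_add_le[OF this] show ?thesis by simp
      qed
      have "knorm (x * (y - b)) < e"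
      proof -
        have "knorm x * knorm (y - b) \<le> M * knorm (y - b)" using x by (intro mult_right_mono) auto
        also have "\<dots> < M * (e / M)" using * d M by (intro mult_strict_left_mono) (auto simp: dist_knorm)
        finally show ?thesis using M by (simp add: knorm_mult)
      qed
      moreover have "knorm ((x - a) * b) < e"
      proof -
        have "knorm (x - a) * knorm b \<le> knorm (x - a) * M"
          by (intro mult_left_mono) (auto simp: M_def)
        also have "\<dots> < (e / M) * M" using * d M by (intro mult_strict_right_mono) (auto simp: dist_knorm)
        finally show ?thesis using M by (simp add: knorm_mult)
      qed
      ultimately have "knorm (x * (y - b) + (x - a) * b) < e" by (rule knorm_add_less)
      thus ?thesis by (simp add: dist_knorm algebra_simps)
    qed
    thus "\<forall>\<^sub>F x in nhds a \<times>\<^sub>F nhds b. dist (fst x * snd x) (a * b) < e"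
      unfolding eventually_prod_filter using d
      by (intro exI[of _ "\<lambda>x. dist x a < d"] exI[of _ "\<lambda>y. dist y b < d"])
        (auto simp: eventually_nhds_metric)
  qed
qed

lemma exists_small_knorm:
  assumes "e > 0"
  shows "\<exists>c :: 'k::nonarch_local_field. c \<noteq> 0 \<and> knorm c < e"
proof -
  obtain n where "knorm (unif :: 'k) ^ n < e"
    using real_arch_pow_inv[OF assms, of "knorm (unif :: 'k)"] by auto
  thus ?thesis by (intro exI[of _ "unif ^ n"]) (auto simp: knorm_power)
qed

lemma at_0_neq_bot: "at (0 :: 'k::nonarch_local_field) \<noteq> bot"
proof -
  have "\<exists>x\<in>UNIV. x \<noteq> (0 :: 'k) \<and> dist x 0 < e" if "e > 0" for e
    using exists_small_knorm[OF that] by (auto simp: dist_knorm)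
  hence "(0 :: 'k) islimpt UNIV" by (simp add: islimpt_approachable)
  thus ?thesis by (simp add: trivial_limit_within)
qed

lemma open_vec_knorm:
  fixes x :: "'k::nonarch_local_field ^ 'd"
  assumes "open U" "x \<in> U"
  shows "\<exists>\<delta>>0. \<forall>y. (\<forall>i. knorm (y $ i - x $ i) \<le> \<delta>) \<longrightarrow> y \<in> U"
proof -
  obtain A where A: "\<And>i. open (A i)" "\<And>i. x $ i \<in> A i" "\<And>y. (\<forall>i. y $ i \<in> A i) \<Longrightarrow> y \<in> U"
    using assms unfolding open_vec_def by metis
  have "\<exists>e>0. ball (x $ i) e \<subseteq> A i" for i using A(1,2) open_contains_ball by blast
  then obtain e where e: "\<And>i. e i > 0" "\<And>i. ball (x $ i) (e i) \<subseteq> A i" by metis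
  define \<delta> where "\<delta> = Min (range e) / 2"
  have "Min (range e) > 0" using e by (subst Min_gr_iff) auto
  moreover have "Min (range e) \<le> e i" for i by (rule Min_le) auto
  ultimately have \<delta>: "\<delta> > 0" "\<delta> < e i" for i
    unfolding \<delta>_def by (simp, smt (verit) field_sum_of_halves)
  have "y \<in> U" if "\<forall>i. knorm (y $ i - x $ i) \<le> \<delta>" for y
  proof (intro A(3) allI)
    fix i
    have "dist (x $ i) (y $ i) < e i"
      using that \<delta>(2)[of i] by (auto simp: dist_knorm knorm_minus_commute intro: le_less_trans)
    thus "y $ i \<in> A i" using e(2)[of i] by (auto simp: subset_iff)
  qed
  thus ?thesis using \<delta> by blast
qed

section \<open>Unconditional sums\<close>

definition null_family :: "('i \<Rightarrow> 'k::nonarch_valued_field) \<Rightarrow> 'i set \<Rightarrow> bool" where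
  "null_family F A \<longleftrightarrow> (\<forall>e>0. finite {x\<in>A. knorm (F x) \<ge> e})"

lemma null_familyD: "null_family F A \<Longrightarrow> e > 0 \<Longrightarrow> finite {x\<in>A. knorm (F x) \<ge> e}"
  by (simp add: null_family_def)

lemma null_family_mono:
  assumes "null_family F A" "\<And>x. x \<in> A \<Longrightarrow> knorm (G x) \<le> knorm (F x)"
  shows "null_family G A"
  unfolding null_family_def
proof (intro allI impI)
  fix e :: real assume "e > 0"
  thus "finite {x \<in> A. e \<le> knorm (G x)}"
    by (intro finite_subset[OF _ null_familyD[OF assms(1) \<open>e > 0\<close>]]) (auto intro: order_trans assms(2))
qed

lemma null_family_bounded:
  assumes "null_family F A"
  shows "\<exists>B>0. \<forall>x\<in>A. knorm (F x) \<le> B"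
proof -
  let ?T = "{x\<in>A. knorm (F x) \<ge> 1}"
  have fin: "finite ?T" using null_familyD[OF assms, of 1] by simp
  have "knorm (F x) \<le> Max (insert 1 ((\<lambda>x. knorm (F x)) ` ?T))" if "x \<in> A" for x
  proof (cases "knorm (F x) \<ge> 1")
    case True
    thus ?thesis using that fin by (intro Max_ge) auto
  next
    case False
    hence "knorm (F x) \<le> 1" by simp
    also have "1 \<le> Max (insert 1 ((\<lambda>x. knorm (F x)) ` ?T))" using fin by (intro Max_ge) auto
    finally show ?thesis .
  qed
  moreover have "Max (insert 1 ((\<lambda>x. knorm (F x)) ` ?T)) \<ge> 1" using fin by (intro Max_ge) auto
  ultimately show ?thesis by (intro exI[of _ "Max (insert 1 ((\<lambda>x. knorm (F x)) ` ?T))"]) auto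
qed

lemma has_sum_knorm:
  fixes F :: "'i \<Rightarrow> 'k::nonarch_valued_field"
  shows "(F has_sum S) A \<longleftrightarrow>
    (\<forall>e>0. \<exists>X. finite X \<and> X \<subseteq> A \<and> (\<forall>Y. finite Y \<and> X \<subseteq> Y \<and> Y \<subseteq> A \<longrightarrow> knorm (sum F Y - S) < e))"
  unfolding has_sum_def tendsto_iff eventually_finite_subsets_at_top by (simp add: dist_knorm)

lemma has_sum_null_family:
  fixes F :: "'i \<Rightarrow> 'k::nonarch_valued_field"
  assumes "(F has_sum S) A"
  shows "null_family F A"
  unfolding null_family_def
proof (intro allI impI)
  fix e :: real assume "e > 0"
  then obtain X where X: "finite X" "X \<subseteq> A"
    "\<And>Y. finite Y \<Longrightarrow> X \<subseteq> Y \<Longrightarrow> Y \<subseteq> A \<Longrightarrow> knorm (sum F Y - S) < e"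
    using assms unfolding has_sum_knorm by metis
  have "x \<in> X" if "x \<in> A" "knorm (F x) \<ge> e" for x
  proof (rule ccontr)
    assume x: "x \<notin> X"
    have "knorm ((sum F (insert x X) - S) - (sum F X - S)) < e"
      using X that by (intro knorm_diff_less X(3)) auto
    thus False using x X that by simp
  qed
  thus "finite {x \<in> A. e \<le> knorm (F x)}" by (intro finite_subset[OF _ X(1)]) auto
qed

lemma has_sum_knorm_le:
  fixes F :: "'i \<Rightarrow> 'k::nonarch_valued_field"
  assumes "(F has_sum S) A" "\<And>x. x \<in> A \<Longrightarrow> knorm (F x) \<le> B" "B \<ge> 0"
  shows "knorm S \<le> B"
proof (rule field_le_epsilon)
  fix e :: real assume "e > 0"
  then obtain X where X: "finite X" "X \<subseteq> A"
    "\<And>Y. finite Y \<Longrightarrow> X \<subseteq> Y \<Longrightarrow> Y \<subseteq> A \<Longrightarrow> knorm (sum F Y - S) < e"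
    using assms(1) unfolding has_sum_knorm by metis
  have "knorm (sum F X) \<le> B" using X(2) assms by (intro knorm_sum_le) auto
  moreover have "knorm (sum F X - S) < e" using X(1,2) by (intro X(3)) auto
  ultimately show "knorm S \<le> B + e"
    using knorm_diff_le[of "sum F X" "B + e" "sum F X - S"] \<open>e > 0\<close> assms(3) by simp
qed

text \<open>
  The partial sums over the finite sets of terms of norm at least \<open>1 / (n + 1)\<close> form a Cauchy
  sequence, because by the ultrametric inequality any further terms change a sum by less than that.
\<close>

lemma null_family_summable:
  fixes F :: "'i \<Rightarrow> 'k::nonarch_local_field"
  assumes "null_family F A"
  shows "F summable_on A"
proof -
  define T where "T n = {x\<in>A. knorm (F x) \<ge> inverse (real (Suc n))}" for n
  have fin: "finite (T n)" for n unfolding T_def by (intro null_familyD assms) auto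
  have close: "knorm (sum F Y - sum F (T n)) < inverse (real (Suc n))"
    if "finite Y" "T n \<subseteq> Y" "Y \<subseteq> A" for Y n
  proof -
    have "sum F Y - sum F (T n) = sum F (Y - T n)" using that by (simp add: sum_diff)
    also have "knorm \<dots> < inverse (real (Suc n))"
      using that by (intro knorm_sum_less) (auto simp: T_def not_le)
    finally show ?thesis .
  qed
  have mono: "T m \<subseteq> T n" if "m \<le> n" for m n
    using that by (auto simp: T_def elim!: order_trans[rotated])
  define s where "s n = sum F (T n)" for n
  have "Cauchy s"
  proof (rule metric_CauchyI)
    fix e :: real assume "e > 0"
    then obtain M where M: "inverse (real (Suc M)) < e" using reals_Archimedean by blast
    have sM: "knorm (s n - s M) < e" if "n \<ge> M" for n
      unfolding s_def using mono[OF that] by (intro less_trans[OF close M] fin) (auto simp: T_def)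
    show "\<exists>M. \<forall>m\<ge>M. \<forall>n\<ge>M. dist (s m) (s n) < e"
    proof (intro exI[of _ M] allI impI)
      fix m n assume "m \<ge> M" "n \<ge> M"
      have "knorm ((s m - s M) - (s n - s M)) < e"
        by (intro knorm_diff_less sM) fact+
      thus "dist (s m) (s n) < e" by (simp add: dist_knorm)
    qed
  qed
  then obtain L where L: "s \<longlonglongrightarrow> L" using Cauchy_convergent convergent_def by blast
  have "(F has_sum L) A"
    unfolding has_sum_knorm
  proof (intro allI impI)
    fix e :: real assume e: "e > 0"
    obtain M where M: "inverse (real (Suc M)) < e" using e reals_Archimedean by blast
    obtain M' where M': "\<And>n. n \<ge> M' \<Longrightarrow> dist (s n) L < e"
      using L e unfolding LIMSEQ_def by blast
    define n where "n = max M M'"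
    have n: "inverse (real (Suc n)) < e"
      by (rule le_less_trans[OF _ M]) (simp add: n_def)
    show "\<exists>X. finite X \<and> X \<subseteq> A \<and> (\<forall>Y. finite Y \<and> X \<subseteq> Y \<and> Y \<subseteq> A \<longrightarrow> knorm (sum F Y - L) < e)"
    proof (intro exI[of _ "T n"] conjI allI impI fin)
      show "T n \<subseteq> A" by (auto simp: T_def)
      fix Y assume Y: "finite Y \<and> T n \<subseteq> Y \<and> Y \<subseteq> A"
      have "knorm (sum F Y - s n) < e" using close[of Y n] Y n by (auto simp: s_def)
      moreover have "knorm (s n - L) < e" using M'[of n] by (simp add: n_def dist_knorm)
      ultimately have "knorm ((sum F Y - s n) + (s n - L)) < e" by (rule knorm_add_less)
      thus "knorm (sum F Y - L) < e" by simp
    qed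
  qed
  thus ?thesis by (auto simp: summable_on_def)
qed

section \<open>Power series on polydiscs\<close>

definition monomial :: "'k::nonarch_local_field ^ 'd \<Rightarrow> ('d \<Rightarrow> nat) \<Rightarrow> 'k" where
  "monomial z \<beta> = (\<Prod>i\<in>UNIV. z $ i ^ \<beta> i)"

definition unit_polydisc :: "('k::nonarch_local_field ^ 'd) set" where
  "unit_polydisc = {z. \<forall>i. knorm (z $ i) \<le> 1}"

lemma knorm_monomial_le_1: "z \<in> unit_polydisc \<Longrightarrow> knorm (monomial z \<beta>) \<le> 1"
  unfolding monomial_def unit_polydisc_def by (intro knorm_prod_le_1 knorm_power_le_1) auto

lemma zero_in_polydisc [simp]: "0 \<in> unit_polydisc"
  by (simp add: unit_polydisc_def)

text \<open>
  An expansion about \<open>x\<close> that is valid on the whole polydisc \<open>x + c z\<close>, \<open>|z| \<le> 1\<close>. The variable is rescaled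
  by \<open>c\<close>, so that convergence on the closed polydisc means that the coefficients tend to zero.
\<close>

definition power_series_at ::
  "'k::nonarch_local_field ^ 'd \<Rightarrow> 'k \<Rightarrow> (('d \<Rightarrow> nat) \<Rightarrow> 'k) \<Rightarrow> ('k ^ 'd \<Rightarrow> 'k) \<Rightarrow> bool" where
  "power_series_at x c b g \<longleftrightarrow> c \<noteq> 0 \<and> null_family b UNIV \<and>
     (\<forall>z\<in>unit_polydisc. ((\<lambda>\<beta>. b \<beta> * monomial z \<beta>) has_sum g (x + c *s z)) UNIV)"

lemma finite_multi_index_le: "finite {\<beta> :: 'd::finite \<Rightarrow> nat. \<forall>i. \<beta> i \<le> \<alpha> i}"
proof -
  have "{\<beta> :: 'd \<Rightarrow> nat. \<forall>i. \<beta> i \<le> \<alpha> i} = PiE UNIV (\<lambda>i. {..\<alpha> i})" by (auto simp: PiE_def Pi_def)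
  thus ?thesis by (simp add: finite_PiE)
qed

lemma null_family_finite_fibres:
  fixes T :: "'i \<Rightarrow> 'k::nonarch_local_field"
  assumes T: "null_family T UNIV" and J: "\<And>\<alpha>. finite (J \<alpha>)"
    and G: "\<And>\<alpha> \<beta>. \<beta> \<in> J \<alpha> \<Longrightarrow> knorm (G (\<alpha>, \<beta>)) \<le> knorm (T \<alpha>)" "\<And>\<alpha> \<beta>. \<beta> \<notin> J \<alpha> \<Longrightarrow> G (\<alpha>, \<beta>) = 0"
  shows "null_family (G :: 'i \<times> 'j \<Rightarrow> 'l::nonarch_local_field) UNIV"
  unfolding null_family_def
proof (intro allI impI)
  fix e :: real assume e: "e > 0"
  have "(\<alpha>, \<beta>) \<in> (SIGMA \<alpha>:{\<alpha>\<in>UNIV. knorm (T \<alpha>) \<ge> e}. J \<alpha>)" if "knorm (G (\<alpha>, \<beta>)) \<ge> e" for \<alpha> \<beta>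
  proof -
    have "\<beta> \<in> J \<alpha>" using G(2)[of \<beta> \<alpha>] that e by (cases "\<beta> \<in> J \<alpha>") auto
    thus ?thesis using G(1)[of \<beta> \<alpha>] that by auto
  qed
  hence "{x \<in> UNIV. e \<le> knorm (G x)} \<subseteq> (SIGMA \<alpha>:{\<alpha>\<in>UNIV. knorm (T \<alpha>) \<ge> e}. J \<alpha>)" by auto
  thus "finite {x \<in> UNIV. e \<le> knorm (G x)}"
    by (rule finite_subset) (intro finite_SigmaI null_familyD T e J)
qed

text \<open>
  Each term of the series about \<open>a\<close> is expanded by the binomial theorem, and the two summations are
  interchanged. The point \<open>y\<close> lies at least as far from \<open>a\<close> in every coordinate as the points of the
  new polydisc, so the term at \<open>y\<close> bounds all parts of the expanded term, and these bounds tend to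
  zero.
\<close>

lemma power_series_recentre:
  fixes x a y :: "'k::nonarch_local_field ^ 'd" and co :: "('d \<Rightarrow> nat) \<Rightarrow> 'k"
  assumes c: "c \<noteq> 0"
    and y: "\<And>i. knorm (x $ i - a $ i) \<le> knorm (y $ i - a $ i)" "\<And>i. knorm c \<le> knorm (y $ i - a $ i)"
    and null: "null_family (\<lambda>\<alpha>. co \<alpha> * (\<Prod>i\<in>UNIV. (y $ i - a $ i) ^ \<alpha> i)) UNIV"
    and g: "\<And>z. z \<in> unit_polydisc \<Longrightarrow>
       ((\<lambda>\<alpha>. co \<alpha> * (\<Prod>i\<in>UNIV. ((x + c *s z) $ i - a $ i) ^ \<alpha> i)) has_sum g (x + c *s z)) UNIV"
  shows "\<exists>b. power_series_at x c b g"
proof -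
  define T where "T \<alpha> = co \<alpha> * (\<Prod>i\<in>UNIV. (y $ i - a $ i) ^ \<alpha> i)" for \<alpha>
  define B where "B \<alpha> \<beta> = co \<alpha> * (\<Prod>i\<in>UNIV. of_nat (\<alpha> i choose \<beta> i) * (x $ i - a $ i) ^ (\<alpha> i - \<beta> i) * c ^ \<beta> i)" for \<alpha> \<beta>
  define J where "J \<alpha> = {\<beta> :: 'd \<Rightarrow> nat. \<forall>i. \<beta> i \<le> \<alpha> i}" for \<alpha>
  have T: "null_family T UNIV" using null by (simp add: T_def[abs_def])
  have J: "finite (J \<alpha>)" for \<alpha> unfolding J_def by (rule finite_multi_index_le)
  have B0: "B \<alpha> \<beta> = 0" if "\<beta> \<notin> J \<alpha>" for \<alpha> \<beta>
  proof -
    from that obtain i where "\<alpha> i < \<beta> i" by (auto simp: J_def not_le)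
    hence "(\<Prod>i\<in>UNIV. of_nat (\<alpha> i choose \<beta> i) * (x $ i - a $ i) ^ (\<alpha> i - \<beta> i) * c ^ \<beta> i) = 0"
      by (intro prod_zero) (auto intro!: exI[of _ i] simp: binomial_eq_0)
    thus ?thesis by (simp add: B_def)
  qed
  have B1: "knorm (B \<alpha> \<beta>) \<le> knorm (T \<alpha>)" if "\<beta> \<in> J \<alpha>" for \<alpha> \<beta>
  proof -
    have "(\<Prod>i\<in>UNIV. knorm (of_nat (\<alpha> i choose \<beta> i) * (x $ i - a $ i) ^ (\<alpha> i - \<beta> i) * c ^ \<beta> i)) \<le>
        (\<Prod>i\<in>UNIV. knorm ((y $ i - a $ i) ^ \<alpha> i))"
    proof (intro prod_mono conjI)
      fix i
      have "knorm (of_nat (\<alpha> i choose \<beta> i) * (x $ i - a $ i) ^ (\<alpha> i - \<beta> i) * c ^ \<beta> i) \<le>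
         1 * knorm (y $ i - a $ i) ^ (\<alpha> i - \<beta> i) * knorm (y $ i - a $ i) ^ \<beta> i"
        by (intro knorm_mult_le) (auto simp: knorm_power intro!: power_mono y)
      also have "\<dots> = knorm (y $ i - a $ i) ^ \<alpha> i"
        using that by (simp add: J_def flip: power_add)
      finally show "knorm (of_nat (\<alpha> i choose \<beta> i) * (x $ i - a $ i) ^ (\<alpha> i - \<beta> i) * c ^ \<beta> i) \<le>
        knorm ((y $ i - a $ i) ^ \<alpha> i)" by (simp add: knorm_power)
    qed auto
    hence "knorm (co \<alpha>) * (\<Prod>i\<in>UNIV. knorm (of_nat (\<alpha> i choose \<beta> i) * (x $ i - a $ i) ^ (\<alpha> i - \<beta> i) * c ^ \<beta> i)) \<le>
        knorm (co \<alpha>) * (\<Prod>i\<in>UNIV. knorm ((y $ i - a $ i) ^ \<alpha> i))"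
      by (rule mult_left_mono) simp
    thus ?thesis unfolding B_def T_def knorm_mult[of "co \<alpha>"] knorm_prod .
  qed
  define b where "b \<beta> = infsum (\<lambda>\<alpha>. B \<alpha> \<beta>) UNIV" for \<beta>
  have b: "((\<lambda>\<alpha>. B \<alpha> \<beta>) has_sum b \<beta>) UNIV" for \<beta>
  proof -
    have "null_family (\<lambda>\<alpha>. B \<alpha> \<beta>) UNIV"
    proof (rule null_family_mono[OF T])
      fix \<alpha> show "knorm (B \<alpha> \<beta>) \<le> knorm (T \<alpha>)"
        using B0[of \<beta> \<alpha>] B1[of \<beta> \<alpha>] by (cases "\<beta> \<in> J \<alpha>") simp_all
    qed
    thus ?thesis unfolding b_def by (intro has_sum_infsum null_family_summable)
  qed
  have "null_family b UNIV"
    unfolding null_family_def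
  proof (intro allI impI)
    fix e :: real assume e: "e > 0"
    have "\<beta> \<in> (\<Union>\<alpha>\<in>{\<alpha>\<in>UNIV. knorm (T \<alpha>) \<ge> e / 2}. J \<alpha>)" if \<beta>: "knorm (b \<beta>) \<ge> e" for \<beta>
    proof (rule ccontr)
      assume *: "\<beta> \<notin> (\<Union>\<alpha>\<in>{\<alpha>\<in>UNIV. knorm (T \<alpha>) \<ge> e / 2}. J \<alpha>)"
      have "knorm (b \<beta>) \<le> e / 2"
      proof (rule has_sum_knorm_le[OF b])
        fix \<alpha>
        have "knorm (T \<alpha>) < e / 2" if "\<beta> \<in> J \<alpha>" using * that by (auto simp: not_le)
        thus "knorm (B \<alpha> \<beta>) \<le> e / 2"
          using B0[of \<beta> \<alpha>] B1[of \<beta> \<alpha>] e by (cases "\<beta> \<in> J \<alpha>") auto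
      qed (use e in auto)
      thus False using \<beta> e by simp
    qed
    thus "finite {x \<in> UNIV. e \<le> knorm (b x)}"
      using e by (intro finite_subset[OF _ finite_UN_I[OF null_familyD[OF T, of "e / 2"] J]]) auto
  qed
  moreover have "((\<lambda>\<beta>. b \<beta> * monomial z \<beta>) has_sum g (x + c *s z)) UNIV" if z: "z \<in> unit_polydisc" for z
  proof -
    define G where "G = (\<lambda>(\<alpha>, \<beta>). B \<alpha> \<beta> * monomial z \<beta>)"
    have "null_family G UNIV"
    proof (rule null_family_finite_fibres[OF T J])
      fix \<alpha> \<beta> assume "\<beta> \<in> J \<alpha>"
      thus "knorm (G (\<alpha>, \<beta>)) \<le> knorm (T \<alpha>)"
        using B1 knorm_monomial_le_1[OF z] by (auto simp: G_def intro!: knorm_mult_le_right)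
    qed (use B0 in \<open>auto simp: G_def\<close>)
    then obtain L where L: "(G has_sum L) (UNIV \<times> UNIV)"
      using null_family_summable[of G UNIV] by (auto simp: summable_on_def)
    have inner: "((\<lambda>\<beta>. G (\<alpha>, \<beta>)) has_sum co \<alpha> * (\<Prod>i\<in>UNIV. ((x + c *s z) $ i - a $ i) ^ \<alpha> i)) UNIV" for \<alpha>
    proof (rule has_sum_finite_neutralI[OF J])
      have "(\<Prod>i\<in>UNIV. ((x + c *s z) $ i - a $ i) ^ \<alpha> i) =
         (\<Prod>i\<in>UNIV. \<Sum>k\<le>\<alpha> i. of_nat (\<alpha> i choose k) * (c * z $ i) ^ k * (x $ i - a $ i) ^ (\<alpha> i - k))"
      proof (rule prod.cong)
        fix i
        have "(x + c *s z) $ i - a $ i = c * z $ i + (x $ i - a $ i)" by simp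
        thus "((x + c *s z) $ i - a $ i) ^ \<alpha> i =
          (\<Sum>k\<le>\<alpha> i. of_nat (\<alpha> i choose k) * (c * z $ i) ^ k * (x $ i - a $ i) ^ (\<alpha> i - k))"
          by (simp only: binomial_ring)
      qed auto
      also have "\<dots> = (\<Sum>\<beta>\<in>PiE UNIV (\<lambda>i. {..\<alpha> i}). \<Prod>i\<in>UNIV. of_nat (\<alpha> i choose \<beta> i) * (c * z $ i) ^ \<beta> i * (x $ i - a $ i) ^ (\<alpha> i - \<beta> i))"
        by (rule prod_sum_PiE) auto
      also have "PiE UNIV (\<lambda>i. {..\<alpha> i}) = J \<alpha>" by (auto simp: J_def PiE_def Pi_def)
      finally have "co \<alpha> * (\<Prod>i\<in>UNIV. ((x + c *s z) $ i - a $ i) ^ \<alpha> i) =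
        (\<Sum>\<beta>\<in>J \<alpha>. co \<alpha> * (\<Prod>i\<in>UNIV. of_nat (\<alpha> i choose \<beta> i) * (c * z $ i) ^ \<beta> i * (x $ i - a $ i) ^ (\<alpha> i - \<beta> i)))"
        by (simp only: sum_distrib_left)
      also have "\<dots> = (\<Sum>\<beta>\<in>J \<alpha>. G (\<alpha>, \<beta>))"
      proof (rule sum.cong)
        fix \<beta>
        have "(\<Prod>i\<in>UNIV. of_nat (\<alpha> i choose \<beta> i) * (c * z $ i) ^ \<beta> i * (x $ i - a $ i) ^ (\<alpha> i - \<beta> i)) =
          (\<Prod>i\<in>UNIV. (of_nat (\<alpha> i choose \<beta> i) * (x $ i - a $ i) ^ (\<alpha> i - \<beta> i) * c ^ \<beta> i) * z $ i ^ \<beta> i)"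
          by (rule prod.cong) (simp_all only: power_mult_distrib mult_ac)
        also have "\<dots> = (\<Prod>i\<in>UNIV. of_nat (\<alpha> i choose \<beta> i) * (x $ i - a $ i) ^ (\<alpha> i - \<beta> i) * c ^ \<beta> i) * monomial z \<beta>"
          unfolding monomial_def by (rule prod.distrib)
        finally show "co \<alpha> * (\<Prod>i\<in>UNIV. of_nat (\<alpha> i choose \<beta> i) * (c * z $ i) ^ \<beta> i * (x $ i - a $ i) ^ (\<alpha> i - \<beta> i)) =
          G (\<alpha>, \<beta>)" by (simp only: G_def B_def prod.case mult.assoc)
      qed auto
      finally show "co \<alpha> * (\<Prod>i\<in>UNIV. ((x + c *s z) $ i - a $ i) ^ \<alpha> i) = (\<Sum>\<beta>\<in>J \<alpha>. G (\<alpha>, \<beta>))" .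
    qed (use B0 in \<open>auto simp: G_def\<close>)
    have "((\<lambda>\<alpha>. co \<alpha> * (\<Prod>i\<in>UNIV. ((x + c *s z) $ i - a $ i) ^ \<alpha> i)) has_sum L) UNIV"
      by (rule has_sum_SigmaD[OF L inner])
    from this g[OF z] have L_eq: "L = g (x + c *s z)" by (rule has_sum_unique)
    have "((\<lambda>(\<beta>, \<alpha>). G (\<alpha>, \<beta>)) has_sum L) (UNIV \<times> UNIV)"
      by (rule has_sum_swap[THEN iffD1, OF L])
    moreover have "((\<lambda>\<alpha>. (\<lambda>(\<beta>, \<alpha>). G (\<alpha>, \<beta>)) (\<beta>, \<alpha>)) has_sum b \<beta> * monomial z \<beta>) UNIV" for \<beta>
      using has_sum_cmult_left[OF b[of \<beta>], of "monomial z \<beta>"] by (simp add: G_def)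
    ultimately have "((\<lambda>\<beta>. b \<beta> * monomial z \<beta>) has_sum L) UNIV"
      by (rule has_sum_SigmaD)
    thus ?thesis by (simp add: L_eq)
  qed
  ultimately have "power_series_at x c b g" using c by (simp add: power_series_at_def)
  thus ?thesis by (rule exI[of _ b])
qed

text \<open>
  The centre \<open>a\<close> of the given expansion may lie outside its domain and may share coordinates with
  \<open>x\<close>. Moving \<open>x\<close> slightly in the shared coordinates gives the point \<open>y\<close> needed for recentring.
\<close>

lemma K_analytic_on_power_series:
  fixes f :: "'k::nonarch_local_field ^ 'd \<Rightarrow> 'k ^ 'm"
  assumes f: "K_analytic_on f X" and x: "x \<in> X" and e: "e > 0"
  shows "\<exists>c b. c \<noteq> 0 \<and> knorm c < e \<and> (\<forall>z\<in>unit_polydisc. x + c *s z \<in> X) \<and>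
    (\<forall>j. power_series_at x c (b j) (\<lambda>y. f y $ j))"
proof -
  from f x have "\<exists>U. open U \<and> x \<in> U \<and> U \<subseteq> X \<and>
        (\<exists>(a :: 'k ^ 'd) (c :: 'm \<Rightarrow> ('d \<Rightarrow> nat) \<Rightarrow> 'k). \<forall>y\<in>U. \<forall>j.
           ((\<lambda>\<alpha>. c j \<alpha> * (\<Prod>i\<in>UNIV. (y $ i - a $ i) ^ \<alpha> i)) has_sum f y $ j) UNIV)"
    unfolding K_analytic_on_def by (rule bspec)
  then obtain U and a :: "'k ^ 'd" and co :: "'m \<Rightarrow> ('d \<Rightarrow> nat) \<Rightarrow> 'k"
    where U: "open U" "x \<in> U" "U \<subseteq> X" and sums': "\<forall>y\<in>U. \<forall>j.
           ((\<lambda>\<alpha>. co j \<alpha> * (\<Prod>i\<in>UNIV. (y $ i - a $ i) ^ \<alpha> i)) has_sum f y $ j) UNIV"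
    by (elim exE conjE)
  have sums: "((\<lambda>\<alpha>. co j \<alpha> * (\<Prod>i\<in>UNIV. (y $ i - a $ i) ^ \<alpha> i)) has_sum f y $ j) UNIV" if "y \<in> U" for y j
    using sums' that by simp
  obtain \<delta> where \<delta>: "\<delta> > 0" "\<And>y. (\<And>i. knorm (y $ i - x $ i) \<le> \<delta>) \<Longrightarrow> y \<in> U"
    using open_vec_knorm[OF U(1,2)] by blast
  obtain \<pi> :: 'k where \<pi>: "\<pi> \<noteq> 0" "knorm \<pi> < \<delta>" using exists_small_knorm \<delta> by blast
  define y where "y = (\<chi> i. if x $ i = a $ i then x $ i + \<pi> else x $ i)"
  have y: "y \<in> U" using \<pi> \<delta>(1) by (intro \<delta>) (auto simp: y_def)
  have y_nz: "y $ i - a $ i \<noteq> 0" for i using \<pi> by (simp add: y_def)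
  have y_ge: "knorm (x $ i - a $ i) \<le> knorm (y $ i - a $ i)" for i by (simp add: y_def)
  define \<epsilon> where "\<epsilon> = Min (insert e (insert \<delta> (range (\<lambda>i. knorm (y $ i - a $ i)))))"
  have "\<epsilon> > 0" unfolding \<epsilon>_def using e \<delta> y_nz by (subst Min_gr_iff) auto
  then obtain c :: 'k where c: "c \<noteq> 0" "knorm c < \<epsilon>" using exists_small_knorm by blast
  have \<epsilon>: "\<epsilon> \<le> e" "\<epsilon> \<le> \<delta>" "\<And>i. \<epsilon> \<le> knorm (y $ i - a $ i)"
    unfolding \<epsilon>_def by (rule Min_le; simp)+
  have in_U: "x + c *s z \<in> U" if "z \<in> unit_polydisc" for z
  proof (rule \<delta>(2))
    fix i
    have "knorm (c * z $ i) \<le> knorm c" using that by (auto simp: unit_polydisc_def intro: knorm_mult_le_right)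
    thus "knorm ((x + c *s z) $ i - x $ i) \<le> \<delta>" using c \<epsilon> by simp
  qed
  have "\<exists>b. power_series_at x c b (\<lambda>y. f y $ j)" for j
  proof (rule power_series_recentre[OF c(1) y_ge])
    show "knorm c \<le> knorm (y $ i - a $ i)" for i using c \<epsilon>(3)[of i] by simp
    show "null_family (\<lambda>\<alpha>. co j \<alpha> * (\<Prod>i\<in>UNIV. (y $ i - a $ i) ^ \<alpha> i)) UNIV"
      using sums[OF y] by (rule has_sum_null_family)
  qed (intro sums in_U)
  then obtain b where "\<And>j. power_series_at x c (b j) (\<lambda>y. f y $ j)" by metis
  moreover have "knorm c < e" using c \<epsilon> by simp
  ultimately show ?thesis using c in_U U by blast
qed

section \<open>Derivatives of power series\<close>

lemma power_expand:
  assumes "knorm (z :: 'k::nonarch_valued_field) \<le> 1" "knorm h \<le> 1"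
  shows "\<exists>r. knorm r \<le> 1 \<and> (z + h) ^ n = z ^ n + h * (of_nat n * z ^ (n - 1)) + h ^ 2 * r"
proof (induction n)
  case 0
  show ?case by (intro exI[of _ 0]) auto
next
  case (Suc n)
  then obtain r where r: "knorm r \<le> 1" "(z + h) ^ n = z ^ n + h * (of_nat n * z ^ (n - 1)) + h ^ 2 * r"
    by blast
  have zn: "z * (of_nat n * z ^ (n - 1)) = of_nat n * z ^ n" by (cases n) (auto simp: mult_ac)
  have "(z + h) ^ Suc n = z ^ Suc n + h * (z * (of_nat n * z ^ (n - 1)) + z ^ n) + h ^ 2 * (z * r + of_nat n * z ^ (n - 1) + h * r)"
    unfolding power_Suc[of "z + h"] r(2) by (simp add: algebra_simps power2_eq_square)
  also have "z * (of_nat n * z ^ (n - 1)) + z ^ n = of_nat (Suc n) * z ^ (Suc n - 1)"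
    unfolding zn by (simp add: algebra_simps)
  finally show ?case
    by (rule exI[of _ "z * r + of_nat n * z ^ (n - 1) + h * r", OF conjI, rotated])
      (intro knorm_add_le knorm_mult_le_left[of z] knorm_mult_le_left[of h] knorm_mult_le_left[of "of_nat n"] knorm_power_le_1 assms r, auto)
qed

lemma monomial_split:
  "monomial z \<beta> = z $ i ^ \<beta> i * (\<Prod>l\<in>UNIV - {i}. z $ l ^ \<beta> l)"
  unfolding monomial_def by (subst prod.remove[of _ i]) auto

lemma has_sum_shift_index:
  fixes F :: "('d \<Rightarrow> nat) \<Rightarrow> 'k::{comm_monoid_add, topological_space}"
  assumes "((\<lambda>\<beta>. F (\<beta>(i := Suc (\<beta> i)))) has_sum D) UNIV" "\<And>\<beta>. \<beta> i = 0 \<Longrightarrow> F \<beta> = 0"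
  shows "(F has_sum D) UNIV"
proof -
  define \<phi> where "\<phi> \<beta> = \<beta>(i := Suc (\<beta> i))" for \<beta> :: "'d \<Rightarrow> nat"
  have inj: "inj \<phi>"
  proof (rule injI)
    fix \<beta> \<beta>' :: "'d \<Rightarrow> nat" assume *: "\<phi> \<beta> = \<phi> \<beta>'"
    show "\<beta> = \<beta>'"
    proof
      fix l show "\<beta> l = \<beta>' l" using fun_cong[OF *, of l] by (auto simp: \<phi>_def split: if_splits)
    qed
  qed
  have "(F has_sum D) (range \<phi>)"
    using assms(1) inj by (subst has_sum_reindex) (auto simp: o_def \<phi>_def)
  also have "(F has_sum D) (range \<phi>) \<longleftrightarrow> (F has_sum D) UNIV"
  proof (rule has_sum_cong_neutral)
    fix \<beta> assume "\<beta> \<in> UNIV - range \<phi>"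
    moreover have "\<beta> = \<phi> (\<beta>(i := \<beta> i - 1))" if "\<beta> i \<noteq> 0" using that by (auto simp: \<phi>_def)
    ultimately show "F \<beta> = 0" using assms(2) by blast
  qed auto
  finally show ?thesis .
qed

text \<open>
  The difference quotient minus the series differentiated termwise is a series whose terms are bounded
  by \<open>|h|\<close> times a constant, since \<open>(z + h)^n\<close> differs from its linear part by \<open>h^2\<close> times an
  element of the valuation ring.
\<close>

lemma power_series_partial_deriv:
  fixes x :: "'k::nonarch_local_field ^ 'd"
  assumes g: "power_series_at x c b g"
  shows "power_series_at x c (\<lambda>\<beta>. of_nat (Suc (\<beta> i)) * b (\<beta>(i := Suc (\<beta> i))) / c) (partial_deriv i g)"
proof -
  have c: "c \<noteq> 0" and b: "null_family b UNIV"
    and sums: "\<And>z. z \<in> unit_polydisc \<Longrightarrow> ((\<lambda>\<beta>. b \<beta> * monomial z \<beta>) has_sum g (x + c *s z)) UNIV"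
    using g by (auto simp: power_series_at_def)
  obtain B where B: "B > 0" "\<And>\<beta>. knorm (b \<beta>) \<le> B" using null_family_bounded[OF b] by auto
  define b' where "b' \<beta> = of_nat (Suc (\<beta> i)) * b (\<beta>(i := Suc (\<beta> i))) / c" for \<beta>
  have null': "null_family b' UNIV"
    unfolding null_family_def
  proof (intro allI impI)
    fix e :: real assume e: "e > 0"
    have "finite {\<beta>\<in>UNIV. knorm (b \<beta>) \<ge> e * knorm c}" using e c by (intro null_familyD[OF b]) auto
    hence "finite ((\<lambda>\<beta>. \<beta>(i := \<beta> i - 1)) ` {\<beta>\<in>UNIV. knorm (b \<beta>) \<ge> e * knorm c})" by (rule finite_imageI)
    moreover have "\<beta> \<in> (\<lambda>\<beta>. \<beta>(i := \<beta> i - 1)) ` {\<beta>\<in>UNIV. knorm (b \<beta>) \<ge> e * knorm c}" if "knorm (b' \<beta>) \<ge> e" for \<beta>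
    proof (rule image_eqI)
      show "\<beta> = (\<beta>(i := Suc (\<beta> i)))(i := (\<beta>(i := Suc (\<beta> i))) i - 1)" by auto
      have "knorm (of_nat (Suc (\<beta> i)) * b (\<beta>(i := Suc (\<beta> i)))) \<le> knorm (b (\<beta>(i := Suc (\<beta> i))))"
        by (rule knorm_mult_le_left[OF knorm_of_nat_le]) simp
      thus "\<beta>(i := Suc (\<beta> i)) \<in> {\<beta>\<in>UNIV. knorm (b \<beta>) \<ge> e * knorm c}"
        using that c by (auto simp: b'_def knorm_divide field_simps)
    qed
    ultimately show "finite {\<beta> \<in> UNIV. e \<le> knorm (b' \<beta>)}" by (auto elim: finite_subset[rotated])
  qed
  have "((\<lambda>\<beta>. b' \<beta> * monomial z \<beta>) has_sum partial_deriv i g (x + c *s z)) UNIV"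
    if z: "z \<in> unit_polydisc" for z
  proof -
    have "null_family (\<lambda>\<beta>. b' \<beta> * monomial z \<beta>) UNIV"
      by (intro null_family_mono[OF null'] knorm_mult_le_right knorm_monomial_le_1 z order.refl)
    then obtain D where D: "((\<lambda>\<beta>. b' \<beta> * monomial z \<beta>) has_sum D) UNIV"
      using null_family_summable by (auto simp: summable_on_def)
    define M where "M \<beta> = (\<Prod>l\<in>UNIV - {i}. z $ l ^ \<beta> l)" for \<beta>
    have M: "knorm (M \<beta>) \<le> 1" for \<beta>
      using z unfolding M_def unit_polydisc_def by (intro knorm_prod_le_1 knorm_power_le_1) auto
    have M_upd: "M (\<beta>(i := n)) = M \<beta>" for \<beta> n unfolding M_def by (rule prod.cong) auto
    have D': "((\<lambda>\<beta>. b \<beta> * M \<beta> * (of_nat (\<beta> i) * z $ i ^ (\<beta> i - 1)) / c) has_sum D) UNIV"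
    proof (rule has_sum_shift_index[of _ i])
      have "(\<lambda>\<beta>. b' \<beta> * monomial z \<beta>) =
        (\<lambda>\<beta>. b (\<beta>(i := Suc (\<beta> i))) * M (\<beta>(i := Suc (\<beta> i))) *
           (of_nat ((\<beta>(i := Suc (\<beta> i))) i) * z $ i ^ ((\<beta>(i := Suc (\<beta> i))) i - 1)) / c)"
        by (rule ext) (simp add: b'_def monomial_split[of z _ i] M_def[symmetric] M_upd mult_ac del: of_nat_Suc)
      thus "((\<lambda>\<beta>. b (\<beta>(i := Suc (\<beta> i))) * M (\<beta>(i := Suc (\<beta> i))) *
           (of_nat ((\<beta>(i := Suc (\<beta> i))) i) * z $ i ^ ((\<beta>(i := Suc (\<beta> i))) i - 1)) / c) has_sum D) UNIV"
        using D by simp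
    qed auto
    have lim: "((\<lambda>h. (g (x + c *s z + axis i h) - g (x + c *s z)) / h) \<longlongrightarrow> D) (at 0)"
      unfolding LIM_def
    proof (intro allI impI)
      fix e :: real assume e: "e > 0"
      define d where "d = min (knorm c) (e * knorm c ^ 2 / B)"
      have d: "d > 0" "d \<le> knorm c" "d \<le> e * knorm c ^ 2 / B"
        using e B c by (auto simp: d_def knorm_eq_zero intro!: divide_pos_pos mult_pos_pos)
      show "\<exists>s>0. \<forall>h. h \<noteq> 0 \<and> dist h 0 < s \<longrightarrow>
        dist ((g (x + c *s z + axis i h) - g (x + c *s z)) / h) D < e"
      proof (intro exI[of _ d] conjI d(1) allI impI)
        fix h :: 'k assume "h \<noteq> 0 \<and> dist h 0 < d"
        hence h: "h \<noteq> 0" "knorm h < d" by (auto simp: dist_knorm)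
        define h' where "h' = h / c"
        have h': "h = c * h'" "h' \<noteq> 0" "knorm h' \<le> 1"
          using h c d by (auto simp: h'_def knorm_divide)
        define z' where "z' = z + axis i h'"
        have z'i: "z' $ i = z $ i + h'" "\<And>l. l \<noteq> i \<Longrightarrow> z' $ l = z $ l" by (auto simp: z'_def axis_def)
        have z': "z' \<in> unit_polydisc"
          using z h' by (auto simp: unit_polydisc_def z'_def axis_def intro!: knorm_add_le)
        have xz': "x + c *s z + axis i h = x + c *s z'"
          by (auto simp: vec_eq_iff z'_def axis_def h'(1) distrib_left)
        have "\<forall>\<beta>. \<exists>r. knorm r \<le> 1 \<and>
           (z $ i + h') ^ \<beta> i = z $ i ^ \<beta> i + h' * (of_nat (\<beta> i) * z $ i ^ (\<beta> i - 1)) + h' ^ 2 * r" for \<beta> :: "'d \<Rightarrow> nat"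
          using z h' by (intro allI power_expand) (auto simp: unit_polydisc_def)
        then obtain r where r: "\<And>\<beta> :: 'd \<Rightarrow> nat. knorm (r \<beta>) \<le> 1"
          "\<And>\<beta> :: 'd \<Rightarrow> nat. (z $ i + h') ^ \<beta> i = z $ i ^ \<beta> i + h' * (of_nat (\<beta> i) * z $ i ^ (\<beta> i - 1)) + h' ^ 2 * r \<beta>"
          by metis
        have mono_z: "monomial z \<beta> = z $ i ^ \<beta> i * M \<beta>" for \<beta>
          by (simp add: monomial_split[of z _ i] M_def)
        have mono_z': "monomial z' \<beta> = (z $ i + h') ^ \<beta> i * M \<beta>" for \<beta>
          unfolding monomial_split[of z' _ i] M_def z'i(1) using z'i(2) by (auto intro!: prod.cong)
        have "((\<lambda>\<beta>. (b \<beta> * monomial z' \<beta> + - (b \<beta> * monomial z \<beta>)) * inverse h +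
            - (b \<beta> * M \<beta> * (of_nat (\<beta> i) * z $ i ^ (\<beta> i - 1)) / c))
          has_sum (g (x + c *s z') + - g (x + c *s z)) * inverse h + - D) UNIV"
          by (intro has_sum_add has_sum_cmult_left has_sum_uminusI sums z z' D')
        also have "(\<lambda>\<beta>. (b \<beta> * monomial z' \<beta> + - (b \<beta> * monomial z \<beta>)) * inverse h +
            - (b \<beta> * M \<beta> * (of_nat (\<beta> i) * z $ i ^ (\<beta> i - 1)) / c)) =
          (\<lambda>\<beta>. b \<beta> * M \<beta> * r \<beta> * (h' / c))"
        proof
          fix \<beta>
          show "(b \<beta> * monomial z' \<beta> + - (b \<beta> * monomial z \<beta>)) * inverse h +
            - (b \<beta> * M \<beta> * (of_nat (\<beta> i) * z $ i ^ (\<beta> i - 1)) / c) = b \<beta> * M \<beta> * r \<beta> * (h' / c)"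
            unfolding mono_z mono_z' r(2) using h' c
            by (simp add: field_simps power2_eq_square)
        qed
        finally have "knorm ((g (x + c *s z') + - g (x + c *s z)) * inverse h + - D) \<le> B * knorm (h' / c)"
        proof (rule has_sum_knorm_le)
          fix \<beta> show "knorm (b \<beta> * M \<beta> * r \<beta> * (h' / c)) \<le> B * knorm (h' / c)"
            by (intro knorm_mult_le knorm_mult_le_right M r B order.refl)
        qed (use B in auto)
        also have "\<dots> = B * knorm h / knorm c ^ 2"
          by (simp add: h'_def knorm_divide knorm_mult power2_eq_square)
        also have "\<dots> < e"
        proof -
          have "knorm h < e * knorm c ^ 2 / B" using h d by simp
          moreover have "knorm c ^ 2 > 0" using c by (simp add: knorm_eq_zero)
          ultimately show ?thesis using B by (simp add: field_simps)
        qed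
        finally show "dist ((g (x + c *s z + axis i h) - g (x + c *s z)) / h) D < e"
          by (simp add: xz' dist_knorm divide_inverse)
      qed
    qed
    have "partial_deriv i g (x + c *s z) = D"
      unfolding partial_deriv_def using at_0_neq_bot lim by (rule tendsto_Lim)
    thus ?thesis using D by simp
  qed
  thus ?thesis using c null' by (simp add: power_series_at_def b'_def[abs_def])
qed

text \<open>
  The integer factors \<open>N\<close> depend on the list of derivatives only; they are common to all series.
\<close>

lemma power_series_foldr_partial_deriv:
  fixes x :: "'k::nonarch_local_field ^ 'd"
  shows "\<exists>N :: ('d \<Rightarrow> nat) \<Rightarrow> nat. \<forall>b g. power_series_at x c b g \<longrightarrow>
    power_series_at x c (\<lambda>\<beta>. of_nat (N \<beta>) * b (\<lambda>i. \<beta> i + count_list is i) / c ^ length is)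
      (foldr partial_deriv is g)"
proof (induction "is")
  case Nil
  show ?case by (intro exI[of _ "\<lambda>_. 1"]) auto
next
  case (Cons i "is")
  then obtain N :: "('d \<Rightarrow> nat) \<Rightarrow> nat" where N: "\<And>b g. power_series_at x c b g \<Longrightarrow>
    power_series_at x c (\<lambda>\<beta>. of_nat (N \<beta>) * b (\<lambda>i. \<beta> i + count_list is i) / c ^ length is)
      (foldr partial_deriv is g)" by blast
  show ?case
  proof (intro exI[of _ "\<lambda>\<beta>. Suc (\<beta> i) * N (\<beta>(i := Suc (\<beta> i)))"] allI impI)
    fix b g assume "power_series_at x c b g"
    from power_series_partial_deriv[OF N[OF this], of i]
    have "power_series_at x c (\<lambda>\<beta>. of_nat (Suc (\<beta> i)) * (of_nat (N (\<beta>(i := Suc (\<beta> i)))) *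
        b (\<lambda>l. (\<beta>(i := Suc (\<beta> i))) l + count_list is l) / c ^ length is) / c)
      (partial_deriv i (foldr partial_deriv is g))" .
    moreover have "(\<lambda>l. (\<beta>(i := Suc (\<beta> i))) l + count_list is l) = (\<lambda>l. \<beta> l + count_list (i # is) l)" for \<beta>
      by (rule ext) auto
    ultimately show "power_series_at x c (\<lambda>\<beta>. of_nat (Suc (\<beta> i) * N (\<beta>(i := Suc (\<beta> i)))) *
        b (\<lambda>l. \<beta> l + count_list (i # is) l) / c ^ length (i # is)) (foldr partial_deriv (i # is) g)"
      by (simp only: of_nat_mult mult.assoc times_divide_eq_right divide_divide_eq_left length_Cons
          power_Suc2 foldr.simps comp_apply)
  qed
qed

lemma exists_list_with_counts: "\<exists>is. \<forall>i :: 'd::finite. count_list is i = \<alpha> i"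
proof -
  have rep: "count_list (replicate n j) i = (if i = j then n else 0)" for n and i j :: 'd
    by (induction n) auto
  have "\<exists>is. \<forall>i. count_list is i = (if i \<in> A then \<alpha> i else 0)" if "finite A" for A :: "'d set"
    using that
  proof induction
    case empty
    show ?case by (intro exI[of _ "[]"]) auto
  next
    case (insert j A)
    then obtain "is" where "\<And>i. count_list is i = (if i \<in> A then \<alpha> i else 0)" by blast
    thus ?case using insert by (intro exI[of _ "replicate (\<alpha> j) j @ is"]) (auto simp: rep)
  qed
  from this[of UNIV] show ?thesis by simp
qed

text \<open>
  A partial derivative at the centre is a multiple of the corresponding coefficient, with a factor
  common to all series. So if the derivative of a linear combination of series is nonzero,
  then so is its coefficient; this is how the type condition is used.
\<close>

lemma multi_deriv_power_series:
  fixes x :: "'k::nonarch_local_field ^ 'd"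
  shows "\<exists>e. \<forall>b g. power_series_at x c b g \<longrightarrow> multi_deriv \<alpha> g x = e * b \<alpha>"
proof -
  define "is" where "is = (SOME is. \<forall>i. count_list is i = \<alpha> i)"
  have cnt: "count_list is i = \<alpha> i" for i
    using someI_ex[OF exists_list_with_counts[of \<alpha>]] by (simp add: is_def)
  obtain N :: "('d \<Rightarrow> nat) \<Rightarrow> nat" where N: "\<And>b g. power_series_at x c b g \<Longrightarrow>
    power_series_at x c (\<lambda>\<beta>. of_nat (N \<beta>) * b (\<lambda>i. \<beta> i + count_list is i) / c ^ length is)
      (foldr partial_deriv is g)" using power_series_foldr_partial_deriv by blast
  have at_centre: "g x = b (\<lambda>_. 0)" if "power_series_at x c b g" for b g
  proof -
    have "\<forall>z\<in>unit_polydisc. ((\<lambda>\<beta>. b \<beta> * monomial z \<beta>) has_sum g (x + c *s z)) UNIV"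
      using that by (simp add: power_series_at_def)
    from bspec[OF this zero_in_polydisc]
    have "((\<lambda>\<beta>. b \<beta> * monomial 0 \<beta>) has_sum g (x + c *s 0)) UNIV" .
    moreover have "((\<lambda>\<beta>. b \<beta> * monomial 0 \<beta>) has_sum b (\<lambda>_. 0)) UNIV"
    proof (rule has_sum_finite_neutralI)
      show "b \<beta> * monomial 0 \<beta> = 0" if "\<beta> \<in> UNIV - {\<lambda>_. 0}" for \<beta>
      proof -
        from that obtain i where "\<beta> i \<noteq> 0" by (auto simp: fun_eq_iff)
        thus ?thesis by (simp add: monomial_split[of _ _ i] zero_power)
      qed
    qed (auto simp: monomial_def)
    ultimately have "g (x + c *s 0) = b (\<lambda>_. 0)" by (rule has_sum_unique)
    thus ?thesis by simp
  qed
  have "multi_deriv \<alpha> g x = of_nat (N (\<lambda>_. 0)) / c ^ length is * b \<alpha>" if "power_series_at x c b g" for b g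
    using at_centre[OF N[OF that]] by (simp add: multi_deriv_def is_def[symmetric] cnt)
  thus ?thesis by blast
qed

instance nonarch_valued_field < topological_comm_monoid_mult ..

section \<open>Directions in which a homogeneous form does not vanish\<close>

lemma sum_digits_less:
  assumes "\<And>j. j < n \<Longrightarrow> a j < (m :: nat)"
  shows "(\<Sum>j<n. a j * m ^ j) < m ^ n"
  using assms
proof (induction n)
  case (Suc n)
  have "(\<Sum>j<Suc n. a j * m ^ j) < m ^ n + a n * m ^ n" using Suc by simp
  also have "\<dots> = (Suc (a n)) * m ^ n" by simp
  also have "\<dots> \<le> m * m ^ n" using Suc.prems[of n] by (intro mult_right_mono) auto
  finally show ?case by simp
qed auto

lemma sum_digits_inj:
  assumes "\<And>j. j < n \<Longrightarrow> a j < (m :: nat)" "\<And>j. j < n \<Longrightarrow> b j < m"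
    and "(\<Sum>j<n. a j * m ^ j) = (\<Sum>j<n. b j * m ^ j)" "i < n"
  shows "a i = b i"
  using assms
proof (induction n)
  case (Suc n)
  have lt: "(\<Sum>j<n. a j * m ^ j) < m ^ n" "(\<Sum>j<n. b j * m ^ j) < m ^ n"
    using Suc.prems by (auto intro!: sum_digits_less)
  have pos: "m ^ n \<noteq> 0" using lt by (metis not_less_zero)
  have "a n = (\<Sum>j<Suc n. a j * m ^ j) div m ^ n" using lt pos by simp
  also have "\<dots> = b n" unfolding Suc.prems(3) using lt pos by simp
  finally have "a n = b n" .
  thus ?case using Suc by (cases "i = n") auto
qed auto

lemma infinite_valuation_ring: "infinite {x :: 'k::nonarch_local_field. knorm x \<le> 1}"
proof
  assume fin: "finite {x :: 'k. knorm x \<le> 1}"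
  define S where "S = knorm ` ({x :: 'k. knorm x \<le> 1} - {0})"
  have S: "finite S" "S \<noteq> {}" 
  proof -
    have "(1 :: 'k) \<in> {x. knorm x \<le> 1} - {0}" by simp
    thus "S \<noteq> {}" unfolding S_def by blast
  qed (use fin in \<open>auto simp: S_def\<close>)
  have "Min S \<in> S" using S by (rule Min_in)
  hence "Min S > 0" by (auto simp: S_def)
  then obtain c :: 'k where c: "c \<noteq> 0" "knorm c < min 1 (Min S)"
    using exists_small_knorm[of "min 1 (Min S)"] by auto
  hence "knorm c \<in> S" by (auto simp: S_def)
  hence "Min S \<le> knorm c" using S by (intro Min_le) auto
  thus False using c by simp
qed

text \<open>
  Kronecker's substitution: if \<open>m\<close> exceeds all exponents, putting the powers \<open>\<tau>^(m^j)\<close> for the variables turns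
  distinct monomials into distinct powers of \<open>\<tau>\<close>. The sum becomes a nonzero polynomial in \<open>\<tau>\<close>, which
  has only finitely many roots in the infinite valuation ring.
\<close>

lemma exists_nonvanishing_direction:
  fixes b :: "('d::finite \<Rightarrow> nat) \<Rightarrow> 'k::nonarch_local_field"
  assumes F: "finite F" and \<alpha>: "\<alpha> \<in> F" "b \<alpha> \<noteq> 0"
  shows "\<exists>w\<in>unit_polydisc. (\<Sum>\<beta>\<in>F. b \<beta> * monomial w \<beta>) \<noteq> 0"
proof -
  obtain e :: "nat \<Rightarrow> 'd" where e: "bij_betw e {..<CARD('d)} UNIV"
    using ex_bij_betw_nat_finite[of "UNIV :: 'd set"] by (auto simp: atLeast0LessThan)
  define e' where "e' = the_inv_into {..<CARD('d)} e"
  have e'e: "e' (e j) = j" if "j < CARD('d)" for j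
    using e that unfolding e'_def by (intro the_inv_into_f_f) (auto simp: bij_betw_def)
  define m where "m = Suc (Max ((\<lambda>(\<beta>, i). \<beta> i) ` (F \<times> UNIV)))"
  have m: "\<beta> i < m" if "\<beta> \<in> F" for \<beta> i
    unfolding m_def less_Suc_eq_le using F that by (intro Max_ge) auto
  define \<kappa> where "\<kappa> \<beta> = (\<Sum>i\<in>UNIV. \<beta> i * m ^ e' i)" for \<beta> :: "'d \<Rightarrow> nat"
  have \<kappa>_alt: "\<kappa> \<beta> = (\<Sum>j<CARD('d). \<beta> (e j) * m ^ j)" for \<beta>
    unfolding \<kappa>_def by (subst sum.reindex_bij_betw[OF e, symmetric]) (auto simp: e'e)
  have inj: "\<beta> = \<gamma>" if "\<beta> \<in> F" "\<gamma> \<in> F" "\<kappa> \<beta> = \<kappa> \<gamma>" for \<beta> \<gamma>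
  proof
    fix i
    obtain j where j: "j < CARD('d)" "i = e j" using e by (auto simp: bij_betw_def)
    have "\<beta> (e j) = \<gamma> (e j)"
      by (rule sum_digits_inj[where a = "\<lambda>j. \<beta> (e j)" and b = "\<lambda>j. \<gamma> (e j)"])
        (use m that j in \<open>auto simp: \<kappa>_alt\<close>)
    thus "\<beta> i = \<gamma> i" by (simp add: j)
  qed
  define p where "p = (\<Sum>\<beta>\<in>F. Polynomial.monom (b \<beta>) (\<kappa> \<beta>))"
  have "coeff p (\<kappa> \<alpha>) = (\<Sum>\<beta>\<in>F. if \<beta> = \<alpha> then b \<beta> else 0)"
    unfolding p_def coeff_sum coeff_monom using inj \<alpha> by (intro sum.cong) auto
  also have "\<dots> = b \<alpha>" using F \<alpha> by simp
  finally have "p \<noteq> 0" using \<alpha> by auto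
  hence "finite {x. poly p x = 0}" by (rule poly_roots_finite)
  hence "\<not> {x. knorm x \<le> 1} \<subseteq> {x. poly p x = 0}"
    using infinite_valuation_ring finite_subset by blast
  then obtain \<tau> where \<tau>: "knorm \<tau> \<le> 1" "poly p \<tau> \<noteq> 0" by auto
  define w :: "'k ^ 'd" where "w = (\<chi> i. \<tau> ^ (m ^ e' i))"
  have "monomial w \<beta> = \<tau> ^ \<kappa> \<beta>" for \<beta>
    by (simp add: monomial_def w_def \<kappa>_def power_sum mult.commute flip: power_mult)
  hence "(\<Sum>\<beta>\<in>F. b \<beta> * monomial w \<beta>) = poly p \<tau>"
    by (simp add: p_def poly_sum poly_monom)
  moreover have "w \<in> unit_polydisc"
    using \<tau> by (auto simp: w_def unit_polydisc_def intro!: knorm_power_le_1)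
  ultimately show ?thesis using \<tau> by (intro bexI[of _ w]) auto
qed

section \<open>Restriction of monomials to lines\<close>

definition gauss_le :: "'k::nonarch_local_field poly \<Rightarrow> real \<Rightarrow> bool" where
  "gauss_le p r \<longleftrightarrow> (\<forall>i. knorm (coeff p i) \<le> r)"

lemma gauss_le_mult:
  assumes "gauss_le p r" "gauss_le q s"
  shows "gauss_le (p * q) (r * s)"
  unfolding gauss_le_def coeff_mult
proof (intro allI knorm_sum_le knorm_mult_le)
  have "0 \<le> r" "0 \<le> s" using assms knorm_ge_0 order_trans unfolding gauss_le_def by blast+
  thus "0 \<le> r * s" by simp
qed (use assms in \<open>auto simp: gauss_le_def\<close>)

lemma gauss_le_add: "gauss_le p r \<Longrightarrow> gauss_le q r \<Longrightarrow> gauss_le (p + q) r"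
  by (auto simp: gauss_le_def intro: knorm_add_le)

lemma gauss_le_sum: "(\<And>i. i \<in> I \<Longrightarrow> gauss_le (p i) r) \<Longrightarrow> r \<ge> 0 \<Longrightarrow> gauss_le (\<Sum>i\<in>I. p i) r"
  by (auto simp: gauss_le_def coeff_sum intro: knorm_sum_le)

lemma gauss_le_smult: "knorm c \<le> r \<Longrightarrow> gauss_le p s \<Longrightarrow> gauss_le (smult c p) (r * s)"
  by (auto simp: gauss_le_def intro: knorm_mult_le)

text \<open>
  Closeness in the Gauss norm among polynomials with integral coefficients; integrality makes this
  relation compatible with products.
\<close>

definition gauss_close :: "'k::nonarch_local_field poly \<Rightarrow> 'k poly \<Rightarrow> real \<Rightarrow> bool" where
  "gauss_close p p' \<epsilon> \<longleftrightarrow> gauss_le p 1 \<and> gauss_le p' 1 \<and> gauss_le (p - p') \<epsilon>"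

lemma gauss_close_1: "\<epsilon> \<ge> 0 \<Longrightarrow> gauss_close 1 1 \<epsilon>"
  by (simp add: gauss_close_def gauss_le_def)

lemma gauss_close_mult:
  assumes "gauss_close p p' \<epsilon>" "gauss_close q q' \<epsilon>"
  shows "gauss_close (p * q) (p' * q') \<epsilon>"
proof -
  have "gauss_le ((p - p') * q + p' * (q - q')) \<epsilon>"
    using assms gauss_le_mult[of "p - p'" \<epsilon> q 1] gauss_le_mult[of p' 1 "q - q'" \<epsilon>]
    by (intro gauss_le_add) (auto simp: gauss_close_def)
  also have "(p - p') * q + p' * (q - q') = p * q - p' * q'" by (simp add: algebra_simps)
  finally show ?thesis using assms gauss_le_mult[of p 1 q 1] gauss_le_mult[of p' 1 q' 1]
    by (simp add: gauss_close_def)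
qed

lemma gauss_close_power: "gauss_close p p' \<epsilon> \<Longrightarrow> \<epsilon> \<ge> 0 \<Longrightarrow> gauss_close (p ^ n) (p' ^ n) \<epsilon>"
  by (induction n) (auto intro: gauss_close_1 gauss_close_mult)

lemma gauss_close_prod:
  "(\<And>i. i \<in> I \<Longrightarrow> gauss_close (p i) (p' i) \<epsilon>) \<Longrightarrow> \<epsilon> \<ge> 0 \<Longrightarrow>
    gauss_close (\<Prod>i\<in>I. p i) (\<Prod>i\<in>I. p' i) \<epsilon>"
  by (induction I rule: infinite_finite_induct) (auto intro: gauss_close_1 gauss_close_mult)

definition line_monomial :: "'k::nonarch_local_field ^ 'd \<Rightarrow> 'k ^ 'd \<Rightarrow> ('d \<Rightarrow> nat) \<Rightarrow> 'k poly" where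
  "line_monomial z w \<beta> = (\<Prod>i\<in>UNIV. [:z $ i, w $ i:] ^ \<beta> i)"

lemma poly_line_monomial: "poly (line_monomial z w \<beta>) u = monomial (z + u *s w) \<beta>"
  by (simp add: line_monomial_def monomial_def poly_prod)

lemma gauss_close_line_monomial:
  assumes "\<And>i. knorm (z $ i) \<le> \<epsilon>" "\<epsilon> \<le> 1" "w \<in> unit_polydisc" "\<epsilon> \<ge> 0"
  shows "gauss_close (line_monomial z w \<beta>) (line_monomial 0 w \<beta>) \<epsilon>"
  unfolding line_monomial_def
proof (intro gauss_close_prod gauss_close_power assms(4))
  fix i
  show "gauss_close [:z $ i, w $ i:] [:0 $ i, w $ i:] \<epsilon>"
    using assms order_trans[OF assms(1,2), of i]
    by (auto simp: gauss_close_def gauss_le_def coeff_pCons unit_polydisc_def split: nat.splits)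
qed

lemma line_monomial_0: "line_monomial 0 w \<beta> = Polynomial.monom (monomial w \<beta>) (\<Sum>i\<in>UNIV. \<beta> i)"
proof -
  have lin: "[:0, a:] = Polynomial.monom a 1" for a :: 'a by (simp add: monom_Suc monom_0)
  have "(\<Prod>i\<in>A. Polynomial.monom (a i) (n i)) = Polynomial.monom (\<Prod>i\<in>A. a i) (\<Sum>i\<in>A. n i)"
    for A :: "'b set" and a :: "'b \<Rightarrow> 'a" and n
    by (induction A rule: infinite_finite_induct) (auto simp: mult_monom)
  thus ?thesis by (simp add: line_monomial_def monomial_def lin monom_power)
qed

section \<open>Linear combinations and truncation of power series\<close>

text \<open>
  If the coefficients outside \<open>T\<close> lie in the maximal ideal, a character that is trivial there does not
  distinguish the series from the polynomial.
\<close>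

lemma power_series_truncate:
  fixes x :: "'k::nonarch_local_field ^ 'd"
  assumes g: "power_series_at x c b g" and T: "finite T" "\<And>\<beta>. \<beta> \<notin> T \<Longrightarrow> knorm (b \<beta>) \<le> r" "r \<ge> 0"
    and z: "z \<in> unit_polydisc"
  shows "knorm (g (x + c *s z) - (\<Sum>\<beta>\<in>T. b \<beta> * monomial z \<beta>)) \<le> r"
proof -
  have "((\<lambda>\<beta>. b \<beta> * monomial z \<beta>) has_sum g (x + c *s z)) UNIV"
    using g z by (auto simp: power_series_at_def)
  moreover have "((\<lambda>\<beta>. if \<beta> \<in> T then - (b \<beta> * monomial z \<beta>) else 0) has_sum
      - (\<Sum>\<beta>\<in>T. b \<beta> * monomial z \<beta>)) UNIV"
    by (rule has_sum_finite_neutralI[OF T(1)]) (auto simp: sum_negf)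
  ultimately have "((\<lambda>\<beta>. b \<beta> * monomial z \<beta> + (if \<beta> \<in> T then - (b \<beta> * monomial z \<beta>) else 0))
      has_sum g (x + c *s z) + - (\<Sum>\<beta>\<in>T. b \<beta> * monomial z \<beta>)) UNIV"
    by (rule has_sum_add)
  hence "knorm (g (x + c *s z) + - (\<Sum>\<beta>\<in>T. b \<beta> * monomial z \<beta>)) \<le> r"
  proof (rule has_sum_knorm_le)
    fix \<beta>
    show "knorm (b \<beta> * monomial z \<beta> + (if \<beta> \<in> T then - (b \<beta> * monomial z \<beta>) else 0)) \<le> r"
      using T knorm_monomial_le_1[OF z] by (auto intro: knorm_mult_le_right)
  qed fact
  thus ?thesis by simp
qed

lemma power_series_dot:
  fixes x :: "'k::nonarch_local_field ^ 'd" and f :: "'k ^ 'd \<Rightarrow> 'k ^ 'n"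
  assumes "\<And>j. power_series_at x c (b j) (\<lambda>y. f y $ j)"
  shows "power_series_at x c (\<lambda>\<beta>. \<Sum>j\<in>UNIV. v $ j * b j \<beta>) (\<lambda>y. dot v (f y))"
proof -
  have zero: "power_series_at x c (\<lambda>\<beta>. 0) (\<lambda>y. 0)"
    using assms by (auto simp: power_series_at_def null_family_def)
  have add: "power_series_at x c (\<lambda>\<beta>. a * b1 \<beta> + b2 \<beta>) (\<lambda>y. a * g1 y + g2 y)"
    if "power_series_at x c b1 g1" "power_series_at x c b2 g2" for a b1 b2 g1 g2
    unfolding power_series_at_def
  proof (intro conjI ballI)
    show "c \<noteq> 0" using that by (auto simp: power_series_at_def)
    show "null_family (\<lambda>\<beta>. a * b1 \<beta> + b2 \<beta>) UNIV"
      unfolding null_family_def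
    proof (intro allI impI)
      fix e :: real assume e: "e > 0"
      have "{\<beta> \<in> UNIV. e \<le> knorm (a * b1 \<beta> + b2 \<beta>)} \<subseteq>
         {\<beta> \<in> UNIV. e \<le> knorm (a * b1 \<beta>)} \<union> {\<beta> \<in> UNIV. e \<le> knorm (b2 \<beta>)}"
        using knorm_add_less[of _ e] by (auto simp: not_le[symmetric])
      moreover have "finite {\<beta> \<in> UNIV. e \<le> knorm (a * b1 \<beta>)}"
      proof (cases "a = 0")
        case False
        have "finite {\<beta> \<in> UNIV. e / knorm a \<le> knorm (b1 \<beta>)}"
          using that e False by (intro null_familyD) (auto simp: power_series_at_def)
        thus ?thesis using False by (simp add: knorm_mult divide_le_eq mult.commute)
      qed (use e in simp)
      moreover have "finite {\<beta> \<in> UNIV. e \<le> knorm (b2 \<beta>)}"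
        using that e by (intro null_familyD) (auto simp: power_series_at_def)
      ultimately show "finite {\<beta> \<in> UNIV. e \<le> knorm (a * b1 \<beta> + b2 \<beta>)}"
        by (auto elim: finite_subset)
    qed
    fix z :: "'k ^ 'd" assume "z \<in> unit_polydisc"
    thus "((\<lambda>\<beta>. (a * b1 \<beta> + b2 \<beta>) * monomial z \<beta>) has_sum a * g1 (x + c *s z) + g2 (x + c *s z)) UNIV"
      using that unfolding distrib_right mult.assoc
      by (intro has_sum_add has_sum_cmult_right) (auto simp: power_series_at_def)
  qed
  have "power_series_at x c (\<lambda>\<beta>. \<Sum>j\<in>A. v $ j * b j \<beta>) (\<lambda>y. \<Sum>j\<in>A. v $ j * f y $ j)" for A
  proof (induction A rule: infinite_finite_induct)
    case (insert j A)
    from add[OF assms[of j] insert.IH, of "v $ j"] show ?case using insert by simp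
  qed (use zero in auto)
  thus ?thesis by (simp add: dot_def)
qed

section \<open>Averaging an integral along a line\<close>

definition polydisc :: "'k::nonarch_local_field ^ 'd \<Rightarrow> real \<Rightarrow> ('k ^ 'd) set" where
  "polydisc x r = {y. \<forall>i. knorm (y $ i - x $ i) \<le> r}"

lemma continuous_on_knorm_dist: "continuous_on UNIV (\<lambda>y :: 'k::nonarch_local_field ^ 'd. knorm (y $ i - x $ i))"
  unfolding dist_knorm[symmetric] by (intro continuous_intros)

lemma closed_polydisc: "closed (polydisc x r)"
proof -
  have "polydisc x r = (\<Inter>i. {y. knorm (y $ i - x $ i) \<le> r})" by (auto simp: polydisc_def)
  thus ?thesis by (auto intro!: closed_Collect_le continuous_on_knorm_dist continuous_intros)
qed

lemma polydisc_borel [measurable, simp]: "polydisc x r \<in> sets borel"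
  by (intro borel_closed closed_polydisc)

lemma polydisc_shift:
  fixes a x y :: "'k::nonarch_local_field ^ 'd"
  assumes "\<And>i. knorm (a $ i) \<le> r"
  shows "y + a \<in> polydisc x r \<longleftrightarrow> y \<in> polydisc x r"
proof -
  have *: "y + a \<in> polydisc x r" if "y \<in> polydisc x r" "\<And>i. knorm (a $ i) \<le> r" for y a :: "'k ^ 'd"
    unfolding polydisc_def
  proof (intro CollectI allI)
    fix i
    have "knorm ((y $ i - x $ i) + a $ i) \<le> r"
      using that by (intro knorm_add_le) (auto simp: polydisc_def)
    thus "knorm ((y + a) $ i - x $ i) \<le> r" by (simp add: algebra_simps)
  qed
  show ?thesis using *[of y a] *[of "y + a" "- a"] assms by auto
qed

lemma polydisc_0_1: "polydisc 0 1 = unit_polydisc"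
  by (simp add: polydisc_def unit_polydisc_def)

lemma continuous_on_vec_add: "continuous_on UNIV (\<lambda>y :: 'k::nonarch_local_field ^ 'd. a + y)"
proof -
  have "continuous_on UNIV (\<lambda>y :: 'k ^ 'd. \<chi> i. a $ i + y $ i)" by (intro continuous_intros)
  thus ?thesis by (simp add: plus_vec_def)
qed

lemma haar_translate:
  fixes \<nu> :: "('k::nonarch_local_field ^ 'd) measure"
  assumes \<nu>: "normalized_haar \<nu>"
  shows "distr \<nu> borel (\<lambda>y. y + a) = \<nu>"
proof (rule measure_eqI)
  have sets: "sets \<nu> = sets borel" using \<nu> by (simp add: normalized_haar_def)
  show "sets (distr \<nu> borel (\<lambda>y. y + a)) = sets \<nu>" by (simp add: sets)
  have meas: "(\<lambda>y. y + a) \<in> borel_measurable \<nu>"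
    unfolding measurable_cong_sets[OF sets refl]
    using borel_measurable_continuous_onI[OF continuous_on_vec_add[of a]] by (simp add: add.commute)
  fix A assume "A \<in> sets (distr \<nu> borel (\<lambda>y. y + a))"
  hence A: "A \<in> sets borel" by simp
  have eq: "(\<lambda>y. y + a) -` A \<inter> space \<nu> = (\<lambda>x. - a + x) ` A"
  proof -
    have "space \<nu> = UNIV" using sets_eq_imp_space_eq[OF sets] by simp
    thus ?thesis by (auto simp: image_iff intro!: bexI[of _ "_ + a"])
  qed
  have "emeasure \<nu> ((\<lambda>x. - a + x) ` A) = emeasure \<nu> A"
    using \<nu> A unfolding normalized_haar_def by blast
  thus "emeasure (distr \<nu> borel (\<lambda>y. y + a)) A = emeasure \<nu> A"
    by (simp only: emeasure_distr[OF meas A] eq)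
qed

lemma haar_polydisc_le_1:
  fixes \<nu> :: "('k::nonarch_local_field ^ 'd) measure"
  assumes \<nu>: "normalized_haar \<nu>" and r: "r \<le> 1"
  shows "emeasure \<nu> (polydisc x r) \<le> 1"
proof -
  have sets: "sets \<nu> = sets borel" using \<nu> by (simp add: normalized_haar_def)
  have "polydisc x r \<subseteq> polydisc x 1" using r by (auto simp: polydisc_def intro: order_trans)
  hence "emeasure \<nu> (polydisc x r) \<le> emeasure \<nu> (polydisc x 1)"
    by (intro emeasure_mono) (simp_all add: sets)
  also have "polydisc x 1 = (\<lambda>y. x + y) ` polydisc 0 1"
  proof (intro equalityI subsetI)
    fix y assume "y \<in> polydisc x 1"
    thus "y \<in> (\<lambda>y. x + y) ` polydisc 0 1"
      by (intro image_eqI[of _ _ "y - x"]) (auto simp: polydisc_def)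
  qed (auto simp: polydisc_def)
  also have "emeasure \<nu> \<dots> = emeasure \<nu> (polydisc 0 1)"
    using \<nu> polydisc_borel[of 0 1] unfolding normalized_haar_def by blast
  also have "polydisc (0 :: 'k ^ 'd) 1 = {x. \<forall>i. x $ i \<in> valuation_ring}"
    by (simp add: polydisc_def valuation_ring_def)
  also have "emeasure \<nu> \<dots> = 1" using \<nu> by (simp add: normalized_haar_def)
  finally show ?thesis .
qed

lemma integral_avg:
  fixes F :: "'k::nonarch_local_field \<Rightarrow> 'x \<Rightarrow> complex"
  assumes "\<And>u. knorm u \<le> 1 \<Longrightarrow> integrable M (F u)"
  shows "integrable M (\<lambda>y. avg N (\<lambda>u. F u y)) \<and> (\<integral>y. avg N (\<lambda>u. F u y) \<partial>M) = avg N (\<lambda>u. \<integral>y. F u y \<partial>M)"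
  using assms
proof (induction N arbitrary: F)
  case (Suc N)
  have *: "integrable M (\<lambda>y. avg N (\<lambda>u. F (b + unif * u) y)) \<and>
    (\<integral>y. avg N (\<lambda>u. F (b + unif * u) y) \<partial>M) = avg N (\<lambda>u. \<integral>y. F (b + unif * u) y \<partial>M)"
    if "b \<in> digits" for b
    by (rule Suc.IH) (use Suc.prems that in \<open>auto intro: knorm_digit_shift\<close>)
  show ?case using * by (simp add: integral_sum)
qed auto

text \<open>
  The polydisc and the measure are invariant under translation by \<open>u a\<close> for integral \<open>u\<close>. So the
  integral of \<open>G\<close> does not change when \<open>G\<close> is replaced by its averages in the direction \<open>a\<close>.
\<close>

lemma norm_integral_le_line_avg:
  fixes \<nu> :: "('k::nonarch_local_field ^ 'd) measure" and G :: "'k ^ 'd \<Rightarrow> complex"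
  assumes \<nu>: "normalized_haar \<nu>" and G: "G \<in> borel_measurable borel" "\<And>y. norm (G y) \<le> 1"
    and r: "r \<le> 1" and a: "\<And>i. knorm (a $ i) \<le> r"
    and E: "\<And>y. y \<in> polydisc x r \<Longrightarrow> norm (avg N (\<lambda>u. G (y + u *s a))) \<le> E" "E \<ge> 0"
  shows "norm (\<integral>y. indicator (polydisc x r) y * G y \<partial>\<nu>) \<le> E"
proof -
  define H where "H y = indicator (polydisc x r) y * G y" for y
  have sets: "sets \<nu> = sets borel" using \<nu> by (simp add: normalized_haar_def)
  have le1: "emeasure \<nu> (polydisc x r) \<le> 1" by (intro haar_polydisc_le_1 \<nu> r)
  hence fin: "emeasure \<nu> (polydisc x r) < \<infinity>" by (rule le_less_trans) auto
  have int_ind: "integrable \<nu> (indicator (polydisc x r) :: _ \<Rightarrow> real)"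
    using fin by (intro integrable_real_indicator) (auto simp: sets)
  have H_meas: "H \<in> borel_measurable borel" unfolding H_def using G by measurable
  have H_int: "integrable \<nu> H"
  proof (rule Bochner_Integration.integrable_bound[OF int_ind])
    show "H \<in> borel_measurable \<nu>" using H_meas unfolding measurable_cong_sets[OF sets refl] .
    show "AE y in \<nu>. norm (H y) \<le> norm (indicator (polydisc x r) y :: real)"
      using G(2) by (auto simp: H_def indicator_def norm_mult)
  qed
  have shift_meas: "(\<lambda>y. y + b) \<in> measurable \<nu> borel" for b
    unfolding measurable_cong_sets[OF sets refl]
    using borel_measurable_continuous_onI[OF continuous_on_vec_add[of b]] by (simp add: add.commute)
  have shift_int: "integrable \<nu> (\<lambda>y. H (y + b))" for b
    using integrable_distr_eq[OF shift_meas[of b] H_meas] H_int by (simp add: haar_translate[OF \<nu>])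
  have shift_eq: "(\<integral>y. H (y + b) \<partial>\<nu>) = (\<integral>y. H y \<partial>\<nu>)" for b
    using integral_distr[OF shift_meas[of b] H_meas] by (simp add: haar_translate[OF \<nu>])
  have avg_H: "norm (avg N (\<lambda>u. H (y + u *s a))) \<le> E * indicator (polydisc x r) y" for y
  proof -
    have "avg N (\<lambda>u. H (y + u *s a)) = avg N (\<lambda>u. indicator (polydisc x r) y * G (y + u *s a))"
    proof (rule avg_cong)
      fix u :: 'k assume "knorm u \<le> 1"
      hence "knorm ((u *s a) $ i) \<le> r" for i using a by (auto intro: knorm_mult_le_left)
      from polydisc_shift[OF this]
      show "H (y + u *s a) = indicator (polydisc x r) y * G (y + u *s a)"
        by (simp add: H_def indicator_def)
    qed
    also have "\<dots> = indicator (polydisc x r) y * avg N (\<lambda>u. G (y + u *s a))" by (rule avg_cmult)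
    finally show ?thesis using E(1)[of y] by (auto simp: indicator_def)
  qed
  have *: "integrable \<nu> (\<lambda>y. avg N (\<lambda>u. H (y + u *s a)))"
    "(\<integral>y. avg N (\<lambda>u. H (y + u *s a)) \<partial>\<nu>) = avg N (\<lambda>u. \<integral>y. H (y + u *s a) \<partial>\<nu>)"
    using integral_avg[of \<nu> "\<lambda>u y. H (y + u *s a)" N] shift_int by auto
  have "(\<integral>y. H y \<partial>\<nu>) = (\<integral>y. avg N (\<lambda>u. H (y + u *s a)) \<partial>\<nu>)"
    unfolding *(2) shift_eq by simp
  also have "norm \<dots> \<le> (\<integral>y. norm (avg N (\<lambda>u. H (y + u *s a))) \<partial>\<nu>)"
    by (rule integral_norm_bound)
  also have "\<dots> \<le> (\<integral>y. E * indicator (polydisc x r) y \<partial>\<nu>)"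
    by (rule integral_mono') (use avg_H int_ind E(2) in auto)
  also have "\<dots> = E * measure \<nu> (polydisc x r)"
    using sets_eq_imp_space_eq[OF sets] by simp
  also have "\<dots> \<le> E * 1"
    using le1 E(2) by (intro mult_left_mono) (auto simp: measure_def enn2real_leI)
  finally show ?thesis by (simp add: H_def)
qed

section \<open>The local estimate\<close>

lemma finite_multi_index_sum: "finite {\<beta> :: 'd::finite \<Rightarrow> nat. (\<Sum>i\<in>UNIV. \<beta> i) = m}"
proof (rule finite_subset[OF _ finite_multi_index_le[of "\<lambda>_. m"]])
  show "{\<beta> :: 'd \<Rightarrow> nat. (\<Sum>i\<in>UNIV. \<beta> i) = m} \<subseteq> {\<beta>. \<forall>i. \<beta> i \<le> m}"
    by (auto intro!: member_le_sum)
qed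

lemma taylor_at_0: "taylor p i 0 = coeff p i"
proof -
  define n where "n = max (degree p) i"
  have "taylor p i 0 = (\<Sum>j\<le>n. of_nat (j choose i) * coeff p j * 0 ^ (j - i))"
    by (rule taylor_altdef) (simp add: n_def)
  also have "\<dots> = (\<Sum>j\<le>n. if j = i then coeff p i else 0)"
  proof (rule sum.cong)
    fix j show "of_nat (j choose i) * coeff p j * 0 ^ (j - i) = (if j = i then coeff p i else 0)"
      by (cases j i rule: linorder_cases) (auto simp: binomial_eq_0 zero_power)
  qed auto
  also have "\<dots> = coeff p i" by (simp add: n_def)
  finally show ?thesis .
qed

context nontrivial_character
begin

lemma continuous_on_char: "continuous_on UNIV \<psi>"
proof -
  have "\<exists>d>0. \<forall>x'. dist x' x < d \<longrightarrow> dist (\<psi> x') (\<psi> x) < e" if "e > 0" for x e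
    using that char_cong by (intro exI[of _ 1]) (auto simp: dist_knorm)
  thus ?thesis unfolding continuous_on_iff by simp
qed

text \<open>
  Let \<open>\<Phi> v\<close> be the combination of the coefficient families \<open>b j\<close> with weights \<open>v $ j\<close>. In the
  direction \<open>w\<close> the form of degree \<open>m\<close> of \<open>\<Phi> v0\<close> has a nonzero value \<open>Q\<close>. Restricted to the line through
  \<open>z\<close> in this direction, the polynomial given by \<open>\<Phi> v\<close> has coefficients of norm at most \<open>B\<close>, and
  the one of degree \<open>m\<close> still has norm \<open>|Q|\<close> if \<open>z\<close> is small and \<open>v\<close> is close to \<open>v0\<close>.
  Shortening the segment by \<open>unif ^ s\<close> makes it dominate the higher ones. The depth \<open>N\<close> depends on \<open>t\<close> but not on the line.
\<close>

lemma line_estimate: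
  fixes b :: "'n::finite \<Rightarrow> ('d::finite \<Rightarrow> nat) \<Rightarrow> 'k" and v0 :: "'k ^ 'n"
  assumes b: "\<And>j. null_family (b j) UNIV"
    and m: "m \<ge> 1" "\<forall>j. 1 \<le> j \<longrightarrow> j \<le> m \<longrightarrow> of_nat j \<noteq> (0 :: 'k)"
    and \<alpha>: "(\<Sum>i\<in>UNIV. \<alpha> i) = m" "(\<Sum>j\<in>UNIV. v0 $ j * b j \<alpha>) \<noteq> 0"
  shows "\<exists>w\<in>unit_polydisc. \<exists>s \<delta> C. \<delta> > 0 \<and> C \<ge> 0 \<and>
    (\<forall>v t T. v \<in> unit_polydisc \<longrightarrow> v \<in> polydisc v0 \<delta> \<longrightarrow> t \<noteq> 0 \<longrightarrow> finite T \<longrightarrow>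
       {\<beta>. (\<Sum>i\<in>UNIV. \<beta> i) = m} \<subseteq> T \<longrightarrow>
       (\<exists>N. \<forall>z. (\<forall>i. knorm (z $ i) \<le> knorm (unif :: 'k) ^ s) \<longrightarrow>
         norm (avg N (\<lambda>u. \<psi> (\<Sum>\<beta>\<in>T. t * (\<Sum>j\<in>UNIV. v $ j * b j \<beta>) * monomial (z + (unif ^ s * u) *s w) \<beta>)))
           \<le> C * knorm t powr (- 1 / real m)))"
proof -
  define \<rho> where "\<rho> = knorm (unif :: 'k)"
  have \<rho>: "0 < \<rho>" "\<rho> < 1" by (auto simp: \<rho>_def)
  define B0 where "B0 j = (SOME B. B > 0 \<and> (\<forall>\<beta>. knorm (b j \<beta>) \<le> B))" for j
  have B0: "B0 j > 0 \<and> (\<forall>\<beta>. knorm (b j \<beta>) \<le> B0 j)" for j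
    unfolding B0_def by (rule someI_ex) (use null_family_bounded[OF b[of j]] in auto)
  define B where "B = Max (range B0)"
  have B: "B > 0" "knorm (b j \<beta>) \<le> B" for j \<beta>
  proof -
    have "B0 j \<le> B" for j unfolding B_def by (intro Max_ge) auto
    thus "B > 0" "knorm (b j \<beta>) \<le> B" using B0 by (meson less_le_trans order_trans)+
  qed
  define \<Phi> where "\<Phi> v \<beta> = (\<Sum>j\<in>UNIV. v $ j * b j \<beta>)" for v \<beta>
  have \<Phi>_le: "knorm (\<Phi> v \<beta>) \<le> B" if "v \<in> unit_polydisc" for v \<beta>
    unfolding \<Phi>_def using that B
    by (intro knorm_sum_le knorm_mult_le_left) (auto simp: unit_polydisc_def less_imp_le)
  define Fm where "Fm = {\<beta> :: 'd \<Rightarrow> nat. (\<Sum>i\<in>UNIV. \<beta> i) = m}"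
  have Fm: "finite Fm" "\<alpha> \<in> Fm" using \<alpha> by (auto simp: Fm_def finite_multi_index_sum)
  obtain w where w: "w \<in> unit_polydisc" "(\<Sum>\<beta>\<in>Fm. \<Phi> v0 \<beta> * monomial w \<beta>) \<noteq> 0"
    using exists_nonvanishing_direction[OF Fm, of "\<Phi> v0"] \<alpha> by (auto simp: \<Phi>_def)
  define Q where "Q = (\<Sum>\<beta>\<in>Fm. \<Phi> v0 \<beta> * monomial w \<beta>)"
  define \<eta> where "\<eta> = knorm Q"
  have \<eta>: "\<eta> > 0" using w by (simp add: \<eta>_def Q_def)
  define \<kappa> where "\<kappa> = knorm (of_nat m :: 'k)"
  have \<kappa>: "\<kappa> > 0" "\<kappa> \<le> 1" using m by (auto simp: \<kappa>_def)
  have "\<kappa> * \<rho> * \<eta> / B > 0" using \<kappa> \<rho> \<eta> B by simp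
  \<comment> \<open>this choice gives both domination and stability of the coefficient of degree \<open>m\<close>\<close>
  then obtain s where s: "\<rho> ^ s < \<kappa> * \<rho> * \<eta> / B" using real_arch_pow_inv \<rho> by blast
  define \<delta> where "\<delta> = \<rho> * \<eta> / B"
  have \<delta>: "\<delta> > 0" using \<rho> \<eta> B by (simp add: \<delta>_def)
  have s1: "\<rho> ^ s \<le> 1" using \<rho> by (simp add: power_le_one)
  have sB: "\<rho> ^ s * B \<le> \<kappa> * \<rho> * \<eta>" using s B by (simp add: field_simps)
  have sB': "\<rho> ^ s * B < \<eta>"
  proof -
    have "\<kappa> * \<rho> < 1" using \<kappa> \<rho> mult_le_one mult_strict_mono[of \<rho> 1 \<kappa> 1]
      by (smt (verit) mult_left_le_one_le)
    hence "\<kappa> * \<rho> * \<eta> < 1 * \<eta>" using \<eta> by (intro mult_strict_right_mono)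
    thus ?thesis using sB by simp
  qed
  obtain C where C: "vdc_const m C" using van_der_corput[of m] m by blast
  define C' where "C' = C * (\<rho> ^ (s * m) * \<eta>) powr (- 1 / real m)"
  have "C' \<ge> 0" using C by (auto simp: C'_def vdc_const_def)
  have main: "\<exists>N. \<forall>z. (\<forall>i. knorm (z $ i) \<le> \<rho> ^ s) \<longrightarrow>
         norm (avg N (\<lambda>u. \<psi> (\<Sum>\<beta>\<in>T. t * \<Phi> v \<beta> * monomial (z + (unif ^ s * u) *s w) \<beta>)))
           \<le> C' * knorm t powr (- 1 / real m)"
    if v: "v \<in> unit_polydisc" "v \<in> polydisc v0 \<delta>" and t: "t \<noteq> 0" and T: "finite T" "Fm \<subseteq> T" for v t T
  proof -
    obtain N where "\<rho> ^ N < inverse (knorm t * B)"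
      using real_arch_pow_inv[of "inverse (knorm t * B)" \<rho>] t B \<rho> by auto
    hence N: "knorm t * B < inverse (\<rho> ^ N)" using t B \<rho> by (simp add: field_simps)
    show ?thesis
    proof (intro exI[of _ N] allI impI)
      fix z :: "'k ^ 'd" assume z: "\<forall>i. knorm (z $ i) \<le> \<rho> ^ s"
      define h where "h = (\<Sum>\<beta>\<in>T. smult (t * \<Phi> v \<beta>) (line_monomial z w \<beta>))"
      have close: "gauss_close (line_monomial z w \<beta>) (line_monomial 0 w \<beta>) (\<rho> ^ s)" for \<beta>
        using z s1 w(1) \<rho> by (intro gauss_close_line_monomial) auto
      have h_le: "knorm (coeff h i) \<le> knorm t * B" for i
      proof -
        have "gauss_le h ((knorm t * B) * 1)"
          unfolding h_def
        proof (intro gauss_le_sum gauss_le_smult)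
          fix \<beta> show "knorm (t * \<Phi> v \<beta>) \<le> knorm t * B" by (intro knorm_mult_le \<Phi>_le v) auto
          show "gauss_le (line_monomial z w \<beta>) 1" using close by (auto simp: gauss_close_def)
        qed (use B in auto)
        thus ?thesis by (simp add: gauss_le_def)
      qed
      have hm: "knorm (coeff h m) = knorm t * \<eta>"
      proof -
        have c0: "coeff (line_monomial 0 w \<beta>) m = (if \<beta> \<in> Fm then monomial w \<beta> else 0)" for \<beta>
          by (auto simp: line_monomial_0 Fm_def)
        have "Q = (\<Sum>\<beta>\<in>T. \<Phi> v0 \<beta> * coeff (line_monomial 0 w \<beta>) m)"
          unfolding Q_def c0 using T by (intro sum.mono_neutral_cong_left) auto
        hence "coeff h m - t * Q = t * (\<Sum>\<beta>\<in>T. \<Phi> v \<beta> * coeff (line_monomial z w \<beta> - line_monomial 0 w \<beta>) m +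
            (\<Phi> v \<beta> - \<Phi> v0 \<beta>) * coeff (line_monomial 0 w \<beta>) m)"
          by (simp add: h_def coeff_sum sum_distrib_left algebra_simps flip: sum_subtractf sum.distrib)
        also have "knorm \<dots> \<le> knorm t * max (B * \<rho> ^ s) (\<delta> * B)"
        proof (intro knorm_mult_le knorm_sum_le knorm_add_le order.refl)
          fix \<beta>
          have "knorm (\<Phi> v \<beta> * coeff (line_monomial z w \<beta> - line_monomial 0 w \<beta>) m) \<le> B * \<rho> ^ s"
            using close[of \<beta>] by (intro knorm_mult_le \<Phi>_le v) (auto simp: gauss_close_def gauss_le_def)
          thus "knorm (\<Phi> v \<beta> * coeff (line_monomial z w \<beta> - line_monomial 0 w \<beta>) m) \<le> max (B * \<rho> ^ s) (\<delta> * B)"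
            by simp
          have "knorm (\<Phi> v \<beta> - \<Phi> v0 \<beta>) \<le> \<delta> * B"
          proof -
            have "\<Phi> v \<beta> - \<Phi> v0 \<beta> = (\<Sum>j\<in>UNIV. (v $ j - v0 $ j) * b j \<beta>)"
              by (simp add: \<Phi>_def sum_subtractf left_diff_distrib)
            also have "knorm \<dots> \<le> \<delta> * B"
              using v(2) B \<delta> by (intro knorm_sum_le knorm_mult_le) (auto simp: polydisc_def)
            finally show ?thesis .
          qed
          moreover have "knorm (coeff (line_monomial 0 w \<beta>) m) \<le> 1"
            using close[of \<beta>] by (auto simp: gauss_close_def gauss_le_def)
          ultimately have "knorm ((\<Phi> v \<beta> - \<Phi> v0 \<beta>) * coeff (line_monomial 0 w \<beta>) m) \<le> \<delta> * B"
            by (intro knorm_mult_le_right)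
          thus "knorm ((\<Phi> v \<beta> - \<Phi> v0 \<beta>) * coeff (line_monomial 0 w \<beta>) m) \<le> max (B * \<rho> ^ s) (\<delta> * B)"
            by simp
        qed (use B \<rho> \<delta> in \<open>auto simp: max_def\<close>)
        also have "\<dots> < knorm t * \<eta>"
        proof (intro mult_strict_left_mono)
          have "\<delta> * B < 1 * \<eta>" using \<rho> \<eta> B by (simp add: \<delta>_def)
          thus "max (B * \<rho> ^ s) (\<delta> * B) < \<eta>" using sB' by (simp add: mult.commute)
        qed (use t in auto)
        also have "\<dots> = knorm (t * Q)" by (simp add: knorm_mult \<eta>_def)
        finally show ?thesis using knorm_add_eq[of "coeff h m - t * Q" "t * Q"]
          by (simp add: knorm_mult \<eta>_def)
      qed
      define p where "p = h \<circ>\<^sub>p [:0, unif ^ s:]"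
      have coeff_p: "knorm (coeff p i) = \<rho> ^ (s * i) * knorm (coeff h i)" for i
        by (simp add: p_def coeff_pcompose_linear taylor_at_0 knorm_mult knorm_power \<rho>_def power_mult)
      have "dominated p m"
        unfolding dominated_def
      proof (intro allI impI)
        fix i assume i: "i > m"
        have "s * m + s \<le> s * i" using i mult_le_mono2[of "Suc m" i s] by simp
        hence "knorm (coeff p i) \<le> \<rho> ^ (s * m + s) * (knorm t * B)"
          unfolding coeff_p using \<rho> h_le by (intro mult_mono power_decreasing) auto
        also have "\<dots> = \<rho> ^ (s * m) * knorm t * (\<rho> ^ s * B)" by (simp add: power_add mult_ac)
        also have "\<dots> \<le> \<rho> ^ (s * m) * knorm t * (\<kappa> * \<rho> * \<eta>)"
          using sB \<rho> by (intro mult_left_mono) auto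
        also have "\<dots> = \<kappa> * \<rho> * knorm (coeff p m)" by (simp add: coeff_p hm mult_ac)
        finally show "knorm (coeff p i) \<le> knorm (of_nat m :: 'k) * knorm (unif :: 'k) * knorm (coeff p m)"
          by (simp add: \<kappa>_def \<rho>_def)
      qed
      moreover have "knorm (coeff p m) > 0" using \<rho> \<eta> t by (simp add: coeff_p hm del: knorm_pos_iff) simp
      hence "coeff p m \<noteq> 0" by simp
      moreover have "knorm (coeff p i) < inverse (\<rho> ^ N)" for i
      proof -
        have "\<rho> ^ (s * i) * knorm (coeff h i) \<le> 1 * (knorm t * B)"
          using \<rho> h_le by (intro mult_mono) (auto simp: power_le_one)
        thus ?thesis using N by (simp add: coeff_p)
      qed
      ultimately have "norm (avg N (\<lambda>u. \<psi> (poly p u))) \<le> C * knorm (coeff p m) powr (- 1 / real m)"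
        using C by (auto simp: vdc_const_def \<rho>_def)
      also have "\<dots> = C' * knorm t powr (- 1 / real m)"
        unfolding coeff_p hm C'_def using \<rho> \<eta> t by (simp add: powr_mult)
      also have "poly p = (\<lambda>u. \<Sum>\<beta>\<in>T. t * \<Phi> v \<beta> * monomial (z + (unif ^ s * u) *s w) \<beta>)"
        by (rule ext) (simp add: p_def poly_pcompose h_def poly_sum poly_line_monomial mult.commute)
      finally show "norm (avg N (\<lambda>u. \<psi> (\<Sum>\<beta>\<in>T. t * \<Phi> v \<beta> * monomial (z + (unif ^ s * u) *s w) \<beta>)))
           \<le> C' * knorm t powr (- 1 / real m)" .
    qed
  qed
  show ?thesis
    by (rule bexI[OF _ w(1)], rule exI[of _ s], rule exI[of _ \<delta>], rule exI[of _ C'])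
      (use main \<delta> \<open>C' \<ge> 0\<close> in \<open>auto simp: \<Phi>_def Fm_def \<rho>_def\<close>)
qed

text \<open>
  The type condition at \<open>x\<close> enters through \<open>\<alpha>\<close>. For given \<open>t\<close> the phase is truncated to the polynomial with the
  terms in \<open>T\<close>; this also supplies a globally continuous \<open>G\<close> that represents the integrand on
  the polydisc. The exponent \<open>-1/m\<close> is at least as good as \<open>-1/k\<close> because \<open>|t| \<ge> 1\<close>.
\<close>

lemma local_estimate:
  fixes \<nu> :: "('k ^ 'd) measure" and f :: "'k ^ 'd \<Rightarrow> 'k ^ 'n" and v0 :: "'k ^ 'n"
  assumes \<nu>: "normalized_haar \<nu>"
    and ps: "\<forall>j. power_series_at x c (b j) (\<lambda>y. f y $ j)" and c: "knorm c \<le> 1"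
    and k: "\<forall>j. 1 \<le> j \<longrightarrow> j \<le> k \<longrightarrow> of_nat j \<noteq> (0 :: 'k)"
    and \<alpha>: "0 < (\<Sum>i\<in>UNIV. \<alpha> i)" "(\<Sum>i\<in>UNIV. \<alpha> i) \<le> k" "(\<Sum>j\<in>UNIV. v0 $ j * b j \<alpha>) \<noteq> 0"
  shows "\<exists>r \<delta> C. 0 < r \<and> r \<le> knorm c \<and> 0 < \<delta> \<and> 0 \<le> C \<and>
    (\<forall>v t. v \<in> unit_polydisc \<longrightarrow> v \<in> polydisc v0 \<delta> \<longrightarrow> knorm t \<ge> 1 \<longrightarrow>
      (\<exists>G\<in>borel_measurable borel. (\<forall>y\<in>polydisc x r. G y = \<psi> (t * dot v (f y))) \<and>
         norm (\<integral>y. indicator (polydisc x r) y * G y \<partial>\<nu>) \<le> C * knorm t powr (- 1 / real k)))"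
proof -
  define \<rho> where "\<rho> = knorm (unif :: 'k)"
  have \<rho>: "0 < \<rho>" "\<rho> < 1" by (auto simp: \<rho>_def)
  note f = ps[rule_format]
  have c0: "c \<noteq> 0" using f by (auto simp: power_series_at_def)
  have null: "null_family (b j) UNIV" for j using f by (auto simp: power_series_at_def)
  define m where "m = (\<Sum>i\<in>UNIV. \<alpha> i)"
  have m: "1 \<le> m" "m \<le> k" using \<alpha> by (auto simp: m_def)
  have char_m: "\<forall>j. 1 \<le> j \<longrightarrow> j \<le> m \<longrightarrow> of_nat j \<noteq> (0 :: 'k)"
    using k m by simp
  from line_estimate[of b m \<alpha> v0, OF null m(1) char_m m_def[symmetric] \<alpha>(3), folded \<rho>_def]
  obtain w s \<delta> C where w: "w \<in> unit_polydisc" and *: "\<delta> > 0 \<and> C \<ge> 0 \<and>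
    (\<forall>v t T. v \<in> unit_polydisc \<longrightarrow> v \<in> polydisc v0 \<delta> \<longrightarrow> t \<noteq> 0 \<longrightarrow> finite T \<longrightarrow>
       {\<beta>. (\<Sum>i\<in>UNIV. \<beta> i) = m} \<subseteq> T \<longrightarrow>
       (\<exists>N. \<forall>z. (\<forall>i. knorm (z $ i) \<le> \<rho> ^ s) \<longrightarrow>
         norm (avg N (\<lambda>u. \<psi> (\<Sum>\<beta>\<in>T. t * (\<Sum>j\<in>UNIV. v $ j * b j \<beta>) * monomial (z + (unif ^ s * u) *s w) \<beta>)))
           \<le> C * knorm t powr (- 1 / real m)))"
    by (elim bexE exE)
  have \<delta>: "\<delta> > 0" and C: "C \<ge> 0" using * by simp_all
  note est = *[THEN conjunct2, THEN conjunct2, rule_format]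
  define r where "r = knorm c * \<rho> ^ s"
  have r: "0 < r" "r \<le> knorm c" "r \<le> 1"
  proof -
    show "0 < r" using c0 \<rho> by (simp add: r_def)
    have "\<rho> ^ s \<le> 1" using \<rho> by (simp add: power_le_one)
    thus "r \<le> knorm c" by (simp add: r_def mult_left_le)
    thus "r \<le> 1" using c by simp
  qed
  have main: "\<exists>G\<in>borel_measurable borel. (\<forall>y\<in>polydisc x r. G y = \<psi> (t * dot v (f y))) \<and>
         norm (\<integral>y. indicator (polydisc x r) y * G y \<partial>\<nu>) \<le> C * knorm t powr (- 1 / real k)"
    if v: "v \<in> unit_polydisc" "v \<in> polydisc v0 \<delta>" and t: "knorm t \<ge> 1" for v t
  proof -
    have t0: "t \<noteq> 0" using t by auto
    define \<Phi> where "\<Phi> \<beta> = (\<Sum>j\<in>UNIV. v $ j * b j \<beta>)" for \<beta>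
    have ps_v: "power_series_at x c \<Phi> (\<lambda>y. dot v (f y))"
      unfolding \<Phi>_def by (rule power_series_dot[OF f])
    define T where "T = {\<beta> \<in> UNIV. knorm (\<Phi> \<beta>) \<ge> \<rho> / knorm t} \<union> {\<beta>. (\<Sum>i\<in>UNIV. \<beta> i) = m}"
    have "finite {\<beta> \<in> UNIV. knorm (\<Phi> \<beta>) \<ge> \<rho> / knorm t}"
      using ps_v \<rho> t0 by (intro null_familyD) (auto simp: power_series_at_def)
    hence T: "finite T" "{\<beta>. (\<Sum>i\<in>UNIV. \<beta> i) = m} \<subseteq> T"
      unfolding T_def using finite_multi_index_sum by auto
    from est[OF v t0 T, folded \<Phi>_def]
    obtain N where N': "\<forall>z. (\<forall>i. knorm (z $ i) \<le> \<rho> ^ s) \<longrightarrow>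
         norm (avg N (\<lambda>u. \<psi> (\<Sum>\<beta>\<in>T. t * \<Phi> \<beta> * monomial (z + (unif ^ s * u) *s w) \<beta>)))
           \<le> C * knorm t powr (- 1 / real m)" by (elim exE)
    note N = N'[rule_format]
    define P where "P z = (\<Sum>\<beta>\<in>T. t * \<Phi> \<beta> * monomial z \<beta>)" for z
    define G where "G y = \<psi> (P (inverse c *s (y - x)))" for y
    have "continuous_on UNIV (\<lambda>y. P (inverse c *s (y - x)))"
      unfolding P_def monomial_def by (simp, intro continuous_intros)
    hence "continuous_on UNIV G"
      unfolding G_def by (rule continuous_on_compose2[OF continuous_on_char]) auto
    hence G_meas: "G \<in> borel_measurable borel" by (rule borel_measurable_continuous_onI)
    have in_disc: "inverse c *s (y - x) \<in> polydisc 0 (\<rho> ^ s)" if "y \<in> polydisc x r" for y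
      unfolding polydisc_def
    proof (intro CollectI allI)
      fix i
      have "inverse (knorm c) * knorm (y $ i - x $ i) \<le> inverse (knorm c) * (knorm c * \<rho> ^ s)"
        using that by (intro mult_left_mono) (auto simp: polydisc_def r_def)
      also have "\<dots> = \<rho> ^ s" using c0 by (simp add: knorm_eq_zero)
      finally show "knorm ((inverse c *s (y - x)) $ i - 0 $ i) \<le> \<rho> ^ s"
        by (simp add: knorm_mult[symmetric] knorm_inverse[symmetric] right_diff_distrib)
    qed
    have G_eq: "G y = \<psi> (t * dot v (f y))" if y: "y \<in> polydisc x r" for y
    proof -
      define z where "z = inverse c *s (y - x)"
      have y_eq: "y = x + c *s z" using c0 by (simp add: z_def vec_eq_iff)
      have "\<rho> ^ s \<le> 1" using \<rho> by (simp add: power_le_one)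
      hence z: "z \<in> unit_polydisc"
        using in_disc[OF y, folded z_def] by (auto simp: polydisc_def unit_polydisc_def intro: order_trans)
      have "knorm (dot v (f (x + c *s z)) - (\<Sum>\<beta>\<in>T. \<Phi> \<beta> * monomial z \<beta>)) \<le> \<rho> / knorm t"
        using \<rho> t by (intro power_series_truncate[OF ps_v T(1) _ _ z]) (auto simp: T_def)
      hence "knorm (t * (dot v (f y) - (\<Sum>\<beta>\<in>T. \<Phi> \<beta> * monomial z \<beta>))) \<le> knorm t * (\<rho> / knorm t)"
        unfolding y_eq[symmetric] by (intro knorm_mult_le) auto
      also have "\<dots> < 1" using \<rho> t0 by (simp add: knorm_eq_zero)
      finally have "knorm (t * dot v (f y) - P z) < 1"
        by (simp add: P_def right_diff_distrib sum_distrib_left mult.assoc)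
      thus ?thesis using char_cong[of "t * dot v (f y)" "P z"] by (simp add: G_def z_def)
    qed
    have "norm (\<integral>y. indicator (polydisc x r) y * G y \<partial>\<nu>) \<le> C * knorm t powr (- 1 / real m)"
    proof (rule norm_integral_le_line_avg[where a = "(c * unif ^ s) *s w" and N = N])
      show "norm (G y) \<le> 1" for y by (simp add: G_def)
      show "knorm (((c * unif ^ s) *s w) $ i) \<le> r" for i
        using w by (auto simp: r_def \<rho>_def knorm_mult knorm_power unit_polydisc_def intro!: mult_left_le)
      fix y assume y: "y \<in> polydisc x r"
      define z where "z = inverse c *s (y - x)"
      have "inverse c *s (y + u *s ((c * unif ^ s) *s w) - x) = z + (unif ^ s * u) *s w" for u
        using c0 by (simp add: z_def vec_eq_iff field_simps)
      hence "(\<lambda>u. G (y + u *s ((c * unif ^ s) *s w))) = (\<lambda>u. \<psi> (P (z + (unif ^ s * u) *s w)))"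
        by (simp add: G_def)
      moreover have "knorm (z $ i) \<le> \<rho> ^ s" for i
        using in_disc[OF y, folded z_def] by (simp add: polydisc_def)
      ultimately show "norm (avg N (\<lambda>u. G (y + u *s ((c * unif ^ s) *s w)))) \<le> C * knorm t powr (- 1 / real m)"
        using N[of z] by (simp add: P_def)
    qed (use \<nu> G_meas r C in auto)
    also have "\<dots> \<le> C * knorm t powr (- 1 / real k)"
      using C t m by (intro mult_left_mono powr_mono) (auto simp: field_simps)
    finally have "norm (\<integral>y. indicator (polydisc x r) y * G y \<partial>\<nu>) \<le> C * knorm t powr (- 1 / real k)" .
    with G_meas G_eq show ?thesis by (intro bexI[of _ G] conjI ballI)
  qed
  show ?thesis
    by (rule exI[of _ r], rule exI[of _ \<delta>], rule exI[of _ C]) (intro conjI allI impI r \<delta> C main)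
qed

end

section \<open>Compactness and ultrametric coverings\<close>

lemma max_norm_le_iff: "max_norm z \<le> r \<longleftrightarrow> (\<forall>i. knorm (z $ i) \<le> r)"
  by (simp add: max_norm_def Max_le_iff)

lemma knorm_le_max_norm: "knorm (z $ i) \<le> max_norm z"
  using max_norm_le_iff by blast

lemma max_norm_attained: "\<exists>i. max_norm z = knorm (z $ i)"
proof -
  have "Max (range (\<lambda>i. knorm (z $ i))) \<in> range (\<lambda>i. knorm (z $ i))" by (rule Max_in) auto
  then obtain i where "Max (range (\<lambda>i. knorm (z $ i))) = knorm (z $ i)" by (rule imageE)
  thus ?thesis unfolding max_norm_def by (rule exI[of _ i])
qed

lemma polydisc_max_norm: "polydisc x r = {y. max_norm (y - x) \<le> r}"
  by (simp add: polydisc_def max_norm_le_iff)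

lemma polydisc_subset:
  assumes "y \<in> polydisc x r" "s \<le> r"
  shows "polydisc y s \<subseteq> polydisc x r"
proof
  fix z assume z: "z \<in> polydisc y s"
  show "z \<in> polydisc x r"
    unfolding polydisc_def
  proof (intro CollectI allI)
    fix i
    have "knorm ((z $ i - y $ i) + (y $ i - x $ i)) \<le> r"
      using assms z by (intro knorm_add_le) (auto simp: polydisc_def intro: order_trans)
    thus "knorm (z $ i - x $ i) \<le> r" by simp
  qed
qed

lemma polydisc_nested:
  assumes "polydisc x r \<inter> polydisc y s \<noteq> {}"
  shows "polydisc x r \<subseteq> polydisc y s \<or> polydisc y s \<subseteq> polydisc x r"
proof -
  have *: "polydisc y s \<subseteq> polydisc x r"
    if "s \<le> r" "z \<in> polydisc x r" "z \<in> polydisc y s" for x y :: "'a ^ 'b" and z r s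
  proof -
    have "y \<in> polydisc z r" using polydisc_subset[of z y s s] that polydisc_subset[OF _ that(1), of y z]
      by (auto simp: polydisc_def knorm_minus_commute intro: order_trans)
    hence "y \<in> polydisc x r" using polydisc_subset[OF that(2), of r] by auto
    thus ?thesis using that(1) by (rule polydisc_subset)
  qed
  from assms obtain z where "z \<in> polydisc x r" "z \<in> polydisc y s" by blast
  thus ?thesis using *[of s r z x y] *[of r s z y x] by (cases "s \<le> r") auto
qed

lemma open_polydisc: "r > 0 \<Longrightarrow> open (polydisc x r)"
  unfolding open_vec_def
proof (intro ballI)
  fix y assume r: "r > 0" and y: "y \<in> polydisc x r"
  show "\<exists>A. (\<forall>i. open (A i) \<and> y $ i \<in> A i) \<and> (\<forall>z. (\<forall>i. z $ i \<in> A i) \<longrightarrow> z \<in> polydisc x r)"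
  proof (intro exI[of _ "\<lambda>i. ball (y $ i) r"] conjI allI impI)
    fix z assume z: "\<forall>i. z $ i \<in> ball (y $ i) r"
    have "z \<in> polydisc y r"
      using z by (auto simp: polydisc_def dist_knorm knorm_minus_commute intro: less_imp_le)
    thus "z \<in> polydisc x r" using polydisc_subset[OF y order.refl] by blast
  qed (use r in auto)
qed

lemma finite_net_valuation_ring:
  "\<exists>R. finite R \<and> (\<forall>x :: 'k::nonarch_local_field. knorm x \<le> 1 \<longrightarrow> (\<exists>a\<in>R. knorm (x - a) \<le> knorm (unif :: 'k) ^ N))"
proof (induction N)
  case 0
  show ?case by (intro exI[of _ "{0}"]) auto
next
  case (Suc N)
  then obtain R where R: "finite R"
    "\<And>x :: 'k. knorm x \<le> 1 \<Longrightarrow> \<exists>a\<in>R. knorm (x - a) \<le> knorm (unif :: 'k) ^ N" by blast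
  show ?case
  proof (intro exI[of _ "(\<lambda>(b, a). b + unif * a) ` (digits \<times> R)"] conjI allI impI)
    fix x :: 'k assume "knorm x \<le> 1"
    then obtain b c where bc: "b \<in> digits" "knorm c \<le> 1" "x = b + unif * c" by (rule digit_decomp)
    obtain a where a: "a \<in> R" "knorm (c - a) \<le> knorm (unif :: 'k) ^ N" using R(2)[OF bc(2)] by blast
    have "x - (b + unif * a) = unif * (c - a)" by (simp add: bc algebra_simps)
    hence "knorm (x - (b + unif * a)) \<le> knorm (unif :: 'k) ^ Suc N"
      using a by (simp add: knorm_mult mult_left_mono)
    thus "\<exists>a\<in>(\<lambda>(b, a). b + unif * a) ` (digits \<times> R). knorm (x - a) \<le> knorm (unif :: 'k) ^ Suc N"
      using image_eqI[of "b + unif * a" "\<lambda>(b, a). b + unif * a" "(b, a)" "digits \<times> R"] a(1) bc(1)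
      by (intro bexI[of _ "b + unif * a"]) simp_all
  qed (use R in auto)
qed

lemma compact_unit_polydisc: "compact (unit_polydisc :: ('k::nonarch_local_field ^ 'n) set)"
  unfolding compact_eq_totally_bounded
proof (intro conjI allI impI)
  show "complete (unit_polydisc :: ('k ^ 'n) set)"
    unfolding complete_eq_closed polydisc_0_1[symmetric] by (rule closed_polydisc)
  fix e :: real assume e: "e > 0"
  obtain N where N: "knorm (unif :: 'k) ^ N < e / real CARD('n)"
    using real_arch_pow_inv[of "e / real CARD('n)" "knorm (unif :: 'k)"] e by auto
  obtain R where R: "finite R"
    "\<And>x :: 'k. knorm x \<le> 1 \<Longrightarrow> \<exists>a\<in>R. knorm (x - a) \<le> knorm (unif :: 'k) ^ N"
    using finite_net_valuation_ring by blast
  define K :: "('k ^ 'n) set" where "K = vec_lambda ` PiE UNIV (\<lambda>_. R)"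
  have "x \<in> (\<Union>a\<in>K. ball a e)" if x: "x \<in> unit_polydisc" for x
  proof -
    have "\<forall>i. \<exists>a. a \<in> R \<and> knorm (x $ i - a) \<le> knorm (unif :: 'k) ^ N"
      using x R(2) by (auto simp: unit_polydisc_def)
    from choice[OF this] obtain a
      where "\<forall>i. a i \<in> R \<and> knorm (x $ i - a i) \<le> knorm (unif :: 'k) ^ N" by (elim exE)
    hence a: "\<And>i. a i \<in> R" "\<And>i. knorm (x $ i - a i) \<le> knorm (unif :: 'k) ^ N" by simp_all
    have "dist (vec_lambda a) x \<le> (\<Sum>i\<in>UNIV. dist (vec_lambda a $ i) (x $ i))"
      unfolding dist_vec_def by (rule L2_set_le_sum) auto
    also have "\<dots> \<le> (\<Sum>i\<in>(UNIV :: 'n set). knorm (unif :: 'k) ^ N)"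
      using a(2) by (intro sum_mono) (auto simp: dist_knorm knorm_minus_commute)
    also have "\<dots> = real CARD('n) * knorm (unif :: 'k) ^ N" by simp
    also have "\<dots> < e" using N by (simp add: field_simps)
    finally have "x \<in> ball (vec_lambda a) e" by simp
    moreover have "vec_lambda a \<in> K" unfolding K_def using a(1) by (intro imageI PiE_I) simp_all
    ultimately show ?thesis by (intro UN_I)
  qed
  moreover have "finite K" unfolding K_def using R(1) by (intro finite_imageI finite_PiE) auto
  ultimately show "\<exists>K. finite K \<and> (unit_polydisc :: ('k ^ 'n) set) \<subseteq> (\<Union>a\<in>K. ball a e)"
    by (intro exI[of _ K] conjI subsetI)
qed

lemma compact_unit_sphere: "compact {v :: 'k::nonarch_local_field ^ 'n. max_norm v = 1}"
proof -
  have "{v :: 'k ^ 'n. max_norm v = 1} = unit_polydisc \<inter> (\<Union>i. {v. knorm (v $ i - 0 $ i) = 1})"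
  proof (intro equalityI subsetI)
    fix v :: "'k ^ 'n" assume "v \<in> {v. max_norm v = 1}"
    thus "v \<in> unit_polydisc \<inter> (\<Union>i. {v. knorm (v $ i - 0 $ i) = 1})"
      using max_norm_attained[of v] max_norm_le_iff[of v 1] by (auto simp: unit_polydisc_def)
  next
    fix v :: "'k ^ 'n" assume v: "v \<in> unit_polydisc \<inter> (\<Union>i. {v. knorm (v $ i - 0 $ i) = 1})"
    then obtain i where "knorm (v $ i) = 1" by auto
    moreover have "max_norm v \<le> 1" using v by (auto simp: unit_polydisc_def max_norm_le_iff)
    ultimately show "v \<in> {v. max_norm v = 1}" using knorm_le_max_norm[of v i] by simp
  qed
  moreover have "closed (\<Union>i. {v :: 'k ^ 'n. knorm (v $ i - 0 $ i) = 1})"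
    by (intro closed_UN finite ballI closed_Collect_eq continuous_on_knorm_dist continuous_on_const)
  ultimately show ?thesis by (simp only: compact_Int_closed[OF compact_unit_polydisc])
qed

lemma compact_polydisc_cover:
  fixes S :: "('k::nonarch_local_field ^ 'n) set"
  assumes S: "compact S" and r: "\<forall>x\<in>S. r x > 0"
  shows "\<exists>X. X \<subseteq> S \<and> finite X \<and> S \<subseteq> (\<Union>x\<in>X. polydisc x (r x))"
proof (rule compactE_image[OF S, of S "\<lambda>x. polydisc x (r x)"])
  show "open (polydisc x (r x))" if "x \<in> S" for x using r that by (intro open_polydisc) blast
  have "x \<in> polydisc x (r x)" if "x \<in> S" for x
    using r that by (simp add: polydisc_def less_imp_le)
  thus "S \<subseteq> (\<Union>x\<in>S. polydisc x (r x))" by blast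
  fix X assume "X \<subseteq> S" "finite X" "S \<subseteq> (\<Union>x\<in>X. polydisc x (r x))"
  thus ?thesis by (intro exI[of _ X] conjI)
qed

text \<open>
  Two polydiscs are disjoint or nested, so the maximal members of a finite covering are disjoint and
  still cover. Only one centre is kept for each of them, since different centres may give the same set.
\<close>

lemma disjoint_polydisc_cover:
  fixes S :: "('k::nonarch_local_field ^ 'n) set"
  assumes S: "compact S" and r: "\<forall>x\<in>S. r x > 0"
  shows "\<exists>D. finite D \<and> D \<subseteq> S \<and> (\<Union>x\<in>D. S \<inter> polydisc x (r x)) = S \<and>
    disjoint_family_on (\<lambda>x. S \<inter> polydisc x (r x)) D"
proof -
  define B where "B x = S \<inter> polydisc x (r x)" for x
  obtain X where X: "X \<subseteq> S" "finite X" "S \<subseteq> (\<Union>x\<in>X. polydisc x (r x))"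
    using compact_polydisc_cover[OF S r] by blast
  define Mx where "Mx = {E \<in> B ` X. \<forall>E'\<in>B ` X. E \<subseteq> E' \<longrightarrow> E = E'}"
  have "Mx \<subseteq> B ` X" by (auto simp: Mx_def)
  then obtain D where D: "D \<subseteq> X" "inj_on B D" "Mx = B ` D" by (auto simp: subset_image_inj)
  have "finite D" using D(1) X(2) by (rule finite_subset)
  moreover have "D \<subseteq> S" using D(1) X(1) by simp
  moreover have "(\<Union>x\<in>D. B x) = S"
  proof
    show "(\<Union>x\<in>D. B x) \<subseteq> S" by (auto simp: B_def)
    show "S \<subseteq> (\<Union>x\<in>D. B x)"
    proof
      fix y assume "y \<in> S"
      then obtain x where x: "x \<in> X" "y \<in> B x" using X by (auto simp: B_def)
      obtain E where E: "E \<in> B ` X" "B x \<subseteq> E" "\<forall>E'\<in>B ` X. E \<subseteq> E' \<longrightarrow> E = E'"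
        using finite_has_maximal2[of "B ` X" "B x"] X x by auto
      hence "E \<in> B ` D" unfolding D(3)[symmetric] by (simp add: Mx_def)
      thus "y \<in> (\<Union>x\<in>D. B x)" using E(2) x(2) by blast
    qed
  qed
  moreover have "disjoint_family_on B D"
    unfolding disjoint_family_on_def
  proof (intro ballI impI)
    fix x y assume xy: "x \<in> D" "y \<in> D" "x \<noteq> y"
    hence Mxy: "B x \<in> Mx" "B y \<in> Mx" by (simp_all add: D(3))
    show "B x \<inter> B y = {}"
    proof (rule ccontr)
      assume "B x \<inter> B y \<noteq> {}"
      hence "polydisc x (r x) \<inter> polydisc y (r y) \<noteq> {}" by (auto simp: B_def)
      from polydisc_nested[OF this] have "B x \<subseteq> B y \<or> B y \<subseteq> B x"
        unfolding B_def by (elim disjE) (intro disjI1 disjI2 Int_mono order.refl; assumption)+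
      moreover have "\<forall>E'\<in>B ` X. B x \<subseteq> E' \<longrightarrow> B x = E'" "\<forall>E'\<in>B ` X. B y \<subseteq> E' \<longrightarrow> B y = E'"
        "B x \<in> B ` X" "B y \<in> B ` X" using Mxy by (simp_all add: Mx_def)
      ultimately have "B x = B y" by metis
      thus False using inj_onD[OF D(2)] xy by blast
    qed
  qed
  ultimately have "finite D \<and> D \<subseteq> S \<and> (\<Union>x\<in>D. B x) = S \<and> disjoint_family_on B D"
    by (intro conjI)
  thus ?thesis unfolding B_def[abs_def] by (rule exI[of _ D])
qed

section \<open>Discs of a manifold in isometric charts\<close>

lemma continuous_on_coord_proj: "continuous_on UNIV (coord_proj \<sigma>)"
  unfolding coord_proj_def[abs_def] by (intro continuous_intros)

text \<open>
  Because the chart is an isometry, a disc of \<open>S\<close> around \<open>x0\<close> corresponds to the full polydisc around the image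
  of \<open>x0\<close>. Pushing forward along the globally continuous projection, rather than pulling back along
  the parametrization, requires measurability of the projection only.
\<close>

lemma isometric_chart_disc:
  fixes \<nu> :: "('k::nonarch_local_field ^ 'd) measure" and \<mu> :: "('k ^ 'n) measure"
  assumes \<mu>: "space \<mu> = S" "sets \<mu> = sets (restrict_space borel S)"
    and \<nu>: "sets \<nu> = sets borel"
    and U: "U \<subseteq> S" "x0 \<in> U" "S \<inter> polydisc x0 r \<subseteq> U"
    and isometric: "\<forall>y\<in>U. \<forall>z\<in>U. max_norm (coord_proj \<sigma> y - coord_proj \<sigma> z) = max_norm (y - z)"
    and pullback: "\<forall>A\<in>sets \<mu>. A \<subseteq> U \<longrightarrow> emeasure \<mu> A = emeasure \<nu> (coord_proj \<sigma> ` A)"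
    and img: "polydisc (coord_proj \<sigma> x0) r \<subseteq> coord_proj \<sigma> ` U"
  shows "S \<inter> polydisc x0 r \<in> sets \<mu>"
    and "coord_proj \<sigma> ` (S \<inter> polydisc x0 r) = polydisc (coord_proj \<sigma> x0) r"
    and "emeasure \<mu> (S \<inter> polydisc x0 r) = emeasure \<nu> (polydisc (coord_proj \<sigma> x0) r)"
    and "G \<in> borel_measurable borel \<Longrightarrow>
      (\<integral>x. indicator (S \<inter> polydisc x0 r) x * G (coord_proj \<sigma> x) \<partial>\<mu>) =
      (\<integral>y. indicator (polydisc (coord_proj \<sigma> x0) r) y * (G y :: complex) \<partial>\<nu>)"
proof -
  note iso = isometric[rule_format] and meas = pullback[rule_format]
  define B where "B = S \<inter> polydisc x0 r"
  define B' where "B' = polydisc (coord_proj \<sigma> x0) r"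
  show B: "S \<inter> polydisc x0 r \<in> sets \<mu>"
    unfolding \<mu>(2) sets_restrict_space by (intro imageI) auto
  show pB: "coord_proj \<sigma> ` (S \<inter> polydisc x0 r) = polydisc (coord_proj \<sigma> x0) r"
  proof (intro equalityI subsetI)
    fix y assume "y \<in> coord_proj \<sigma> ` (S \<inter> polydisc x0 r)"
    thus "y \<in> polydisc (coord_proj \<sigma> x0) r"
      using iso[OF _ U(2)] U by (auto simp: polydisc_max_norm)
  next
    fix y assume y: "y \<in> polydisc (coord_proj \<sigma> x0) r"
    then obtain x where x: "x \<in> U" "y = coord_proj \<sigma> x" using img by auto
    hence "x \<in> polydisc x0 r" using y iso[OF x(1) U(2)] by (simp add: polydisc_max_norm)
    thus "y \<in> coord_proj \<sigma> ` (S \<inter> polydisc x0 r)" using x U by auto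
  qed
  show "emeasure \<mu> (S \<inter> polydisc x0 r) = emeasure \<nu> (polydisc (coord_proj \<sigma> x0) r)"
    using meas[OF B U(3)] by (simp add: pB)
  assume G: "G \<in> borel_measurable borel"
  have p: "coord_proj \<sigma> \<in> measurable \<mu> borel"
    unfolding measurable_cong_sets[OF \<mu>(2) refl]
    by (intro measurable_restrict_space1 borel_measurable_continuous_onI continuous_on_coord_proj)
  have B_ind: "(\<lambda>x. indicator B x :: real) \<in> borel_measurable \<mu>" using B by (simp add: B_def)
  have B'_ind: "(\<lambda>x. indicator B' x :: real) \<in> borel_measurable \<nu>"
    unfolding B'_def by (intro borel_measurable_indicator) (simp add: \<nu>)
  have distr_eq: "distr (density \<mu> (indicator B)) borel (coord_proj \<sigma>) = density \<nu> (indicator B')"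
  proof (rule measure_eqI)
    fix A assume "A \<in> sets (distr (density \<mu> (indicator B)) borel (coord_proj \<sigma>))"
    hence A: "A \<in> sets borel" by simp
    have pA: "coord_proj \<sigma> -` A \<inter> S \<in> sets \<mu>" using measurable_sets[OF p A] by (simp add: \<mu>)
    have "emeasure (distr (density \<mu> (indicator B)) borel (coord_proj \<sigma>)) A =
        emeasure (density \<mu> (indicator B)) (coord_proj \<sigma> -` A \<inter> S)"
      using p A by (subst emeasure_distr) (auto simp: \<mu>)
    also have "\<dots> = emeasure \<mu> (B \<inter> (coord_proj \<sigma> -` A \<inter> S))"
      using B pA unfolding B_def by (rule emeasure_restricted)
    also have "\<dots> = emeasure \<nu> (coord_proj \<sigma> ` (B \<inter> (coord_proj \<sigma> -` A \<inter> S)))"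
      using B pA U by (intro meas) (auto simp: B_def)
    also have "coord_proj \<sigma> ` (B \<inter> (coord_proj \<sigma> -` A \<inter> S)) = B' \<inter> A"
      unfolding B'_def pB[symmetric] by (auto simp: B_def)
    also have "emeasure \<nu> (B' \<inter> A) = emeasure (density \<nu> (indicator B')) A"
      using A by (intro emeasure_restricted[symmetric]) (auto simp: B'_def \<nu>)
    finally show "emeasure (distr (density \<mu> (indicator B)) borel (coord_proj \<sigma>)) A =
      emeasure (density \<nu> (indicator B')) A" .
  qed (simp add: \<nu>)
  have "(\<integral>x. indicator B x * G (coord_proj \<sigma> x) \<partial>\<mu>) =
      (\<integral>x. indicator B x *\<^sub>R G (coord_proj \<sigma> x) \<partial>\<mu>)"
    by (intro Bochner_Integration.integral_cong) (auto simp: indicator_def)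
  also have "\<dots> = (\<integral>x. G (coord_proj \<sigma> x) \<partial>density \<mu> (\<lambda>x. ennreal (indicator B x)))"
    using p G B_ind by (intro integral_density[symmetric]) auto
  also have "\<dots> = (\<integral>y. G y \<partial>distr (density \<mu> (indicator B)) borel (coord_proj \<sigma>))"
    using p G by (subst integral_distr) (auto simp: ennreal_indicator)
  also have "\<dots> = (\<integral>y. G y \<partial>density \<nu> (\<lambda>y. ennreal (indicator B' y)))"
    unfolding distr_eq by (simp add: ennreal_indicator)
  also have "\<dots> = (\<integral>y. indicator B' y *\<^sub>R G y \<partial>\<nu>)"
    using G B'_ind \<nu> by (intro integral_density) (auto simp: measurable_cong_sets[OF \<nu> refl])
  also have "\<dots> = (\<integral>y. indicator B' y * G y \<partial>\<nu>)"
    by (intro Bochner_Integration.integral_cong) (auto simp: indicator_def)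
  finally show "(\<integral>x. indicator (S \<inter> polydisc x0 r) x * G (coord_proj \<sigma> x) \<partial>\<mu>) =
      (\<integral>y. indicator (polydisc (coord_proj \<sigma> x0) r) y * G y \<partial>\<nu>)"
    by (simp add: B_def B'_def)
qed

section \<open>Decay of the Fourier transform\<close>

lemma dot_scale: "dot (t *s v) x = t * dot v x"
  by (simp add: dot_def sum_distrib_left mult.assoc)

context nontrivial_character
begin

text \<open>
  The chart supplied by the induced measure is isometric, and the type condition holds in every
  chart, hence in this one.
\<close>

lemma manifold_local_estimate:
  fixes \<nu> :: "('k ^ 'd) measure" and \<mu> :: "('k ^ 'n) measure"
  assumes \<nu>: "normalized_haar \<nu>" and \<mu>: "induced_measure \<nu> S \<mu>"
    and type_le: "type_le_at TYPE('d) S x0 k" and x0: "x0 \<in> S" and v0: "v0 \<noteq> 0"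
    and k: "\<forall>j. 1 \<le> j \<longrightarrow> j \<le> k \<longrightarrow> of_nat j \<noteq> (0 :: 'k)"
  shows "\<exists>r \<delta> C. 0 < r \<and> 0 < \<delta> \<and> 0 \<le> C \<and> emeasure \<mu> (S \<inter> polydisc x0 r) \<le> 1 \<and>
    (\<forall>v t. v \<in> unit_polydisc \<longrightarrow> v \<in> polydisc v0 \<delta> \<longrightarrow> knorm t \<ge> 1 \<longrightarrow>
      norm (\<integral>x. indicator (S \<inter> polydisc x0 r) x * \<psi> (t * dot v x) \<partial>\<mu>) \<le> C * knorm t powr (- 1 / real k))"
proof -
  have space: "space \<mu> = S" "sets \<mu> = sets (restrict_space borel S)"
    using \<mu> by (auto simp: induced_measure_def)
  have \<nu>_sets: "sets \<nu> = sets borel" using \<nu> by (simp add: normalized_haar_def)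
  obtain U and \<sigma> :: "'d \<Rightarrow> 'n" and f where U: "x0 \<in> U" "analytic_chart S U \<sigma> f"
    and iso: "\<forall>y\<in>U. \<forall>z\<in>U. max_norm (coord_proj \<sigma> y - coord_proj \<sigma> z) = max_norm (y - z)"
    and meas: "\<forall>A\<in>sets \<mu>. A \<subseteq> U \<longrightarrow> emeasure \<mu> A = emeasure \<nu> (coord_proj \<sigma> ` A)"
    using \<mu> x0 unfolding induced_measure_def by meson
  define x' where "x' = coord_proj \<sigma> x0"
  have chart: "openin (top_of_set S) U" "K_analytic_on f (coord_proj \<sigma> ` U)" "\<forall>x\<in>U. f (coord_proj \<sigma> x) = x"
    using U by (auto simp: analytic_chart_def)
  have US: "U \<subseteq> S" using chart(1) by (auto simp: openin_open)
  obtain W where W: "open W" "U = S \<inter> W" using chart(1) by (auto simp: openin_open)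
  obtain \<epsilon> where \<epsilon>: "\<epsilon> > 0" "polydisc x0 \<epsilon> \<subseteq> W"
    using open_vec_knorm[OF W(1), of x0] U W by (auto simp: polydisc_def)
  have "x' \<in> coord_proj \<sigma> ` U" using U by (auto simp: x'_def)
  from K_analytic_on_power_series[OF chart(2) this, of "min 1 \<epsilon>"]
  obtain c b where c: "c \<noteq> 0" "knorm c < min 1 \<epsilon>"
    and disc: "\<forall>z\<in>unit_polydisc. x' + c *s z \<in> coord_proj \<sigma> ` U"
    and ps: "\<forall>j. power_series_at x' c (b j) (\<lambda>y. f y $ j)" using \<epsilon>(1) by auto
  obtain \<alpha> where \<alpha>: "0 < (\<Sum>i\<in>UNIV. \<alpha> i)" "(\<Sum>i\<in>UNIV. \<alpha> i) \<le> k"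
    "dot v0 (\<chi> j. multi_deriv \<alpha> (\<lambda>x. f x $ j) x') \<noteq> 0"
    using type_le U v0 unfolding type_le_at_def x'_def by meson
  obtain e where e: "\<And>b g. power_series_at x' c b g \<Longrightarrow> multi_deriv \<alpha> g x' = e * b \<alpha>"
    using multi_deriv_power_series by blast
  have "dot v0 (\<chi> j. multi_deriv \<alpha> (\<lambda>x. f x $ j) x') = e * (\<Sum>j\<in>UNIV. v0 $ j * b j \<alpha>)"
    by (simp add: dot_def sum_distrib_left e[OF ps[rule_format]] mult_ac)
  hence nz: "(\<Sum>j\<in>UNIV. v0 $ j * b j \<alpha>) \<noteq> 0" using \<alpha>(3) by auto
  have c1: "knorm c \<le> 1" using c by simp
  from local_estimate[OF \<nu> ps c1 k \<alpha>(1,2) nz]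
  obtain r \<delta> C where r: "0 < r" "r \<le> knorm c" and \<delta>: "0 < \<delta>" and C: "0 \<le> C"
    and est: "\<forall>v t. v \<in> unit_polydisc \<longrightarrow> v \<in> polydisc v0 \<delta> \<longrightarrow> knorm t \<ge> 1 \<longrightarrow>
      (\<exists>G\<in>borel_measurable borel. (\<forall>y\<in>polydisc x' r. G y = \<psi> (t * dot v (f y))) \<and>
         norm (\<integral>y. indicator (polydisc x' r) y * G y \<partial>\<nu>) \<le> C * knorm t powr (- 1 / real k))"
    by auto
  have sub: "S \<inter> polydisc x0 r \<subseteq> U"
  proof -
    have "r \<le> \<epsilon>" using r c by simp
    hence "polydisc x0 r \<subseteq> polydisc x0 \<epsilon>"
      using \<epsilon>(1) by (intro polydisc_subset) (auto simp: polydisc_def)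
    thus ?thesis using W(2) \<epsilon>(2) by blast
  qed
  have img: "polydisc x' r \<subseteq> coord_proj \<sigma> ` U"
  proof
    fix y assume y: "y \<in> polydisc x' r"
    define z where "z = inverse c *s (y - x')"
    have "inverse (knorm c) * knorm (y $ i - x' $ i) \<le> inverse (knorm c) * knorm c" for i
      using y r by (intro mult_left_mono) (auto simp: polydisc_def intro: order_trans)
    hence "z \<in> unit_polydisc"
      using c by (simp add: unit_polydisc_def z_def knorm_eq_zero knorm_mult[symmetric]
          knorm_inverse[symmetric] right_diff_distrib)
    moreover have "y = x' + c *s z" using c by (simp add: z_def vec_eq_iff)
    ultimately show "y \<in> coord_proj \<sigma> ` U" using disc by auto
  qed
  note discs = isometric_chart_disc[OF space \<nu>_sets US U(1) sub, of \<sigma>, folded x'_def,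
      OF iso meas img]
  have "emeasure \<mu> (S \<inter> polydisc x0 r) \<le> 1"
    unfolding discs(3) using r c by (intro haar_polydisc_le_1 \<nu>) simp
  moreover have "norm (\<integral>x. indicator (S \<inter> polydisc x0 r) x * \<psi> (t * dot v x) \<partial>\<mu>) \<le> C * knorm t powr (- 1 / real k)"
    if vt: "v \<in> unit_polydisc" "v \<in> polydisc v0 \<delta>" "knorm t \<ge> 1" for v t
  proof -
    obtain G where G: "G \<in> borel_measurable borel" "\<forall>y\<in>polydisc x' r. G y = \<psi> (t * dot v (f y))"
      "norm (\<integral>y. indicator (polydisc x' r) y * G y \<partial>\<nu>) \<le> C * knorm t powr (- 1 / real k)"
      using est vt by blast
    have restrict: "indicator (S \<inter> polydisc x0 r) x * \<psi> (t * dot v x) =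
        indicator (S \<inter> polydisc x0 r) x * G (coord_proj \<sigma> x)" for x
    proof (cases "x \<in> S \<inter> polydisc x0 r")
      case True
      hence "coord_proj \<sigma> x \<in> polydisc x' r" "f (coord_proj \<sigma> x) = x"
        using discs(2) sub chart(3) by blast+
      thus ?thesis using G(2) by simp
    qed simp
    show ?thesis unfolding restrict discs(4)[OF G(1)] by (rule G(3))
  qed
  ultimately show ?thesis
    using r \<delta> C by (intro exI[of _ r] exI[of _ \<delta>] exI[of _ C] conjI allI impI)
qed

text \<open>
  Summation of the local estimates over a partition of \<open>S\<close> into finitely many discs; the discs have
  finite measure, so \<open>\<mu>\<close> is finite.
\<close>

lemma manifold_estimate_near_direction:
  fixes \<nu> :: "('k ^ 'd) measure" and \<mu> :: "('k ^ 'n) measure"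
  assumes \<nu>: "normalized_haar \<nu>" and \<mu>: "induced_measure \<nu> S \<mu>"
    and S: "compact S" and type_le: "\<forall>x\<in>S. type_le_at TYPE('d) S x k" and v0: "v0 \<noteq> 0"
    and k: "\<forall>j. 1 \<le> j \<longrightarrow> j \<le> k \<longrightarrow> of_nat j \<noteq> (0 :: 'k)"
  shows "finite_measure \<mu> \<and> (\<exists>\<delta> C. 0 < \<delta> \<and> 0 \<le> C \<and>
    (\<forall>v t. v \<in> unit_polydisc \<longrightarrow> v \<in> polydisc v0 \<delta> \<longrightarrow> knorm t \<ge> 1 \<longrightarrow>
      norm (\<integral>x. \<psi> (t * dot v x) \<partial>\<mu>) \<le> C * knorm t powr (- 1 / real k)))"
proof -
  have space: "space \<mu> = S" "sets \<mu> = sets (restrict_space borel S)"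
    using \<mu> by (auto simp: induced_measure_def)
  define P where "P x r \<delta> C \<longleftrightarrow> 0 < r \<and> 0 < \<delta> \<and> 0 \<le> C \<and> emeasure \<mu> (S \<inter> polydisc x r) \<le> 1 \<and>
    (\<forall>v t. v \<in> unit_polydisc \<longrightarrow> v \<in> polydisc v0 \<delta> \<longrightarrow> knorm t \<ge> 1 \<longrightarrow>
      norm (\<integral>y. indicator (S \<inter> polydisc x r) y * \<psi> (t * dot v y) \<partial>\<mu>) \<le> C * knorm t powr (- 1 / real k))"
    for x r \<delta> C
  have "\<forall>x\<in>S. \<exists>r \<delta> C. P x r \<delta> C"
    unfolding P_def by (intro ballI manifold_local_estimate[OF \<nu> \<mu> type_le[rule_format] _ v0 k])
  then obtain r \<delta> C where P: "\<And>x. x \<in> S \<Longrightarrow> P x (r x) (\<delta> x) (C x)" by metis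
  have r: "\<forall>x\<in>S. 0 < r x" using P unfolding P_def by blast
  have \<delta>: "0 < \<delta> x" and C: "0 \<le> C x" and le1: "emeasure \<mu> (S \<inter> polydisc x (r x)) \<le> 1" if "x \<in> S" for x
    using P that by (simp_all add: P_def)
  have est: "norm (\<integral>y. indicator (S \<inter> polydisc x (r x)) y * \<psi> (t * dot v y) \<partial>\<mu>) \<le> C x * knorm t powr (- 1 / real k)"
    if "x \<in> S" "v \<in> unit_polydisc" "v \<in> polydisc v0 (\<delta> x)" "knorm t \<ge> 1" for x v t
    using P[OF that(1)] that(2-4) unfolding P_def by simp
  define B where "B x = S \<inter> polydisc x (r x)" for x
  have B_sets: "B x \<in> sets \<mu>" for x
    unfolding \<open>sets \<mu> = _\<close> sets_restrict_space B_def by (intro imageI) auto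
  obtain D where D: "finite D" "D \<subseteq> S" "(\<Union>x\<in>D. B x) = S" "disjoint_family_on B D"
    using disjoint_polydisc_cover[OF S r] unfolding B_def by blast
  have "emeasure \<mu> (space \<mu>) = emeasure \<mu> (\<Union>x\<in>D. B x)" using D(3) by (simp add: space)
  also have "\<dots> \<le> (\<Sum>x\<in>D. emeasure \<mu> (B x))"
    using D(1) B_sets by (intro emeasure_subadditive_finite) auto
  also have "\<dots> \<le> (\<Sum>x\<in>D. 1)" using le1 D(2) by (intro sum_mono) (auto simp: B_def)
  also have "\<dots> < \<infinity>" by (simp add: of_nat_less_top)
  finally have fin: "finite_measure \<mu>" by (intro finite_measureI) simp
  then interpret finite_measure \<mu> .
  define \<delta>' where "\<delta>' = Min (insert 1 (\<delta> ` D))"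
  have \<delta>'_pos: "\<delta>' > 0" unfolding \<delta>'_def using D \<delta> by (subst Min_gr_iff) auto
  have \<delta>'_le: "\<delta>' \<le> \<delta> x" if "x \<in> D" for x
    unfolding \<delta>'_def using D(1) that by (intro Min_le) auto
  have "norm (\<integral>x. \<psi> (t * dot v x) \<partial>\<mu>) \<le> (\<Sum>x\<in>D. C x) * knorm t powr (- 1 / real k)"
    if vt: "v \<in> unit_polydisc" "v \<in> polydisc v0 \<delta>'" "knorm t \<ge> 1" for v t
  proof -
    have "continuous_on UNIV (\<lambda>x. t * dot v x)"
      unfolding dot_def by (intro continuous_intros)
    hence "continuous_on UNIV (\<lambda>x. \<psi> (t * dot v x))"
      by (rule continuous_on_compose2[OF continuous_on_char]) auto
    hence meas: "(\<lambda>x. \<psi> (t * dot v x)) \<in> borel_measurable \<mu>"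
      unfolding measurable_cong_sets[OF space(2) refl]
      by (intro measurable_restrict_space1 borel_measurable_continuous_onI)
    have int: "integrable \<mu> (\<lambda>y. indicator (B x) y * \<psi> (t * dot v y))" for x
    proof (rule integrable_const_bound[of _ 1])
      show "(\<lambda>y. indicator (B x) y * \<psi> (t * dot v y)) \<in> borel_measurable \<mu>"
        using meas B_sets[of x] by measurable
    qed (auto simp: norm_mult indicator_def)
    have "(\<integral>x. \<psi> (t * dot v x) \<partial>\<mu>) = (\<integral>y. (\<Sum>x\<in>D. indicator (B x) y * \<psi> (t * dot v y)) \<partial>\<mu>)"
    proof (rule Bochner_Integration.integral_cong)
      fix y assume "y \<in> space \<mu>"
      hence "y \<in> S" by (simp add: space)
      then obtain x where x: "x \<in> D" "y \<in> B x" using D(3) by blast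
      have "(\<Sum>x'\<in>D. indicator (B x') y * \<psi> (t * dot v y)) = (\<Sum>x'\<in>D. if x' = x then \<psi> (t * dot v y) else 0)"
        using x D(4) by (intro sum.cong) (auto simp: indicator_def disjoint_family_on_def)
      also have "\<dots> = \<psi> (t * dot v y)" using x D(1) by simp
      finally show "\<psi> (t * dot v y) = (\<Sum>x\<in>D. indicator (B x) y * \<psi> (t * dot v y))" by simp
    qed simp
    also have "\<dots> = (\<Sum>x\<in>D. \<integral>y. indicator (B x) y * \<psi> (t * dot v y) \<partial>\<mu>)"
      by (rule Bochner_Integration.integral_sum) (rule int)
    also have "norm \<dots> \<le> (\<Sum>x\<in>D. C x * knorm t powr (- 1 / real k))"
    proof (rule sum_norm_le)
      fix x assume x: "x \<in> D"
      have "v \<in> polydisc v0 (\<delta> x)" using vt(2) \<delta>'_le[OF x] by (auto simp: polydisc_def intro: order_trans)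
      thus "norm (\<integral>y. indicator (B x) y * \<psi> (t * dot v y) \<partial>\<mu>) \<le> C x * knorm t powr (- 1 / real k)"
        unfolding B_def using x D(2) vt by (intro est) auto
    qed
    finally show ?thesis by (simp add: sum_distrib_right)
  qed
  moreover have "(\<Sum>x\<in>D. C x) \<ge> 0" using C D(2) by (intro sum_nonneg) auto
  ultimately show ?thesis
    using fin \<delta>'_pos by (intro conjI exI[of _ \<delta>'] exI[of _ "\<Sum>x\<in>D. C x"] allI impI)
qed

text \<open>
  Compactness of the unit sphere makes the constant uniform in the direction \<open>v\<close> of \<open>y = t v\<close>, where
  \<open>t\<close> is a coordinate of \<open>y\<close> of maximal norm. For \<open>|t| < 1\<close> the total mass of \<open>\<mu>\<close> suffices, because
  \<open>|t|^(-1/k) \<ge> 1\<close>.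
\<close>

lemma fourier_transform_bound:
  fixes \<nu> :: "('k ^ 'd) measure" and \<mu> :: "('k ^ 'n) measure"
  assumes \<nu>: "normalized_haar \<nu>" and \<mu>: "induced_measure \<nu> S \<mu>"
    and S: "compact S" and type_le: "\<forall>x\<in>S. type_le_at TYPE('d) S x k"
    and k: "\<forall>j. 1 \<le> j \<longrightarrow> j \<le> k \<longrightarrow> of_nat j \<noteq> (0 :: 'k)"
  shows "\<exists>c. \<forall>y. y \<noteq> 0 \<longrightarrow>
    norm (fourier_transform \<psi> \<mu> y) \<le> c * max_norm y powr (- (1 / real k))"
proof -
  let ?\<Sigma> = "{v :: 'k ^ 'n. max_norm v = 1}"
  have nz: "v \<noteq> 0" if "v \<in> ?\<Sigma>" for v using that max_norm_attained[of v] by auto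
  have fin: "finite_measure \<mu>"
    using manifold_estimate_near_direction[OF \<nu> \<mu> S type_le, of "\<chi> i. 1"] k by (auto simp: vec_eq_iff)
  define P where "P v0 \<delta> C \<longleftrightarrow> 0 < \<delta> \<and> 0 \<le> C \<and>
    (\<forall>v t. v \<in> unit_polydisc \<longrightarrow> v \<in> polydisc v0 \<delta> \<longrightarrow> knorm t \<ge> 1 \<longrightarrow>
      norm (\<integral>x. \<psi> (t * dot v x) \<partial>\<mu>) \<le> C * knorm t powr (- 1 / real k))" for v0 \<delta> C
  have "\<forall>v0\<in>?\<Sigma>. \<exists>\<delta> C. P v0 \<delta> C"
    unfolding P_def by (intro ballI manifold_estimate_near_direction[OF \<nu> \<mu> S type_le nz k, THEN conjunct2])
  then obtain \<delta> C where P: "\<And>v0. v0 \<in> ?\<Sigma> \<Longrightarrow> P v0 (\<delta> v0) (C v0)" by metis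
  have \<delta>: "\<forall>v0\<in>?\<Sigma>. 0 < \<delta> v0" using P unfolding P_def by blast
  have C: "0 \<le> C v0" if "v0 \<in> ?\<Sigma>" for v0 using P[OF that] by (simp add: P_def)
  have est: "norm (\<integral>x. \<psi> (t * dot v x) \<partial>\<mu>) \<le> C v0 * knorm t powr (- 1 / real k)"
    if "v0 \<in> ?\<Sigma>" "v \<in> unit_polydisc" "v \<in> polydisc v0 (\<delta> v0)" "knorm t \<ge> 1" for v0 v t
    using P[OF that(1)] that(2-4) unfolding P_def by simp
  obtain V where V: "V \<subseteq> ?\<Sigma>" "finite V" "?\<Sigma> \<subseteq> (\<Union>v\<in>V. polydisc v (\<delta> v))"
    using compact_polydisc_cover[OF compact_unit_sphere \<delta>] by blast
  define c where "c = (\<Sum>v\<in>V. C v) + measure \<mu> (space \<mu>)"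
  have C_sum: "(\<Sum>v\<in>V. C v) \<ge> 0" using C V(1) by (intro sum_nonneg) auto
  have "norm (fourier_transform \<psi> \<mu> y) \<le> c * max_norm y powr (- (1 / real k))" if y: "y \<noteq> 0" for y
  proof -
    obtain i where i: "max_norm y = knorm (y $ i)" using max_norm_attained by blast
    define t where "t = y $ i"
    have t: "t \<noteq> 0"
    proof
      assume "t = 0"
      hence "knorm (y $ j) \<le> 0" for j using i knorm_le_max_norm[of y j] by (simp add: t_def)
      hence "y $ j = 0" for j using knorm_ge_0[of "y $ j"] knorm_eq_zero[of "y $ j"] by (metis order_antisym)
      thus False using y by (simp add: vec_eq_iff)
    qed
    show ?thesis
    proof (cases "knorm t \<ge> 1")
      case True
      define v where "v = inverse t *s y"
      have y_eq: "y = t *s v" using t by (simp add: v_def vec_eq_iff)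
      have "knorm (v $ j) \<le> 1" for j
      proof -
        have "knorm (y $ j) \<le> knorm t" using knorm_le_max_norm[of y j] i by (simp add: t_def)
        moreover have "v $ j = y $ j / t" by (simp add: v_def divide_inverse)
        ultimately show ?thesis using t by (simp add: knorm_divide divide_le_eq_1)
      qed
      hence v1: "v \<in> unit_polydisc" by (simp add: unit_polydisc_def)
      hence "max_norm v \<le> 1" by (simp add: unit_polydisc_def max_norm_le_iff)
      moreover have "knorm (v $ i) = 1" using t by (simp add: v_def t_def[symmetric])
      ultimately have "v \<in> ?\<Sigma>" using knorm_le_max_norm[of v i] by simp
      then obtain v0 where v0: "v0 \<in> V" "v \<in> polydisc v0 (\<delta> v0)" using V(3) by blast
      have "norm (fourier_transform \<psi> \<mu> y) = norm (\<integral>x. \<psi> (t * dot v x) \<partial>\<mu>)"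
        by (simp add: fourier_transform_def y_eq dot_scale)
      also have "\<dots> \<le> C v0 * knorm t powr (- 1 / real k)"
        using v0 V(1) v1 True by (intro est) auto
      also have "\<dots> \<le> c * knorm t powr (- 1 / real k)"
      proof (rule mult_right_mono)
        have "C v0 \<le> (\<Sum>v\<in>V. C v)" using V C v0 by (intro member_le_sum) auto
        thus "C v0 \<le> c" by (simp add: c_def add_increasing2)
      qed simp
      finally show ?thesis by (simp add: i t_def)
    next
      case False
      have "norm (fourier_transform \<psi> \<mu> y) \<le> (\<integral>x. norm (\<psi> (dot y x)) \<partial>\<mu>)"
        unfolding fourier_transform_def by (rule integral_norm_bound)
      also have "\<dots> = measure \<mu> (space \<mu>)" by simp
      also have "\<dots> \<le> c * 1" using C_sum by (simp add: c_def)
      also have "\<dots> \<le> c * max_norm y powr (- (1 / real k))"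
        using False t C_sum by (intro mult_left_mono one_le_powr_nonpos)
          (auto simp: i c_def t_def[symmetric] add_nonneg_nonneg)
      finally show ?thesis .
    qed
  qed
  thus ?thesis by blast
qed

end

theorem theorem3p11:
  fixes M S :: "('k::nonarch_local_field ^ 'n) set"
    and k :: nat
    and \<psi> :: "'k \<Rightarrow> complex"
    and \<nu> :: "('k ^ 'd) measure"
    and \<mu> :: "('k ^ 'n) measure"
  assumes "additive_character \<psi>"
    and "\<forall>x\<in>maximal_ideal. \<psi> x = 1"
    and "\<exists>x\<in>valuation_ring. \<psi> x \<noteq> 1"
    and "analytic_manifold TYPE('d) M"
    and "finite_type TYPE('d) M"
    and "compact S" and "openin (top_of_set M) S"
    and "k > 0" and "has_type TYPE('d) S k"
    and "CHAR('k) = 0 \<or> CHAR('k) > k"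
    and "normalized_haar \<nu>"
    and "induced_measure \<nu> S \<mu>"
  shows "(fourier_transform \<psi> \<mu> \<longlongrightarrow> 0) (filtercomap max_norm at_top) \<and>
    (\<exists>c::real. \<forall>y. y \<noteq> 0 \<longrightarrow>
       norm (fourier_transform \<psi> \<mu> y) \<le> c * max_norm y powr (- (1 / real k)))"
proof -
  interpret nontrivial_character \<psi>
    using assms(1-3) by unfold_locales
  have type_le: "\<forall>x\<in>S. type_le_at TYPE('d) S x k"
    using assms(9) by (simp add: has_type_def)
  have char: "\<forall>j. 1 \<le> j \<longrightarrow> j \<le> k \<longrightarrow> of_nat j \<noteq> (0 :: 'k)"
    using assms(10) by (auto simp: of_nat_eq_0_iff_char_dvd dest: dvd_imp_le)
  obtain c where c: "\<And>y. y \<noteq> 0 \<Longrightarrow>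
      norm (fourier_transform \<psi> \<mu> y) \<le> c * max_norm y powr (- (1 / real k))"
    using fourier_transform_bound[OF assms(11,12,6) type_le char] by blast
  have "(fourier_transform \<psi> \<mu> \<longlongrightarrow> 0) (filtercomap max_norm at_top)"
  proof (rule Lim_null_comparison)
    have "\<forall>\<^sub>F y in filtercomap max_norm at_top. max_norm (y :: 'k ^ 'n) > 0"
      by (intro eventually_filtercomapI eventually_gt_at_top)
    thus "\<forall>\<^sub>F y in filtercomap max_norm at_top.
        norm (fourier_transform \<psi> \<mu> y) \<le> c * max_norm y powr (- (1 / real k))"
    proof eventually_elim
      case (elim y)
      have "y \<noteq> 0" using elim by (auto simp: max_norm_def)
      thus ?case by (rule c)
    qed
    have "((\<lambda>y :: 'k ^ 'n. max_norm y powr (- (1 / real k))) \<longlongrightarrow> 0) (filtercomap max_norm at_top)"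
      using assms(8) by (intro tendsto_neg_powr filterlim_filtercomap) auto
    thus "((\<lambda>y :: 'k ^ 'n. c * max_norm y powr (- (1 / real k))) \<longlongrightarrow> 0) (filtercomap max_norm at_top)"
      by (rule tendsto_mult_right_zero)
  qed
  thus ?thesis using c by blast
qed

end
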